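(* For every $\epsilon>0$ and all Gaussian measures $\mu_0,\mu_1$ on $\mathcal H$, $S^\epsilon_{d^2}(\mu_0,\mu_1)\ge0$, and $S^\epsilon_{d^2}(\mu_0,\mu_1)=0$ if and only if $\mu_0=\mu_1$.
   Context: $\mathcal H$ real separable Hilbert space; Gaussian measures $\mathcal N(m,C)$ with $C$ positive trace class (possibly singular). $\mathrm{OT}^\epsilon_{d^2}(\mu,\nu)=\min_{\gamma\in\mathrm{Joint}(\mu,\nu)}\{\int\|x-y\|^2d\gamma+\epsilon\mathrm{KL}(\gamma\|\mu\otimes\nu)\}$; $S^\epsilon_{d^2}(\mu,\nu)=\mathrm{OT}^\epsilon_{d^2}(\mu,\nu)-\frac12(\mathrm{OT}^\epsilon_{d^2}(\mu,\mu)+\mathrm{OT}^\epsilon_{d^2}(\nu,\nu))$. *)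

theory Defs
  imports "HOL-Probability.Probability"
begin

text \<open>Gaussian (Borel probability) measure on a real separable Hilbert space:
  every one-dimensional projection x \<mapsto> h \<bullet> x is a (possibly degenerate) Gaussian on the real line.
  This is the class of measures N(m,C), m \<in> H, C positive self-adjoint trace class.\<close>
definition gaussian_measure :: "('a::{real_inner,polish_space}) measure \<Rightarrow> bool" where
  "gaussian_measure \<mu> \<longleftrightarrow> sets \<mu> = sets borel \<and> prob_space \<mu> \<and>
     (\<forall>h::'a. (\<exists>m \<sigma>. \<sigma> > 0 \<and> distr \<mu> borel (\<lambda>x. h \<bullet> x) = density lborel (normal_density m \<sigma>))
              \<or> (\<exists>m. distr \<mu> borel (\<lambda>x. h \<bullet> x) = return borel m))"

definition Joint :: "'a measure \<Rightarrow> 'b measure \<Rightarrow> ('a \<times> 'b) measure set" where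
  "Joint \<mu> \<nu> = {\<gamma>. sets \<gamma> = sets (\<mu> \<Otimes>\<^sub>M \<nu>) \<and> prob_space \<gamma> \<and>
                  distr \<gamma> \<mu> fst = \<mu> \<and> distr \<gamma> \<nu> snd = \<nu>}"

definition KL :: "'a measure \<Rightarrow> 'a measure \<Rightarrow> ereal" where
  "KL \<gamma> \<pi> = (if absolutely_continuous \<pi> \<gamma> then
      (let f = (\<lambda>x. enn2real (RN_deriv \<pi> \<gamma> x)); g = (\<lambda>x. f x * ln (f x)) in
        enn2ereal (\<integral>\<^sup>+ x. ennreal (max 0 (g x)) \<partial>\<pi>) - enn2ereal (\<integral>\<^sup>+ x. ennreal (max 0 (- g x)) \<partial>\<pi>))
     else \<infinity>)"

definition OT_eps :: "real \<Rightarrow> ('a::real_normed_vector) measure \<Rightarrow> 'a measure \<Rightarrow> ereal" where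
  "OT_eps \<epsilon> \<mu> \<nu> = (INF \<gamma>\<in>Joint \<mu> \<nu>.
      enn2ereal (\<integral>\<^sup>+ z. ennreal ((norm (fst z - snd z))\<^sup>2) \<partial>\<gamma>) + ereal \<epsilon> * KL \<gamma> (\<mu> \<Otimes>\<^sub>M \<nu>))"

definition sinkhorn :: "real \<Rightarrow> ('a::real_normed_vector) measure \<Rightarrow> 'a measure \<Rightarrow> ereal" where
  "sinkhorn \<epsilon> \<mu> \<nu> = OT_eps \<epsilon> \<mu> \<nu> - (OT_eps \<epsilon> \<mu> \<mu> + OT_eps \<epsilon> \<nu> \<nu>) / 2"

end

(* The Gaussian kernel k(x,y) = exp(-|x-y|^2/eps) is positive definite on a Hilbert space. For every
   probability measure mu with finite second moment there is u > 0 with u(x) * (integral of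
   k(x,y) u(y) dmu(y)) = 1 for every x: the potential of u mu minimises the strongly convex functional
   |w|^2/2 - integral of ln w dmu in the reproducing kernel Hilbert space of k. Then
   u(x) u(y) k(x,y) is the density of a coupling of mu with itself, and
   OT(mu,mu) = 2 eps * integral of ln u dmu. If v is the function belonging to nu, then testing the
   dual problem of OT(mu,nu) with the suboptimal pair (eps ln u, eps ln v) gives
   S(mu,nu) >= eps (1 - <u mu, v nu>_k), which is nonnegative by Cauchy-Schwarz, as u mu and v nu have
   energy 1. If S(mu,nu) = 0 then u mu - v nu has energy 0, so both measures have the same
   potential 1/u = 1/v; hence the Laplace transforms of u exp(-|x|^2/eps) mu and u exp(-|x|^2/eps) nu
   agree, and mu = nu. Gaussianity enters only through the finiteness of second moments. *)
theory Submission
  imports Defs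
begin

text \<open>The Hilbert space of the kernel is never constructed. It is seen only through measures
  with nonnegative densities, and the main tool is one inequality: the energy of
  \<open>f \<mu> - g \<nu> + t \<delta>_z\<close> is nonnegative. For t = 0 it is Cauchy-Schwarz;
  the Dirac mass turns closeness in energy into closeness of potentials at z, uniformly in z. A
  minimising sequence thus gets a limit without completing a space and without compactness. The
  limit density may be unbounded, hence pairings with values in [0, infinity]. The self problem is
  posed because symmetry leaves a single unknown w, and the logarithm in the functional keeps w from
  vanishing. Its Euler equation must hold at every point, not almost everywhere: two Gaussian
  measures can be mutually singular, and then equations valid up to null sets of each would not
  allow the two potentials to be compared. The defect 1 - <u mu, v nu>_k in the dual bound appears
  because u(x) v(y) k(x,y) need not have total mass 1; for mu = nu the mass is 1 and the bound is
  exact.\<close>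

section \<open>Parseval sequences in separable Hilbert spaces\<close>

text \<open>Since \<open>sgn 0 = 0\<close>, a \<open>d n\<close> that depends linearly on its
  predecessors yields a zero term. The sequence is orthonormal up to such zeros, and no case split
  on the dimension is needed.\<close>

fun gram_schmidt_seq :: "(nat \<Rightarrow> 'a::real_inner) \<Rightarrow> nat \<Rightarrow> 'a" where
  "gram_schmidt_seq d n =
     sgn (d n - (\<Sum>i<n. (gram_schmidt_seq d i \<bullet> d n) *\<^sub>R gram_schmidt_seq d i))"

declare gram_schmidt_seq.simps [simp del]

lemma gram_schmidt_seq_norm:
  "gram_schmidt_seq d i = 0 \<or> gram_schmidt_seq d i \<bullet> gram_schmidt_seq d i = 1"
proof -
  obtain r where "gram_schmidt_seq d i = sgn r" using gram_schmidt_seq.simps by blast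
  then show ?thesis by (cases "r = 0") (simp_all add: norm_eq_1[symmetric] norm_sgn)
qed

lemma gram_schmidt_seq_orthogonal:
  "i < j \<Longrightarrow> gram_schmidt_seq d i \<bullet> gram_schmidt_seq d j = 0"
proof (induction j arbitrary: i rule: less_induct)
  case (less j)
  let ?e = "gram_schmidt_seq d"
  have orth: "?e i \<bullet> ?e l = 0" if "l < j" "l \<noteq> i" for l
    using less that by (metis inner_commute linorder_neqE_nat)
  have nrm: "?e i = 0 \<or> ?e i \<bullet> ?e i = 1"
    by (rule gram_schmidt_seq_norm)
  have "?e i \<bullet> (\<Sum>l<j. (?e l \<bullet> d j) *\<^sub>R ?e l) = (\<Sum>l<j. (?e l \<bullet> d j) * (?e i \<bullet> ?e l))"
    by (simp add: inner_sum_right)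
  also have "\<dots> = (\<Sum>l<j. if l = i then (?e i \<bullet> d j) * (?e i \<bullet> ?e i) else 0)"
    using orth by (intro sum.cong) auto
  also have "\<dots> = (?e i \<bullet> d j) * (?e i \<bullet> ?e i)"
    using less.prems by simp
  also have "\<dots> = ?e i \<bullet> d j" using nrm by auto
  finally have "?e i \<bullet> (d j - (\<Sum>l<j. (?e l \<bullet> d j) *\<^sub>R ?e l)) = 0"
    by (simp add: inner_diff_right)
  then show ?case
    by (subst (2) gram_schmidt_seq.simps) (simp add: sgn_div_norm)
qed

text \<open>Pythagoras, one coordinate at a time; zero terms change neither side. Bessel's
  inequality is a by-product, the left side being a square.\<close>

lemma gram_schmidt_seq_residual_norm:
  fixes d :: "nat \<Rightarrow> 'a::real_inner"
  defines "e \<equiv> gram_schmidt_seq d"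
  shows "(norm (x - (\<Sum>i<n. (e i \<bullet> x) *\<^sub>R e i)))\<^sup>2 = (norm x)\<^sup>2 - (\<Sum>i<n. (e i \<bullet> x)\<^sup>2)"
proof (induction n)
  case (Suc n)
  let ?r = "x - (\<Sum>i<n. (e i \<bullet> x) *\<^sub>R e i)"
  have "e n \<bullet> (\<Sum>i<n. (e i \<bullet> x) *\<^sub>R e i) = (\<Sum>i<n. (e i \<bullet> x) * (e n \<bullet> e i))"
    by (simp add: inner_sum_right)
  also have "\<dots> = 0"
    using gram_schmidt_seq_orthogonal[of _ n d]
    by (intro sum.neutral) (auto simp: e_def inner_commute)
  finally have r: "e n \<bullet> ?r = e n \<bullet> x" by (simp add: inner_diff_right)
  have "(norm (x - (\<Sum>i<Suc n. (e i \<bullet> x) *\<^sub>R e i)))\<^sup>2 = (norm (?r - (e n \<bullet> x) *\<^sub>R e n))\<^sup>2"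
    by (simp add: algebra_simps)
  also have "\<dots> = (norm ?r)\<^sup>2 - 2 * (e n \<bullet> x) * (e n \<bullet> ?r) + (e n \<bullet> x)\<^sup>2 * (e n \<bullet> e n)"
    unfolding power2_norm_eq_inner
    by (simp add: inner_diff_left inner_diff_right inner_commute algebra_simps power2_eq_square)
  also have "\<dots> = (norm ?r)\<^sup>2 - (e n \<bullet> x)\<^sup>2"
    using gram_schmidt_seq_norm[of d n] unfolding r
    by (auto simp: power2_eq_square e_def[symmetric])
  finally show ?case using Suc by simp
qed simp

text \<open>The residual of \<open>d m\<close> after m steps is a multiple of \<open>e m\<close>
  with coefficient its own norm, so the next step removes it. Later terms can only lower the
  residual norm, which is already 0.\<close>

lemma gram_schmidt_seq_spans:
  fixes d :: "nat \<Rightarrow> 'a::real_inner"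
  defines "e \<equiv> gram_schmidt_seq d"
  assumes "m < n"
  shows "(\<Sum>i<n. (e i \<bullet> d m) *\<^sub>R e i) = d m"
proof -
  let ?R = "\<lambda>n. (norm (d m - (\<Sum>i<n. (e i \<bullet> d m) *\<^sub>R e i)))\<^sup>2"
  let ?r = "d m - (\<Sum>i<m. (e i \<bullet> d m) *\<^sub>R e i)"
  have em: "e m = sgn ?r" unfolding e_def by (subst gram_schmidt_seq.simps) simp
  have "e m \<bullet> (\<Sum>i<m. (e i \<bullet> d m) *\<^sub>R e i) = (\<Sum>i<m. (e i \<bullet> d m) * (e m \<bullet> e i))"
    by (simp add: inner_sum_right)
  also have "\<dots> = 0"
    using gram_schmidt_seq_orthogonal[of _ m d]
    by (intro sum.neutral) (auto simp: e_def inner_commute)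
  finally have "e m \<bullet> d m = e m \<bullet> ?r" by (simp add: inner_diff_right)
  also have "\<dots> = norm ?r" unfolding em
    by (cases "?r = 0") (simp_all add: sgn_div_norm dot_square_norm power2_eq_square)
  finally have emd: "e m \<bullet> d m = norm ?r" .
  have "?R (Suc m) = 0"
    using emd unfolding e_def by (simp only: gram_schmidt_seq_residual_norm) (simp add: gram_schmidt_seq_residual_norm)
  moreover have "(\<Sum>i<Suc m. (e i \<bullet> d m)\<^sup>2) \<le> (\<Sum>i<n. (e i \<bullet> d m)\<^sup>2)"
    using assms(2) by (intro sum_mono2) auto
  then have "?R n \<le> ?R (Suc m)"
    unfolding e_def gram_schmidt_seq_residual_norm by linarith
  ultimately have "?R n = 0" by (smt (verit) zero_le_power2)
  then show ?thesis by simp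
qed

lemma dense_sequence_exists:
  "\<exists>d::nat \<Rightarrow> 'a::{metric_space,second_countable_topology}. \<forall>x r. r > 0 \<longrightarrow> (\<exists>n. dist (d n) x < r)"
proof -
  obtain B :: "'a set" where B: "countable B" "\<And>X. open X \<Longrightarrow> X \<noteq> {} \<Longrightarrow> \<exists>d\<in>B. d \<in> X"
    using countable_dense_setE by blast
  have ne: "B \<noteq> {}" using B(2)[of UNIV] by auto
  show ?thesis
  proof (rule exI[of _ "from_nat_into B"], intro allI impI)
    fix x :: 'a and r :: real assume "0 < r"
    then obtain b where "b \<in> B" "b \<in> ball x r" using B(2)[of "ball x r"] by auto
    then show "\<exists>n. dist (from_nat_into B n) x < r"
      using from_nat_into_surj[OF B(1)] by (metis dist_commute mem_ball)
  qed
qed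

text \<open>The residual map is linear, does not increase norms and kills \<open>d m\<close> as soon
  as n > m. A point within r of \<open>d m\<close> therefore has residual below r, and the
  \<open>d m\<close> are dense.\<close>

lemma parseval_sequence_exists:
  "\<exists>e::nat \<Rightarrow> 'a::{real_inner,second_countable_topology}. \<forall>x.
     (\<lambda>n. \<Sum>i<n. (e i \<bullet> x)\<^sup>2) \<longlonglongrightarrow> (norm x)\<^sup>2 \<and> (\<forall>n. (\<Sum>i<n. (e i \<bullet> x)\<^sup>2) \<le> (norm x)\<^sup>2)"
proof -
  obtain d :: "nat \<Rightarrow> 'a" where d: "\<And>x r. r > 0 \<Longrightarrow> \<exists>n. dist (d n) x < r"
    using dense_sequence_exists by blast
  define e where "e = gram_schmidt_seq d"
  note res = gram_schmidt_seq_residual_norm[of _ d, folded e_def]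
  show ?thesis
  proof (rule exI[of _ e], rule allI)
    fix x :: 'a
    have le: "(\<Sum>i<n. (e i \<bullet> x)\<^sup>2) \<le> (norm x)\<^sup>2" for n
      using res[of x n] by (smt (verit) zero_le_power2)
    have R: "norm (y - (\<Sum>i<n. (e i \<bullet> y) *\<^sub>R e i)) \<le> norm y" for y n
    proof (rule power2_le_imp_le[OF _ norm_ge_zero])
      have "0 \<le> (\<Sum>i<n. (e i \<bullet> y)\<^sup>2)" by (simp add: sum_nonneg)
      then show "(norm (y - (\<Sum>i<n. (e i \<bullet> y) *\<^sub>R e i)))\<^sup>2 \<le> (norm y)\<^sup>2"
        using res[of y n] by linarith
    qed
    have "(\<lambda>n. norm (x - (\<Sum>i<n. (e i \<bullet> x) *\<^sub>R e i))) \<longlonglongrightarrow> 0"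
    proof (rule LIMSEQ_I)
      fix r :: real assume "r > 0"
      then obtain m where m: "dist (d m) x < r" using d by blast
      have "norm (norm (x - (\<Sum>i<n. (e i \<bullet> x) *\<^sub>R e i)) - 0) < r" if "n \<ge> Suc m" for n
      proof -
        have "(\<Sum>i<n. (e i \<bullet> d m) *\<^sub>R e i) = d m"
          using gram_schmidt_seq_spans[of m n d] that by (simp add: e_def)
        then have "x - (\<Sum>i<n. (e i \<bullet> x) *\<^sub>R e i)
            = (x - d m) - (\<Sum>i<n. (e i \<bullet> (x - d m)) *\<^sub>R e i)"
          by (simp add: inner_diff_right scaleR_left_diff_distrib sum_subtractf)
        then have "norm (x - (\<Sum>i<n. (e i \<bullet> x) *\<^sub>R e i)) \<le> norm (x - d m)"
          using R[of "x - d m" n] by metis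
        then show ?thesis using m by (simp add: dist_norm norm_minus_commute)
      qed
      then show "\<exists>N. \<forall>n\<ge>N. norm (norm (x - (\<Sum>i<n. (e i \<bullet> x) *\<^sub>R e i)) - 0) < r" by blast
    qed
    from tendsto_power[OF this, of 2]
    have "(\<lambda>n. (norm x)\<^sup>2 - (\<Sum>i<n. (e i \<bullet> x)\<^sup>2)) \<longlonglongrightarrow> 0"
      by (simp only: res) simp
    from tendsto_diff[OF tendsto_const[of "(norm x)\<^sup>2"] this]
    show "(\<lambda>n. \<Sum>i<n. (e i \<bullet> x)\<^sup>2) \<longlonglongrightarrow> (norm x)\<^sup>2 \<and>
        (\<forall>n. (\<Sum>i<n. (e i \<bullet> x)\<^sup>2) \<le> (norm x)\<^sup>2)" using le by simp
  qed
qed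

section \<open>Second moments of Gaussian measures\<close>

lemma normal_raw_moments:
  assumes "\<sigma> > 0"
  shows "has_bochner_integral lborel (\<lambda>y. normal_density m \<sigma> y * y\<^sup>2) (\<sigma>\<^sup>2 + m\<^sup>2)"
    and "has_bochner_integral lborel (\<lambda>y. normal_density m \<sigma> y * y ^ 4)
           (3 * \<sigma> ^ 4 + 6 * m\<^sup>2 * \<sigma>\<^sup>2 + m ^ 4)"
proof -
  have 0: "has_bochner_integral lborel (\<lambda>y. normal_density m \<sigma> y) 1"
    using normal_moment_even[OF assms, of m 0] by simp
  have 1: "has_bochner_integral lborel (\<lambda>y. normal_density m \<sigma> y * (y - m)) 0"
    using normal_moment_odd[OF assms, of m 0] by simp
  have 2: "has_bochner_integral lborel (\<lambda>y. normal_density m \<sigma> y * (y - m)\<^sup>2) (\<sigma>\<^sup>2)"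
    using normal_moment_even[OF assms, of m 1] by (simp add: fact_numeral)
  have 3: "has_bochner_integral lborel (\<lambda>y. normal_density m \<sigma> y * (y - m) ^ 3) 0"
    using normal_moment_odd[OF assms, of m 1] by (simp add: numeral_3_eq_3)
  have 4: "has_bochner_integral lborel (\<lambda>y. normal_density m \<sigma> y * (y - m) ^ 4) (3 * \<sigma> ^ 4)"
    using normal_moment_even[OF assms, of m 2] assms
    by (simp add: fact_numeral field_simps power2_eq_square power4_eq_xxxx)
  show "has_bochner_integral lborel (\<lambda>y. normal_density m \<sigma> y * y\<^sup>2) (\<sigma>\<^sup>2 + m\<^sup>2)"
    using has_bochner_integral_add[OF has_bochner_integral_add[OF 2
        has_bochner_integral_mult_right[OF 1, of "2 * m"]]
        has_bochner_integral_mult_right[OF 0, of "m\<^sup>2"]]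
    by (rule has_bochner_integral_cong[THEN iffD1, rotated 3])
       (auto simp: algebra_simps power2_eq_square)
  show "has_bochner_integral lborel (\<lambda>y. normal_density m \<sigma> y * y ^ 4)
           (3 * \<sigma> ^ 4 + 6 * m\<^sup>2 * \<sigma>\<^sup>2 + m ^ 4)"
    using has_bochner_integral_add[OF has_bochner_integral_add[OF has_bochner_integral_add[OF
        has_bochner_integral_add[OF 4 has_bochner_integral_mult_right[OF 3, of "4 * m"]]
        has_bochner_integral_mult_right[OF 2, of "6 * m\<^sup>2"]]
        has_bochner_integral_mult_right[OF 1, of "4 * m ^ 3"]]
        has_bochner_integral_mult_right[OF 0, of "m ^ 4"]]
    by (rule has_bochner_integral_cong[THEN iffD1, rotated 3])
       (auto simp: algebra_simps power2_eq_square power3_eq_cube power4_eq_xxxx)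
qed

text \<open>The factor 3 is the kurtosis of a centred normal law. A mean m only helps: the right
  side exceeds the left by 2 m^4.\<close>

lemma gaussian_measure_projection_moments:
  fixes \<mu> :: "'a::{real_inner,polish_space} measure"
  assumes "gaussian_measure \<mu>"
  shows "integrable \<mu> (\<lambda>x. (h \<bullet> x)\<^sup>2)" and "integrable \<mu> (\<lambda>x. (h \<bullet> x) ^ 4)"
    and "(\<integral>x. (h \<bullet> x) ^ 4 \<partial>\<mu>) \<le> 3 * (\<integral>x. (h \<bullet> x)\<^sup>2 \<partial>\<mu>)\<^sup>2"
proof -
  have sets: "sets \<mu> = sets borel" using assms by (simp add: gaussian_measure_def)
  have meas [measurable]: "(\<lambda>x. h \<bullet> x) \<in> \<mu> \<rightarrow>\<^sub>M borel"
    unfolding measurable_cong_sets[OF sets refl] by measurable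
  let ?D = "distr \<mu> borel (\<lambda>x. h \<bullet> x)"
  have "\<exists>a b. has_bochner_integral ?D (\<lambda>y. y\<^sup>2) a \<and> has_bochner_integral ?D (\<lambda>y. y ^ 4) b \<and> b \<le> 3 * a\<^sup>2"
  proof -
    consider m \<sigma> where "\<sigma> > 0" "?D = density lborel (normal_density m \<sigma>)"
      | m where "?D = return borel m"
      using assms unfolding gaussian_measure_def by blast
    then show ?thesis
    proof cases
      case 1
      have "has_bochner_integral ?D (\<lambda>y. y\<^sup>2) (\<sigma>\<^sup>2 + m\<^sup>2)"
        unfolding 1(2) using normal_raw_moments(1)[OF 1(1), of m]
        by (intro has_bochner_integral_density) auto
      moreover have "has_bochner_integral ?D (\<lambda>y. y ^ 4) (3 * \<sigma> ^ 4 + 6 * m\<^sup>2 * \<sigma>\<^sup>2 + m ^ 4)"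
        unfolding 1(2) using normal_raw_moments(2)[OF 1(1), of m]
        by (intro has_bochner_integral_density) auto
      moreover have "3 * \<sigma> ^ 4 + 6 * m\<^sup>2 * \<sigma>\<^sup>2 + m ^ 4 \<le> 3 * (\<sigma>\<^sup>2 + m\<^sup>2)\<^sup>2"
        using zero_le_power2[of "m\<^sup>2"] by (simp add: power2_eq_square power4_eq_xxxx algebra_simps)
      ultimately show ?thesis by blast
    next
      case 2
      interpret R: prob_space "return borel m" by (rule prob_space_return) simp
      have "integrable (return borel m) (\<lambda>y. y ^ k)" for k
        by (rule integrable_cong_AE_imp[where g="\<lambda>_. m ^ k"])
           (auto simp: AE_return measurable_compose)
      then have "has_bochner_integral ?D (\<lambda>y. y ^ k) (m ^ k)" for k
        unfolding 2 by (simp add: has_bochner_integral_iff integral_return)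
      moreover have "m ^ 4 \<le> 3 * (m\<^sup>2)\<^sup>2"
        using zero_le_power2[of "m\<^sup>2"] by (simp add: power2_eq_square power4_eq_xxxx algebra_simps)
      ultimately show ?thesis by blast
    qed
  qed
  then obtain a b where "has_bochner_integral ?D (\<lambda>y. y\<^sup>2) a"
    "has_bochner_integral ?D (\<lambda>y. y ^ 4) b" "b \<le> 3 * a\<^sup>2" by blast
  then have "has_bochner_integral \<mu> (\<lambda>x. (h \<bullet> x)\<^sup>2) a" "has_bochner_integral \<mu> (\<lambda>x. (h \<bullet> x) ^ 4) b" "b \<le> 3 * a\<^sup>2"
    by (auto simp: has_bochner_integral_iff integrable_distr_eq integral_distr)
  then show "integrable \<mu> (\<lambda>x. (h \<bullet> x)\<^sup>2)" "integrable \<mu> (\<lambda>x. (h \<bullet> x) ^ 4)"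
    "(\<integral>x. (h \<bullet> x) ^ 4 \<partial>\<mu>) \<le> 3 * (\<integral>x. (h \<bullet> x)\<^sup>2 \<partial>\<mu>)\<^sup>2"
    by (auto simp: has_bochner_integral_iff)
qed

text \<open>With v the second moment, Cauchy-Schwarz bounds the left side by sqrt (3 v^2 * prob A),
  and 1/12 is the probability that makes this v / 2. The proof uses the corresponding pointwise
  Young inequality.\<close>

lemma (in prob_space) second_moment_on_small_event:
  fixes X :: "'a \<Rightarrow> real"
  assumes int2: "integrable M (\<lambda>x. (X x)\<^sup>2)" and int4: "integrable M (\<lambda>x. X x ^ 4)"
    and hyper: "expectation (\<lambda>x. X x ^ 4) \<le> 3 * (expectation (\<lambda>x. (X x)\<^sup>2))\<^sup>2"
    and A: "A \<in> events" "prob A \<le> 1 / 12"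
  shows "expectation (\<lambda>x. indicator A x * (X x)\<^sup>2) \<le> expectation (\<lambda>x. (X x)\<^sup>2) / 2"
proof -
  let ?v = "expectation (\<lambda>x. (X x)\<^sup>2)"
  have intA: "integrable M (\<lambda>x. indicator A x * (X x)\<^sup>2)"
    using integrable_mult_indicator[OF A(1) int2] by simp
  have v0: "?v \<ge> 0" by (simp add: integral_nonneg_AE)
  show ?thesis
  proof (cases "?v = 0")
    case True
    have "expectation (\<lambda>x. indicator A x * (X x)\<^sup>2) \<le> ?v"
      using intA int2 by (intro integral_mono) (auto simp: indicator_def)
    then show ?thesis using True by simp
  next
    case False
    with v0 have v: "?v > 0" by linarith
    \<comment> \<open>Expand (X^2 - 6 v)^2 >= 0 and divide by 12 v. The centre 6 v makes each of the
      two terms integrate to at most v / 4.\<close>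
    have pt: "indicator A x * (X x)\<^sup>2 \<le> X x ^ 4 / (12 * ?v) + 3 * ?v * indicator A x" for x
    proof (cases "x \<in> A")
      case True
      have "0 \<le> (((X x)\<^sup>2 - 6 * ?v)\<^sup>2) / (12 * ?v)" using v by simp
      also have "\<dots> = X x ^ 4 / (12 * ?v) + 3 * ?v - (X x)\<^sup>2"
        using v by (simp add: field_simps power2_eq_square power4_eq_xxxx)
      finally show ?thesis using True by simp
    qed (use v in simp)
    have "expectation (\<lambda>x. indicator A x * (X x)\<^sup>2) \<le>
        expectation (\<lambda>x. X x ^ 4 / (12 * ?v) + 3 * ?v * indicator A x)"
      using intA int4 A pt
      by (intro integral_mono Bochner_Integration.integrable_add integrable_divide
            integrable_mult_right integrable_indicator) (auto simp: less_top[symmetric])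
    also have "\<dots> = expectation (\<lambda>x. X x ^ 4) / (12 * ?v) + 3 * ?v * prob A"
      using int4 A by (subst Bochner_Integration.integral_add) (auto simp: less_top[symmetric])
    also have "\<dots> \<le> (3 * ?v\<^sup>2) / (12 * ?v) + 3 * ?v * (1 / 12)"
      using v hyper A by (intro add_mono divide_right_mono mult_left_mono) auto
    also have "\<dots> = ?v / 2" using v by (simp add: field_simps power2_eq_square)
    finally show ?thesis .
  qed
qed

text \<open>Off an event of probability at most 1/12 the norm is bounded, and on that event
  hypercontractivity of the projections lets it carry at most half of each partial sum of the
  second moment. So the partial sums are bounded uniformly in the number of coordinates.\<close>
lemma gaussian_measure_second_moment:
  fixes \<mu> :: "'a::{real_inner,polish_space} measure"
  assumes G: "gaussian_measure \<mu>"
  shows "integrable \<mu> (\<lambda>x. (norm x)\<^sup>2)"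
proof -
  have sets [measurable_cong]: "sets \<mu> = sets borel" using G by (simp add: gaussian_measure_def)
  then have space: "space \<mu> = UNIV" using sets_eq_imp_space_eq by fastforce
  interpret prob_space \<mu> using G by (simp add: gaussian_measure_def)
  obtain e :: "nat \<Rightarrow> 'a" where lim: "\<And>x. (\<lambda>n. \<Sum>i<n. (e i \<bullet> x)\<^sup>2) \<longlonglongrightarrow> (norm x)\<^sup>2"
    and le: "\<And>x n. (\<Sum>i<n. (e i \<bullet> x)\<^sup>2) \<le> (norm x)\<^sup>2"
    using parseval_sequence_exists by blast
  define A where "A n = {x::'a. (norm x)\<^sup>2 > real n}" for n
  have A [measurable]: "A n \<in> events" for n unfolding A_def by measurable
  have "(\<lambda>n. prob (A n)) \<longlonglongrightarrow> prob (\<Inter>n. A n)"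
    by (rule finite_Lim_measure_decseq) (use A in \<open>auto simp: A_def decseq_def\<close>)
  moreover have "(\<Inter>n. A n) = {}"
  proof -
    have "x \<notin> (\<Inter>n. A n)" for x
      using real_arch_simple[of "(norm x)\<^sup>2"] by (auto simp: A_def not_less)
    then show ?thesis by blast
  qed
  ultimately have "(\<lambda>n. prob (A n)) \<longlonglongrightarrow> 0" by simp
  then have "eventually (\<lambda>n. prob (A n) < 1 / 12) sequentially"
    by (rule order_tendstoD) simp
  then obtain N where N: "prob (A N) < 1 / 12" by (auto simp: eventually_sequentially)
  note mom = gaussian_measure_projection_moments[OF G]
  have bound: "expectation (\<lambda>x. \<Sum>i<n. (e i \<bullet> x)\<^sup>2) \<le> 2 * real N" for n
  proof -
    let ?S = "\<lambda>x. \<Sum>i<n. (e i \<bullet> x)\<^sup>2"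
    have intA: "integrable \<mu> (\<lambda>x. indicator (A N) x * (h \<bullet> x)\<^sup>2)" for h
      using integrable_mult_indicator[OF A mom(1)] by simp
    have pt: "?S x \<le> real N + (\<Sum>i<n. indicator (A N) x * (e i \<bullet> x)\<^sup>2)" for x
      using le[of x n] by (cases "x \<in> A N") (auto simp: A_def)
    have "expectation ?S \<le> expectation (\<lambda>x. real N + (\<Sum>i<n. indicator (A N) x * (e i \<bullet> x)\<^sup>2))"
      using pt mom(1) intA
      by (intro integral_mono Bochner_Integration.integrable_add Bochner_Integration.integrable_sum) auto
    also have "\<dots> = real N + (\<Sum>i<n. expectation (\<lambda>x. indicator (A N) x * (e i \<bullet> x)\<^sup>2))"
      using intA
      by (subst Bochner_Integration.integral_add, simp, intro Bochner_Integration.integrable_sum, simp)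
         (subst Bochner_Integration.integral_sum, auto simp: prob_space simp del: sum_mult_indicator)
    also have "\<dots> \<le> real N + (\<Sum>i<n. expectation (\<lambda>x. (e i \<bullet> x)\<^sup>2) / 2)"
      using second_moment_on_small_event[OF mom A[of N]] N by (intro add_left_mono sum_mono) auto
    also have "\<dots> = real N + expectation ?S / 2"
      using mom(1) by (simp add: sum_divide_distrib)
    \<comment> \<open>The inequality S <= N + S / 2 is solved for S. The bound does not involve n,
      so Fatou's lemma applies next.\<close>
    finally show ?thesis by simp
  qed
  have "(\<integral>\<^sup>+x. ennreal ((norm x)\<^sup>2) \<partial>\<mu>) = (\<integral>\<^sup>+x. liminf (\<lambda>n. ennreal (\<Sum>i<n. (e i \<bullet> x)\<^sup>2)) \<partial>\<mu>)"
    by (intro nn_integral_cong lim_imp_Liminf[symmetric] tendsto_ennrealI lim) simp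
  also have "\<dots> \<le> liminf (\<lambda>n. \<integral>\<^sup>+x. ennreal (\<Sum>i<n. (e i \<bullet> x)\<^sup>2) \<partial>\<mu>)"
    by (rule nn_integral_liminf) measurable
  also have "\<dots> \<le> liminf (\<lambda>n::nat. ennreal (2 * real N))"
    using bound mom(1)
    by (intro Liminf_mono always_eventually allI)
       (subst nn_integral_eq_integral, auto intro!: sum_nonneg ennreal_leI)
  also have "\<dots> < \<infinity>" by (simp add: Liminf_const)
  finally show ?thesis by (intro integrableI_nonneg) auto
qed

section \<open>Positive definiteness of the Gaussian kernel\<close>

text \<open>The Gibbs kernel exp (- cost / epsilon) of the entropic problem: an optimal coupling is
  expected to have a density u(x) v(y) k(x,y).\<close>

definition gauss_kernel :: "real \<Rightarrow> 'a::real_inner \<Rightarrow> 'a \<Rightarrow> real" where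
  "gauss_kernel \<epsilon> x y = exp (- (norm (x - y))\<^sup>2 / \<epsilon>)"

lemma gauss_kernel_pos: "gauss_kernel \<epsilon> x y > 0"
  by (simp add: gauss_kernel_def)

lemma gauss_kernel_le_1: "\<epsilon> > 0 \<Longrightarrow> gauss_kernel \<epsilon> x y \<le> 1"
  by (simp add: gauss_kernel_def)

lemma gauss_kernel_self: "gauss_kernel \<epsilon> x x = 1"
  by (simp add: gauss_kernel_def)

lemma gauss_kernel_commute: "gauss_kernel \<epsilon> x y = gauss_kernel \<epsilon> y x"
  by (simp add: gauss_kernel_def norm_minus_commute)

lemma gauss_kernel_measurable [measurable (raw)]:
  fixes f g :: "'b \<Rightarrow> 'a::{real_inner,polish_space}"
  assumes [measurable]: "f \<in> M \<rightarrow>\<^sub>M borel" "g \<in> M \<rightarrow>\<^sub>M borel"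
  shows "(\<lambda>x. gauss_kernel \<epsilon> (f x) (g x)) \<in> borel_measurable M"
  unfolding gauss_kernel_def by measurable

text \<open>Used twice: the last factor expands into powers of the inner product, which gives
  positive definiteness, and it is the integrand of a Laplace transform.\<close>

lemma gauss_kernel_factor:
  "gauss_kernel \<epsilon> x y = exp (- (norm x)\<^sup>2 / \<epsilon>) * exp (- (norm y)\<^sup>2 / \<epsilon>) * exp (2 * (x \<bullet> y) / \<epsilon>)"
  unfolding gauss_kernel_def mult_exp_exp power2_norm_eq_inner
  by (simp add: inner_diff_left inner_diff_right inner_commute add_divide_distrib diff_divide_distrib)

section \<open>Finite-rank kernels and positive definiteness\<close>

text \<open>Kernels of the form sum of phi_i(x) phi_i(y). In inductive form the closure under
  products, Schur's theorem, is an induction without index bookkeeping.\<close>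

inductive finite_rank_kernel :: "('a::topological_space \<Rightarrow> 'a \<Rightarrow> real) \<Rightarrow> bool" where
  finite_rank_zero: "finite_rank_kernel (\<lambda>x y. 0)"
| finite_rank_add_term: "finite_rank_kernel \<kappa> \<Longrightarrow> \<phi> \<in> borel_measurable borel \<Longrightarrow>
    finite_rank_kernel (\<lambda>x y. \<phi> x * \<phi> y + \<kappa> x y)"

lemma finite_rank_single:
  "\<phi> \<in> borel_measurable borel \<Longrightarrow> finite_rank_kernel (\<lambda>x y. \<phi> x * \<phi> y)"
  using finite_rank_add_term[OF finite_rank_zero, of \<phi>] by simp

lemma finite_rank_add:
  "finite_rank_kernel \<kappa> \<Longrightarrow> finite_rank_kernel \<kappa>' \<Longrightarrow> finite_rank_kernel (\<lambda>x y. \<kappa> x y + \<kappa>' x y)"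
proof (induction rule: finite_rank_kernel.induct)
  case (finite_rank_add_term \<kappa> \<phi>)
  from finite_rank_kernel.finite_rank_add_term[OF finite_rank_add_term(3)[OF finite_rank_add_term(4)]
      finite_rank_add_term(2)]
  show ?case by (simp add: add.assoc)
qed simp

lemma finite_rank_sum:
  "(\<And>i. i < (n::nat) \<Longrightarrow> finite_rank_kernel (\<kappa> i)) \<Longrightarrow> finite_rank_kernel (\<lambda>x y. \<Sum>i<n. \<kappa> i x y)"
  by (induction n) (auto intro: finite_rank_add finite_rank_zero)

lemma finite_rank_mult_single:
  assumes "finite_rank_kernel \<kappa>" "\<phi> \<in> borel_measurable borel"
  shows "finite_rank_kernel (\<lambda>x y. (\<phi> x * \<phi> y) * \<kappa> x y)"
  using assms
proof (induction rule: finite_rank_kernel.induct)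
  case (finite_rank_add_term \<kappa> \<psi>)
  then have "finite_rank_kernel (\<lambda>x y. (\<phi> x * \<psi> x) * (\<phi> y * \<psi> y) + (\<phi> x * \<phi> y) * \<kappa> x y)"
    by (intro finite_rank_kernel.intros) auto
  then show ?case by (simp add: algebra_simps)
qed (simp add: finite_rank_zero)

lemma finite_rank_mult:
  "finite_rank_kernel \<kappa> \<Longrightarrow> finite_rank_kernel \<kappa>' \<Longrightarrow> finite_rank_kernel (\<lambda>x y. \<kappa> x y * \<kappa>' x y)"
proof (induction rule: finite_rank_kernel.induct)
  case (finite_rank_add_term \<kappa> \<phi>)
  then have "finite_rank_kernel (\<lambda>x y. (\<phi> x * \<phi> y) * \<kappa>' x y + \<kappa> x y * \<kappa>' x y)"
    by (intro finite_rank_add finite_rank_mult_single) auto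
  then show ?case by (simp add: algebra_simps)
qed (simp add: finite_rank_zero)

lemma finite_rank_const: "c \<ge> 0 \<Longrightarrow> finite_rank_kernel (\<lambda>x y. c)"
  using finite_rank_single[of "\<lambda>x. sqrt c"] by simp

lemma finite_rank_power: "finite_rank_kernel \<kappa> \<Longrightarrow> finite_rank_kernel (\<lambda>x y. \<kappa> x y ^ n)"
  by (induction n) (auto intro: finite_rank_const finite_rank_mult)

lemma finite_rank_diag_nonneg: "finite_rank_kernel \<kappa> \<Longrightarrow> \<kappa> x x \<ge> 0"
  by (induction rule: finite_rank_kernel.induct) auto

text \<open>\<open>L\<close> is the functional \<open>f \<mu> - g \<nu> + t \<delta>\<^sub>z\<close> on bounded functions, and \<open>bm\<close>
  stands for bounded measurable.\<close>
locale signed_functional =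
  \<mu>: prob_space \<mu> + \<nu>: prob_space \<nu> for \<mu> \<nu> :: "'a::{real_inner,polish_space} measure" +
  fixes f g :: "'a \<Rightarrow> real" and C t :: real and z :: 'a
  assumes sets_\<mu> [measurable_cong]: "sets \<mu> = sets borel"
    and sets_\<nu> [measurable_cong]: "sets \<nu> = sets borel"
    and f_meas [measurable]: "f \<in> borel_measurable borel"
    and g_meas [measurable]: "g \<in> borel_measurable borel"
    and f_bound: "\<And>x. \<bar>f x\<bar> \<le> C" and g_bound: "\<And>x. \<bar>g x\<bar> \<le> C"
begin

definition bm :: "('a \<Rightarrow> real) \<Rightarrow> bool" where
  "bm h \<longleftrightarrow> h \<in> borel_measurable borel \<and> (\<exists>D. \<forall>x. \<bar>h x\<bar> \<le> D)"

definition L :: "('a \<Rightarrow> real) \<Rightarrow> real" where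
  "L h = (\<integral>x. f x * h x \<partial>\<mu>) - (\<integral>x. g x * h x \<partial>\<nu>) + t * h z"

lemma bmI: "h \<in> borel_measurable borel \<Longrightarrow> (\<And>x. \<bar>h x\<bar> \<le> D) \<Longrightarrow> bm h"
  unfolding bm_def by blast

lemma C_nonneg: "C \<ge> 0"
  using f_bound[of undefined] by linarith

lemma bm_add:
  assumes "bm h" "bm k"
  shows "bm (\<lambda>x. h x + k x)"
proof -
  obtain D D' where "\<And>x. \<bar>h x\<bar> \<le> D" "\<And>x. \<bar>k x\<bar> \<le> D'" using assms unfolding bm_def by blast
  then have "\<bar>h x + k x\<bar> \<le> D + D'" for x by (meson abs_triangle_ineq add_mono order_trans)
  then show ?thesis using assms by (intro bmI) (auto simp: bm_def)
qed

lemma bm_cmult: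
  assumes "bm h"
  shows "bm (\<lambda>x. c * h x)"
proof -
  obtain D where "\<And>x. \<bar>h x\<bar> \<le> D" using assms unfolding bm_def by blast
  then have "\<bar>c * h x\<bar> \<le> \<bar>c\<bar> * D" for x by (simp add: abs_mult mult_left_mono)
  then show ?thesis using assms by (intro bmI) (auto simp: bm_def)
qed

lemma bm_integrable:
  assumes "bm h"
  shows "integrable \<mu> (\<lambda>x. f x * h x)" "integrable \<nu> (\<lambda>x. g x * h x)"
proof -
  obtain D where D: "\<And>x. \<bar>h x\<bar> \<le> D" and [measurable]: "h \<in> borel_measurable borel"
    using assms unfolding bm_def by blast
  show "integrable \<mu> (\<lambda>x. f x * h x)"
    by (rule \<mu>.integrable_const_bound[of _ "C * D"])
       (use D f_bound C_nonneg in \<open>auto simp: abs_mult intro!: AE_I2 mult_mono\<close>)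
  show "integrable \<nu> (\<lambda>x. g x * h x)"
    by (rule \<nu>.integrable_const_bound[of _ "C * D"])
       (use D g_bound C_nonneg in \<open>auto simp: abs_mult intro!: AE_I2 mult_mono\<close>)
qed

lemma L_add: "bm h \<Longrightarrow> bm k \<Longrightarrow> L (\<lambda>x. h x + k x) = L h + L k"
  using bm_integrable[of h] bm_integrable[of k] by (simp add: L_def algebra_simps)

lemma L_cmult: "L (\<lambda>x. c * h x) = c * L h"
proof -
  have "(\<integral>x. f x * (c * h x) \<partial>\<mu>) = c * (\<integral>x. f x * h x \<partial>\<mu>)"
    by (subst integral_mult_right_zero[symmetric]) (simp add: algebra_simps)
  moreover have "(\<integral>x. g x * (c * h x) \<partial>\<nu>) = c * (\<integral>x. g x * h x \<partial>\<nu>)"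
    by (subst integral_mult_right_zero[symmetric]) (simp add: algebra_simps)
  ultimately show ?thesis by (simp add: L_def algebra_simps)
qed

lemma L_bound:
  assumes "bm h" "\<And>x. \<bar>h x\<bar> \<le> D"
  shows "\<bar>L h\<bar> \<le> (2 * C + \<bar>t\<bar>) * D"
proof -
  have "\<bar>\<integral>x. f x * h x \<partial>\<mu>\<bar> \<le> (\<integral>x. C * D \<partial>\<mu>)"
  proof (rule order_trans[OF integral_abs_bound integral_mono])
    show "integrable \<mu> (\<lambda>x. \<bar>f x * h x\<bar>)" using bm_integrable[OF assms(1)] by (intro integrable_abs)
    show "\<bar>f x * h x\<bar> \<le> C * D" for x
      using assms(2) f_bound C_nonneg by (auto simp: abs_mult intro!: mult_mono)
  qed simp
  moreover have "\<bar>\<integral>x. g x * h x \<partial>\<nu>\<bar> \<le> (\<integral>x. C * D \<partial>\<nu>)"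
  proof (rule order_trans[OF integral_abs_bound integral_mono])
    show "integrable \<nu> (\<lambda>x. \<bar>g x * h x\<bar>)" using bm_integrable[OF assms(1)] by (intro integrable_abs)
    show "\<bar>g x * h x\<bar> \<le> C * D" for x
      using assms(2) g_bound C_nonneg by (auto simp: abs_mult intro!: mult_mono)
  qed simp
  moreover have "\<bar>t * h z\<bar> \<le> \<bar>t\<bar> * D"
    using assms by (auto simp: abs_mult intro!: mult_left_mono)
  ultimately show ?thesis
    unfolding L_def by (simp add: \<mu>.prob_space \<nu>.prob_space algebra_simps)
qed

lemma L_measurable:
  assumes [measurable]: "case_prod \<kappa> \<in> borel_measurable (borel \<Otimes>\<^sub>M borel)"
  shows "(\<lambda>x. L (\<kappa> x)) \<in> borel_measurable borel"
  unfolding L_def by measurable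

lemma L_tendsto:
  assumes "\<And>n. bm (h n)" "\<And>n x. \<bar>h n x\<bar> \<le> D" "\<And>x. (\<lambda>n. h n x) \<longlonglongrightarrow> k x"
  shows "(\<lambda>n. L (h n)) \<longlonglongrightarrow> L k"
proof -
  have [measurable]: "h n \<in> borel_measurable borel" for n using assms(1) by (simp add: bm_def)
  have [measurable]: "k \<in> borel_measurable borel"
    by (rule borel_measurable_LIMSEQ_real[where u=h]) (auto intro: assms(3))
  have "(\<lambda>n. \<integral>x. f x * h n x \<partial>\<mu>) \<longlonglongrightarrow> (\<integral>x. f x * k x \<partial>\<mu>)"
    by (rule integral_dominated_convergence[where w="\<lambda>_. C * D"])
       (use assms f_bound C_nonneg in \<open>auto simp: abs_mult intro!: AE_I2 mult_mono tendsto_intros\<close>)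
  moreover have "(\<lambda>n. \<integral>x. g x * h n x \<partial>\<nu>) \<longlonglongrightarrow> (\<integral>x. g x * k x \<partial>\<nu>)"
    by (rule integral_dominated_convergence[where w="\<lambda>_. C * D"])
       (use assms g_bound C_nonneg in \<open>auto simp: abs_mult intro!: AE_I2 mult_mono tendsto_intros\<close>)
  ultimately show ?thesis unfolding L_def by (intro tendsto_intros assms(3))
qed

lemma bm_section:
  assumes "case_prod \<kappa> \<in> borel_measurable (borel \<Otimes>\<^sub>M borel)" "\<And>x y. \<bar>\<kappa> x y\<bar> \<le> D"
  shows "bm (\<kappa> x)"
  using measurable_Pair2[OF assms(1), of x] assms(2) by (intro bmI) auto

lemma bm_L:
  assumes "case_prod \<kappa> \<in> borel_measurable (borel \<Otimes>\<^sub>M borel)" "\<And>x y. \<bar>\<kappa> x y\<bar> \<le> D"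
  shows "bm (\<lambda>x. L (\<kappa> x))"
  using L_measurable[OF assms(1)] L_bound[OF bm_section[OF assms] assms(2)] by (rule bmI)

text \<open>Applying \<open>L\<close> in both variables gives the sum of the squares (L phi_i)^2. A
  bound on the diagonal is enough for integrability, because phi_i(x)^2 <= kappa(x,x) <= D for each
  i.\<close>

lemma LL_finite_rank_nonneg:
  assumes "finite_rank_kernel \<kappa>" "\<And>x. \<kappa> x x \<le> D"
  shows "(\<forall>x. bm (\<kappa> x)) \<and> bm (\<lambda>x. L (\<kappa> x)) \<and> L (\<lambda>x. L (\<kappa> x)) \<ge> 0"
  using assms
proof (induction arbitrary: D rule: finite_rank_kernel.induct)
  case finite_rank_zero
  have "L (\<lambda>x. 0) = 0" by (simp add: L_def)
  then show ?case by (auto intro: bmI)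
next
  case (finite_rank_add_term \<kappa> \<phi>)
  have d: "\<phi> x * \<phi> x + \<kappa> x x \<le> D" for x using finite_rank_add_term by simp
  have D: "\<kappa> x x \<le> D" for x using d[of x] zero_le_square[of "\<phi> x"] by linarith
  have "(\<phi> x)\<^sup>2 \<le> D" for x
    using d[of x] finite_rank_diag_nonneg[OF finite_rank_add_term(1)]
    by (simp add: power2_eq_square) (smt (verit))
  then have "\<bar>\<phi> x\<bar> \<le> sqrt D" for x using real_le_rsqrt by fastforce
  then have bm\<phi>: "bm \<phi>" using finite_rank_add_term(2) by (intro bmI)
  note IH = finite_rank_add_term(3)[OF D]
  have 1: "bm (\<lambda>y. \<phi> x * \<phi> y + \<kappa> x y)" for x
    using IH bm\<phi> by (intro bm_add bm_cmult) auto
  have 2: "L (\<lambda>y. \<phi> x * \<phi> y + \<kappa> x y) = L \<phi> * \<phi> x + L (\<kappa> x)" for x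
    using IH bm\<phi> by (subst L_add) (auto intro: bm_cmult simp: L_cmult)
  have "L (\<lambda>x. L \<phi> * \<phi> x + L (\<kappa> x)) = L \<phi> * L \<phi> + L (\<lambda>x. L (\<kappa> x))"
    using IH bm\<phi> by (subst L_add) (auto intro: bm_cmult simp: L_cmult)
  then show ?case unfolding 2
    using 1 IH bm\<phi> by (auto intro: bm_add bm_cmult)
qed

lemma LL_tendsto:
  assumes "\<And>n. case_prod (\<kappa> n) \<in> borel_measurable (borel \<Otimes>\<^sub>M borel)"
    and "\<And>n x y. \<bar>\<kappa> n x y\<bar> \<le> D" "\<And>x y. (\<lambda>n. \<kappa> n x y) \<longlonglongrightarrow> \<kappa>' x y"
  shows "(\<lambda>n. L (\<lambda>x. L (\<kappa> n x))) \<longlonglongrightarrow> L (\<lambda>x. L (\<kappa>' x))"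
proof (rule L_tendsto)
  show "bm (\<lambda>x. L (\<kappa> n x))" for n by (rule bm_L) (use assms in auto)
  have bs: "bm (\<kappa> n x)" for n x by (rule bm_section) (use assms in auto)
  show "\<bar>L (\<kappa> n x)\<bar> \<le> (2 * C + \<bar>t\<bar>) * D" for n x by (rule L_bound) (use assms bs in auto)
  show "(\<lambda>n. L (\<kappa> n x)) \<longlonglongrightarrow> L (\<kappa>' x)" for x by (rule L_tendsto) (use assms bs in auto)
qed

text \<open>Two limits of finite-rank kernels: n truncates the exponential series, m the Parseval
  sum for the inner product. The weights \<open>w\<close> keep all kernels within [-1, 1], so
  dominated convergence passes nonnegativity to both limits.\<close>

lemma LL_gauss_kernel_nonneg:
  assumes "\<epsilon> > 0"
  shows "L (\<lambda>x. L (gauss_kernel \<epsilon> x)) \<ge> 0"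
proof -
  obtain e :: "nat \<Rightarrow> 'a" where lim: "\<And>x. (\<lambda>n. \<Sum>i<n. (e i \<bullet> x)\<^sup>2) \<longlonglongrightarrow> (norm x)\<^sup>2"
    and le: "\<And>x n. (\<Sum>i<n. (e i \<bullet> x)\<^sup>2) \<le> (norm x)\<^sup>2"
    using parseval_sequence_exists by blast
  define s where "s m x y = (\<Sum>i<m. (e i \<bullet> x) * (e i \<bullet> y))" for m x y
  define w where "w x = exp (- (norm x)\<^sup>2 / \<epsilon>)" for x :: 'a
  define K where "K m n x y = (w x * w y) * (\<Sum>j<n. (2 / \<epsilon> * s m x y) ^ j / fact j)" for m n x y
  define K' where "K' m x y = (w x * w y) * exp (2 / \<epsilon> * s m x y)" for m x y
  have [measurable]: "w \<in> borel_measurable borel" unfolding w_def by measurable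
  have smeas [measurable]: "(\<lambda>p. s m (fst p) (snd p)) \<in> borel_measurable (borel \<Otimes>\<^sub>M borel)" for m
    unfolding s_def by measurable
  have s_bound: "2 * \<bar>s m x y\<bar> \<le> (norm x)\<^sup>2 + (norm y)\<^sup>2" for m x y
  proof -
    have "2 * \<bar>s m x y\<bar> \<le> (\<Sum>i<m. 2 * \<bar>(e i \<bullet> x) * (e i \<bullet> y)\<bar>)"
      unfolding s_def by (subst sum_distrib_left[symmetric]) (auto intro: sum_abs)
    also have "\<dots> \<le> (\<Sum>i<m. (e i \<bullet> x)\<^sup>2 + (e i \<bullet> y)\<^sup>2)"
    proof (rule sum_mono)
      show "2 * \<bar>(e i \<bullet> x) * (e i \<bullet> y)\<bar> \<le> (e i \<bullet> x)\<^sup>2 + (e i \<bullet> y)\<^sup>2" for i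
        using sum_squares_bound[of "\<bar>e i \<bullet> x\<bar>" "\<bar>e i \<bullet> y\<bar>"] by (simp add: abs_mult)
    qed
    also have "\<dots> \<le> (norm x)\<^sup>2 + (norm y)\<^sup>2"
      using le[of x m] le[of y m] by (simp add: sum.distrib)
    finally show ?thesis .
  qed
  have w_bound: "(w x * w y) * exp (2 / \<epsilon> * \<bar>s m x y\<bar>) \<le> 1" for m x y
  proof -
    have "(w x * w y) * exp (2 / \<epsilon> * \<bar>s m x y\<bar>)
        = exp ((2 * \<bar>s m x y\<bar> - (norm x)\<^sup>2 - (norm y)\<^sup>2) / \<epsilon>)"
      unfolding w_def mult_exp_exp by (simp add: diff_divide_distrib)
    also have "\<dots> \<le> 1" using s_bound[of m x y] assms by (simp add: divide_le_0_iff)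
    finally show ?thesis .
  qed
  have exp_lim: "(\<lambda>n. \<Sum>j<n. a ^ j / fact j) \<longlonglongrightarrow> exp a" for a :: real
    using exp_converges[of a] by (simp add: sums_def divide_inverse_commute)
  \<comment> \<open>For negative a a partial sum may exceed exp a, so the bound uses exp |a|; this
    is why \<open>w_bound\<close> is stated with |s|.\<close>
  have part: "\<bar>\<Sum>j<n. a ^ j / fact j\<bar> \<le> exp \<bar>a\<bar>" for a :: real and n
  proof -
    have "\<bar>\<Sum>j<n. a ^ j / fact j\<bar> \<le> (\<Sum>j<n. \<bar>a\<bar> ^ j / fact j)"
      by (rule order_trans[OF sum_abs]) (simp add: power_abs)
    also have "\<dots> \<le> exp \<bar>a\<bar>"
      by (rule LIMSEQ_le_const[OF exp_lim]) (auto intro!: exI[of _ n] sum_mono2)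
    finally show ?thesis .
  qed
  have w_pos: "w x > 0" for x by (simp add: w_def)
  have K_bound: "\<bar>K m n x y\<bar> \<le> 1" for m n x y
  proof -
    have "\<bar>K m n x y\<bar> = (w x * w y) * \<bar>\<Sum>j<n. (2 / \<epsilon> * s m x y) ^ j / fact j\<bar>"
      using w_pos[of x] w_pos[of y] by (simp add: K_def abs_mult)
    also have "\<dots> \<le> (w x * w y) * exp \<bar>2 / \<epsilon> * s m x y\<bar>"
      using w_pos[of x] w_pos[of y] by (intro mult_left_mono part) simp
    also have "\<dots> \<le> 1" using w_bound[of x y m] assms by (simp add: abs_mult)
    finally show ?thesis .
  qed
  have K'_bound: "\<bar>K' m x y\<bar> \<le> 1" for m x y
  proof -
    have "\<bar>K' m x y\<bar> \<le> (w x * w y) * exp (2 / \<epsilon> * \<bar>s m x y\<bar>)"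
      unfolding K'_def abs_mult using w_pos[of x] w_pos[of y] assms
      by (auto intro!: mult_left_mono divide_right_mono)
    then show ?thesis using w_bound[of x y m] by linarith
  qed
  \<comment> \<open>Polarisation: the Parseval sums for x + y, x and y determine the one for the
    inner product.\<close>
  have s_lim: "(\<lambda>m. s m x y) \<longlonglongrightarrow> x \<bullet> y" for x y
  proof -
    have "(\<lambda>m. ((\<Sum>i<m. (e i \<bullet> (x + y))\<^sup>2) - (\<Sum>i<m. (e i \<bullet> x)\<^sup>2) - (\<Sum>i<m. (e i \<bullet> y)\<^sup>2)) / 2)
        \<longlonglongrightarrow> ((norm (x + y))\<^sup>2 - (norm x)\<^sup>2 - (norm y)\<^sup>2) / 2"
      by (intro tendsto_intros lim) simp
    also have "(\<lambda>m. ((\<Sum>i<m. (e i \<bullet> (x + y))\<^sup>2) - (\<Sum>i<m. (e i \<bullet> x)\<^sup>2) - (\<Sum>i<m. (e i \<bullet> y)\<^sup>2)) / 2)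
        = (\<lambda>m. s m x y)"
      unfolding s_def
      by (simp add: sum_subtractf[symmetric] inner_add_right power2_sum sum_distrib_left[symmetric] mult.assoc)
    also have "((norm (x + y))\<^sup>2 - (norm x)\<^sup>2 - (norm y)\<^sup>2) / 2 = x \<bullet> y"
      by (simp add: power2_norm_eq_inner inner_add_left inner_add_right inner_commute)
    finally show ?thesis .
  qed
  have fr: "finite_rank_kernel (K m n)" for m n
  proof -
    have "finite_rank_kernel (s m)" unfolding s_def
      by (intro finite_rank_sum finite_rank_single) measurable
    then have "finite_rank_kernel (\<lambda>x y. (2 / \<epsilon> * s m x y) ^ j * (1 / fact j))" for j
      using assms by (intro finite_rank_mult finite_rank_power finite_rank_const) auto
    then show ?thesis unfolding K_def
      by (intro finite_rank_mult_single finite_rank_sum) auto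
  qed
  have "L (\<lambda>x. L (K' m x)) \<ge> 0" for m
  proof (rule LIMSEQ_le_const)
    show "(\<lambda>n. L (\<lambda>x. L (K m n x))) \<longlonglongrightarrow> L (\<lambda>x. L (K' m x))"
    proof (rule LL_tendsto)
      show "case_prod (K m n) \<in> borel_measurable (borel \<Otimes>\<^sub>M borel)" for n
        unfolding K_def split_beta' by measurable
      show "(\<lambda>n. K m n x y) \<longlonglongrightarrow> K' m x y" for x y
        unfolding K_def K'_def by (intro tendsto_intros exp_lim)
    qed (rule K_bound)
    have "K m n x x \<le> 1" for n x using K_bound[of m n x x] by linarith
    then show "\<exists>N. \<forall>n\<ge>N. 0 \<le> L (\<lambda>x. L (K m n x))"
      using LL_finite_rank_nonneg[OF fr] by blast
  qed
  moreover have "(\<lambda>m. L (\<lambda>x. L (K' m x))) \<longlonglongrightarrow> L (\<lambda>x. L (gauss_kernel \<epsilon> x))"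
  proof (rule LL_tendsto)
    show "case_prod (K' m) \<in> borel_measurable (borel \<Otimes>\<^sub>M borel)" for m
      unfolding K'_def split_beta' by measurable
    have "(\<lambda>m. K' m x y) \<longlonglongrightarrow> (w x * w y) * exp (2 / \<epsilon> * (x \<bullet> y))" for x y
      unfolding K'_def by (intro tendsto_intros s_lim)
    then show "(\<lambda>m. K' m x y) \<longlonglongrightarrow> gauss_kernel \<epsilon> x y" for x y
      by (simp add: gauss_kernel_factor w_def)
  qed (rule K'_bound)
  ultimately show ?thesis by (intro LIMSEQ_le_const) auto
qed

end

section \<open>Potentials and pairings with values in [0, infinity]\<close>

text \<open>\<open>ennreal\<close> values, because the densities 1 / w obtained later need not be
  bounded.\<close>

definition kernel_potential ::
  "real \<Rightarrow> 'a::{real_inner,polish_space} measure \<Rightarrow> ('a \<Rightarrow> real) \<Rightarrow> 'a \<Rightarrow> ennreal" where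
  "kernel_potential \<epsilon> \<mu> f x = (\<integral>\<^sup>+y. ennreal (f y * gauss_kernel \<epsilon> x y) \<partial>\<mu>)"

definition kernel_pairing :: "real \<Rightarrow> 'a::{real_inner,polish_space} measure \<Rightarrow> ('a \<Rightarrow> real) \<Rightarrow>
    'a measure \<Rightarrow> ('a \<Rightarrow> real) \<Rightarrow> ennreal" where
  "kernel_pairing \<epsilon> \<mu> f \<nu> g = (\<integral>\<^sup>+x. ennreal (f x) * kernel_potential \<epsilon> \<nu> g x \<partial>\<mu>)"

lemma kernel_potential_measurable [measurable]:
  fixes \<mu> :: "'a::{real_inner,polish_space} measure"
  assumes "prob_space \<mu>" and [measurable_cong]: "sets \<mu> = sets borel"
    and [measurable]: "f \<in> borel_measurable borel"
  shows "kernel_potential \<epsilon> \<mu> f \<in> borel_measurable borel"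
proof -
  interpret prob_space \<mu> by fact
  show ?thesis unfolding kernel_potential_def[abs_def] by measurable
qed

lemma kernel_pairing_commute:
  fixes \<mu> \<nu> :: "'a::{real_inner,polish_space} measure"
  assumes "prob_space \<mu>" "prob_space \<nu>"
    and [measurable_cong]: "sets \<mu> = sets borel" "sets \<nu> = sets borel"
    and [measurable]: "f \<in> borel_measurable borel" "g \<in> borel_measurable borel"
    and nn: "\<And>x. f x \<ge> 0" "\<And>x. g x \<ge> 0"
  shows "kernel_pairing \<epsilon> \<mu> f \<nu> g = kernel_pairing \<epsilon> \<nu> g \<mu> f"
proof -
  interpret \<mu>: prob_space \<mu> by fact
  interpret \<nu>: prob_space \<nu> by fact
  interpret pair_sigma_finite \<mu> \<nu> ..
  have "kernel_pairing \<epsilon> \<mu> f \<nu> g = (\<integral>\<^sup>+x. \<integral>\<^sup>+y. ennreal (f x * g y * gauss_kernel \<epsilon> x y) \<partial>\<nu> \<partial>\<mu>)"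
    unfolding kernel_pairing_def kernel_potential_def
    by (subst nn_integral_cmult[symmetric]) (auto simp: ennreal_mult'[symmetric] nn mult.assoc)
  also have "\<dots> = (\<integral>\<^sup>+y. \<integral>\<^sup>+x. ennreal (f x * g y * gauss_kernel \<epsilon> x y) \<partial>\<mu> \<partial>\<nu>)"
    by (rule Fubini'[symmetric]) measurable
  also have "\<dots> = kernel_pairing \<epsilon> \<nu> g \<mu> f"
    unfolding kernel_pairing_def kernel_potential_def
    by (subst nn_integral_cmult[symmetric])
       (auto simp: ennreal_mult'[symmetric] nn mult_ac gauss_kernel_commute)
  finally show ?thesis .
qed

lemma kernel_potential_bounded:
  fixes \<mu> :: "'a::{real_inner,polish_space} measure"
  assumes "\<epsilon> > 0" "prob_space \<mu>" and [measurable_cong]: "sets \<mu> = sets borel"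
    and [measurable]: "f \<in> borel_measurable borel" and f: "\<And>x. f x \<ge> 0" "\<And>x. f x \<le> C"
  defines "F \<equiv> \<lambda>x. \<integral>y. f y * gauss_kernel \<epsilon> x y \<partial>\<mu>"
  shows "integrable \<mu> (\<lambda>y. f y * gauss_kernel \<epsilon> x y)"
    and "kernel_potential \<epsilon> \<mu> f x = ennreal (F x)" and "0 \<le> F x" and "F x \<le> C"
    and "F \<in> borel_measurable borel"
proof -
  interpret prob_space \<mu> by fact
  have bd: "f y * gauss_kernel \<epsilon> x y \<le> C" "0 \<le> f y * gauss_kernel \<epsilon> x y" for x y
    using f[of y] gauss_kernel_pos[of \<epsilon> x y] gauss_kernel_le_1[OF assms(1), of x y]
    by (auto intro: order_trans[OF mult_left_le])
  show int: "integrable \<mu> (\<lambda>y. f y * gauss_kernel \<epsilon> x y)" for x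
    by (rule integrable_const_bound[of _ C]) (use bd in auto)
  show "0 \<le> F x" unfolding F_def using bd by simp
  show "kernel_potential \<epsilon> \<mu> f x = ennreal (F x)" unfolding kernel_potential_def F_def
    using bd int by (intro nn_integral_eq_integral) auto
  have "F x \<le> (\<integral>y. C \<partial>\<mu>)" unfolding F_def using bd int by (intro integral_mono) auto
  then show "F x \<le> C" by (simp add: prob_space)
  show "F \<in> borel_measurable borel" unfolding F_def by measurable
qed

lemma kernel_pairing_bounded:
  fixes \<mu> \<nu> :: "'a::{real_inner,polish_space} measure"
  assumes "\<epsilon> > 0" "prob_space \<mu>" "prob_space \<nu>"
    and sets [measurable_cong]: "sets \<mu> = sets borel" "sets \<nu> = sets borel"
    and [measurable]: "f \<in> borel_measurable borel" "g \<in> borel_measurable borel"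
    and f: "\<And>x. f x \<ge> 0" "\<And>x. f x \<le> C" and g: "\<And>x. g x \<ge> 0" "\<And>x. g x \<le> D"
  defines "G \<equiv> \<lambda>x. \<integral>y. g y * gauss_kernel \<epsilon> x y \<partial>\<nu>"
  shows "integrable \<mu> (\<lambda>x. f x * G x)"
    and "kernel_pairing \<epsilon> \<mu> f \<nu> g = ennreal (\<integral>x. f x * G x \<partial>\<mu>)"
    and "0 \<le> (\<integral>x. f x * G x \<partial>\<mu>)"
proof -
  interpret prob_space \<mu> by fact
  have G_eq: "(\<integral>y. g y * gauss_kernel \<epsilon> x y \<partial>\<nu>) = G x" for x by (simp add: G_def)
  note G = kernel_potential_bounded[OF assms(1) assms(3) sets(2) assms(7) g, unfolded G_eq]
  have [measurable]: "G \<in> borel_measurable borel" by (rule G)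
  have bd: "f x * G x \<le> C * D" "0 \<le> f x * G x" for x
    using f[of x] G(3)[of x] G(4)[of x] by (auto intro!: mult_mono)
  show int: "integrable \<mu> (\<lambda>x. f x * G x)"
    by (rule integrable_const_bound[of _ "C * D"]) (use bd in auto)
  show "0 \<le> (\<integral>x. f x * G x \<partial>\<mu>)" using bd by simp
  have "kernel_pairing \<epsilon> \<mu> f \<nu> g = (\<integral>\<^sup>+x. ennreal (f x * G x) \<partial>\<mu>)"
    unfolding kernel_pairing_def G(2) by (simp add: ennreal_mult' f)
  also have "\<dots> = ennreal (\<integral>x. f x * G x \<partial>\<mu>)"
    using bd int by (intro nn_integral_eq_integral) auto
  finally show "kernel_pairing \<epsilon> \<mu> f \<nu> g = ennreal (\<integral>x. f x * G x \<partial>\<mu>)" .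
qed

text \<open>Positive definiteness applied to \<open>f \<mu> - g \<nu> + t \<delta>_z\<close>, with
  the negative terms moved to the left. The term t^2 is the energy of the Dirac mass, since k(z,z) =
  1.\<close>

lemma kernel_pairing_polarization_bounded:
  fixes \<mu> \<nu> :: "'a::{real_inner,polish_space} measure"
  assumes \<epsilon>: "\<epsilon> > 0" and prob: "prob_space \<mu>" "prob_space \<nu>"
    and sets: "sets \<mu> = sets borel" "sets \<nu> = sets borel"
    and meas: "f \<in> borel_measurable borel" "g \<in> borel_measurable borel"
    and f: "\<And>x. f x \<ge> 0" "\<And>x. f x \<le> C" and g: "\<And>x. g x \<ge> 0" "\<And>x. g x \<le> C" and t: "t \<ge> 0"
  shows "2 * kernel_pairing \<epsilon> \<mu> f \<nu> g + ennreal (2 * t) * kernel_potential \<epsilon> \<nu> g z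
    \<le> kernel_pairing \<epsilon> \<mu> f \<mu> f + kernel_pairing \<epsilon> \<nu> g \<nu> g
      + ennreal (2 * t) * kernel_potential \<epsilon> \<mu> f z + ennreal (t\<^sup>2)"
proof -
  interpret signed_functional \<mu> \<nu> f g C t z
    using assms by (auto simp: signed_functional_def signed_functional_axioms_def)
  let ?k = "gauss_kernel \<epsilon>"
  define F where "F x = (\<integral>y. f y * ?k x y \<partial>\<mu>)" for x
  define G where "G x = (\<integral>y. g y * ?k x y \<partial>\<nu>)" for x
  note F = kernel_potential_bounded[OF \<epsilon> prob(1) sets(1) meas(1) f, folded F_def]
  note G = kernel_potential_bounded[OF \<epsilon> prob(2) sets(2) meas(2) g, folded G_def]
  have bmF: "bm F" by (rule bmI[of F C]) (use F in auto)
  have bmG: "bm G" by (rule bmI[of G C]) (use G in auto)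
  have bmk: "bm (\<lambda>x. ?k x z)"
    by (rule bmI[of _ 1])
       (auto simp: gauss_kernel_le_1[OF \<epsilon>] abs_of_pos gauss_kernel_pos)
  \<comment> \<open>The potential of the signed measure; applying \<open>L\<close> once more gives
    its energy, whose mixed terms agree by symmetry of the kernel.\<close>
  have 1: "L (?k x) = F x + (- 1) * G x + t * ?k x z" for x
    by (simp add: L_def F_def G_def)
  have "L (\<lambda>x. L (?k x)) = L F - L G + t * L (\<lambda>x. ?k x z)"
    unfolding 1
    by (simp only: L_add[OF bm_add[OF bmF bm_cmult[OF bmG, of "-1"]] bm_cmult[OF bmk, of t]]
        L_add[OF bmF bm_cmult[OF bmG, of "-1"]] L_cmult)
  also have "L F = (\<integral>x. f x * F x \<partial>\<mu>) - (\<integral>x. g x * F x \<partial>\<nu>) + t * F z" by (simp add: L_def)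
  also have "L G = (\<integral>x. f x * G x \<partial>\<mu>) - (\<integral>x. g x * G x \<partial>\<nu>) + t * G z" by (simp add: L_def)
  also have "L (\<lambda>x. ?k x z) = F z - G z + t"
    by (simp add: L_def F_def G_def gauss_kernel_self gauss_kernel_commute[of \<epsilon> _ z])
  also have "(\<integral>x. g x * F x \<partial>\<nu>) = (\<integral>x. f x * G x \<partial>\<mu>)"
    using kernel_pairing_commute[OF prob sets meas f(1) g(1), of \<epsilon>]
      kernel_pairing_bounded[OF \<epsilon> prob sets meas f g]
      kernel_pairing_bounded[OF \<epsilon> prob(2) prob(1) sets(2) sets(1) meas(2) meas(1) g f]
    unfolding F_def G_def by simp
  finally have "0 \<le> (\<integral>x. f x * F x \<partial>\<mu>) - 2 * (\<integral>x. f x * G x \<partial>\<mu>) + (\<integral>x. g x * G x \<partial>\<nu>)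
      + 2 * t * F z - 2 * t * G z + t\<^sup>2"
    using LL_gauss_kernel_nonneg[OF \<epsilon>] by (simp add: algebra_simps power2_eq_square)
  then have "2 * (\<integral>x. f x * G x \<partial>\<mu>) + (2 * t) * G z \<le>
      (\<integral>x. f x * F x \<partial>\<mu>) + (\<integral>x. g x * G x \<partial>\<nu>) + (2 * t) * F z + t\<^sup>2"
    by linarith
  from ennreal_leI[OF this] show ?thesis
    using kernel_pairing_bounded[OF \<epsilon> prob sets meas f g]
      kernel_pairing_bounded[OF \<epsilon> prob(1) prob(1) sets(1) sets(1) meas(1) meas(1) f f]
      kernel_pairing_bounded[OF \<epsilon> prob(2) prob(2) sets(2) sets(2) meas(2) meas(2) g g] t F G
    unfolding F_def[symmetric] G_def[symmetric]
    by (simp add: ennreal_plus ennreal_mult)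
qed

lemma kernel_pairing_mono:
  assumes "\<And>x. 0 \<le> f x" "\<And>x. f x \<le> f' x" "\<And>x. 0 \<le> g x" "\<And>x. g x \<le> g' x"
  shows "kernel_potential \<epsilon> \<nu> g x \<le> kernel_potential \<epsilon> \<nu> g' x"
    and "kernel_pairing \<epsilon> \<mu> f \<nu> g \<le> kernel_pairing \<epsilon> \<mu> f' \<nu> g'"
proof -
  show pot: "kernel_potential \<epsilon> \<nu> g x \<le> kernel_potential \<epsilon> \<nu> g' x" for x
    unfolding kernel_potential_def using assms gauss_kernel_pos[of \<epsilon>]
    by (intro nn_integral_mono ennreal_leI mult_right_mono less_imp_le[OF gauss_kernel_pos]) auto
  show "kernel_pairing \<epsilon> \<mu> f \<nu> g \<le> kernel_pairing \<epsilon> \<mu> f' \<nu> g'"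
    unfolding kernel_pairing_def using assms by (intro nn_integral_mono mult_mono pot ennreal_leI) auto
qed

lemma ennreal_truncation:
  fixes a k :: real
  assumes "k \<ge> 0"
  shows "incseq (\<lambda>n. ennreal (min a (real n) * k))" "(\<lambda>n. ennreal (min a (real n) * k)) \<longlonglongrightarrow> ennreal (a * k)"
proof -
  show "incseq (\<lambda>n. ennreal (min a (real n) * k))"
    using assms by (auto intro!: incseq_SucI ennreal_leI mult_right_mono)
  obtain N where "a \<le> real N" using real_arch_simple by blast
  then have "\<forall>n\<ge>N. ennreal (min a (real n) * k) = ennreal (a * k)" by auto
  then show "(\<lambda>n. ennreal (min a (real n) * k)) \<longlonglongrightarrow> ennreal (a * k)"
    by (intro tendsto_eventually) (auto simp: eventually_sequentially)
qed

lemma kernel_potential_truncation: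
  fixes \<nu> :: "'a::{real_inner,polish_space} measure"
  assumes [measurable_cong]: "sets \<nu> = sets borel" and [measurable]: "g \<in> borel_measurable borel"
  shows "(\<lambda>n. kernel_potential \<epsilon> \<nu> (\<lambda>x. min (g x) (real n)) x) \<longlonglongrightarrow> kernel_potential \<epsilon> \<nu> g x"
  unfolding kernel_potential_def
  using ennreal_truncation[of "gauss_kernel \<epsilon> x _"]
  by (intro nn_integral_LIMSEQ) (auto simp: gauss_kernel_pos less_imp_le incseq_def le_fun_def)

lemma kernel_pairing_truncation:
  fixes \<mu> \<nu> :: "'a::{real_inner,polish_space} measure"
  assumes "prob_space \<mu>" "prob_space \<nu>"
    and sets [measurable_cong]: "sets \<mu> = sets borel" "sets \<nu> = sets borel"
    and [measurable]: "f \<in> borel_measurable borel" "g \<in> borel_measurable borel"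
    and nn: "\<And>x. f x \<ge> 0" "\<And>x. g x \<ge> 0"
  shows "(\<lambda>n. kernel_pairing \<epsilon> \<mu> (\<lambda>x. min (f x) (real n)) \<nu> (\<lambda>x. min (g x) (real n)))
    \<longlonglongrightarrow> kernel_pairing \<epsilon> \<mu> f \<nu> g"
  unfolding kernel_pairing_def
proof (rule nn_integral_LIMSEQ)
  show "incseq (\<lambda>n x. ennreal (min (f x) (real n)) * kernel_potential \<epsilon> \<nu> (\<lambda>x. min (g x) (real n)) x)"
    using nn by (auto simp: incseq_def le_fun_def intro!: mult_mono ennreal_leI kernel_pairing_mono)
  show "(\<lambda>x. ennreal (min (f x) (real n)) * kernel_potential \<epsilon> \<nu> (\<lambda>x. min (g x) (real n)) x)
      \<in> borel_measurable \<mu>" for n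
  proof -
    have [measurable]: "kernel_potential \<epsilon> \<nu> (\<lambda>x. min (g x) (real n)) \<in> borel_measurable borel"
      using assms by (intro kernel_potential_measurable) auto
    show ?thesis by measurable
  qed
  show "(\<lambda>n. ennreal (min (f x) (real n)) * kernel_potential \<epsilon> \<nu> (\<lambda>x. min (g x) (real n)) x)
      \<longlonglongrightarrow> ennreal (f x) * kernel_potential \<epsilon> \<nu> g x" for x
  proof -
    obtain N where "f x \<le> real N" using real_arch_simple by blast
    then have ev: "eventually (\<lambda>n. min (f x) (real n) = f x) sequentially"
      by (auto simp: eventually_sequentially intro!: exI[of _ N])
    have "(\<lambda>n. ennreal (f x) * kernel_potential \<epsilon> \<nu> (\<lambda>x. min (g x) (real n)) x)
      \<longlonglongrightarrow> ennreal (f x) * kernel_potential \<epsilon> \<nu> g x"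
      by (intro ennreal_tendsto_cmult kernel_potential_truncation sets) auto
    then show ?thesis
      by (rule Lim_transform_eventually) (use ev in \<open>auto elim: eventually_mono\<close>)
  qed
qed

text \<open>The energy of \<open>f \<mu> - g \<nu> + t \<delta>\<^sub>z\<close> is nonnegative; written without subtraction
  because each term may be infinite.\<close>
lemma kernel_pairing_polarization:
  fixes \<mu> \<nu> :: "'a::{real_inner,polish_space} measure"
  assumes \<epsilon>: "\<epsilon> > 0" and prob: "prob_space \<mu>" "prob_space \<nu>"
    and sets: "sets \<mu> = sets borel" "sets \<nu> = sets borel"
    and meas: "f \<in> borel_measurable borel" "g \<in> borel_measurable borel"
    and nn: "\<And>x. f x \<ge> 0" "\<And>x. g x \<ge> 0" and t: "t \<ge> 0"
  shows "2 * kernel_pairing \<epsilon> \<mu> f \<nu> g + ennreal (2 * t) * kernel_potential \<epsilon> \<nu> g z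
    \<le> kernel_pairing \<epsilon> \<mu> f \<mu> f + kernel_pairing \<epsilon> \<nu> g \<nu> g
      + ennreal (2 * t) * kernel_potential \<epsilon> \<mu> f z + ennreal (t\<^sup>2)"
\<comment> \<open>Both densities are cut off at n. On the right the cut-off terms are at most the
  full ones, so a limit is needed on the left only.\<close>
proof (rule LIMSEQ_le_const2)
  let ?f = "\<lambda>n x. min (f x) (real n)" and ?g = "\<lambda>n x. min (g x) (real n)"
  show "(\<lambda>n. 2 * kernel_pairing \<epsilon> \<mu> (?f n) \<nu> (?g n) + ennreal (2 * t) * kernel_potential \<epsilon> \<nu> (?g n) z)
    \<longlonglongrightarrow> 2 * kernel_pairing \<epsilon> \<mu> f \<nu> g + ennreal (2 * t) * kernel_potential \<epsilon> \<nu> g z"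
    using assms by (intro tendsto_add ennreal_tendsto_cmult kernel_pairing_truncation
        kernel_potential_truncation) auto
  have "2 * kernel_pairing \<epsilon> \<mu> (?f n) \<nu> (?g n) + ennreal (2 * t) * kernel_potential \<epsilon> \<nu> (?g n) z
    \<le> kernel_pairing \<epsilon> \<mu> f \<mu> f + kernel_pairing \<epsilon> \<nu> g \<nu> g
      + ennreal (2 * t) * kernel_potential \<epsilon> \<mu> f z + ennreal (t\<^sup>2)" for n
  proof -
    have "2 * kernel_pairing \<epsilon> \<mu> (?f n) \<nu> (?g n) + ennreal (2 * t) * kernel_potential \<epsilon> \<nu> (?g n) z
      \<le> kernel_pairing \<epsilon> \<mu> (?f n) \<mu> (?f n) + kernel_pairing \<epsilon> \<nu> (?g n) \<nu> (?g n)
        + ennreal (2 * t) * kernel_potential \<epsilon> \<mu> (?f n) z + ennreal (t\<^sup>2)"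
      by (rule kernel_pairing_polarization_bounded[where C="real n"]) (use assms in auto)
    also have "\<dots> \<le> kernel_pairing \<epsilon> \<mu> f \<mu> f + kernel_pairing \<epsilon> \<nu> g \<nu> g
      + ennreal (2 * t) * kernel_potential \<epsilon> \<mu> f z + ennreal (t\<^sup>2)"
      using nn by (intro add_mono mult_left_mono kernel_pairing_mono) auto
    finally show ?thesis .
  qed
  then show "\<exists>N. \<forall>n\<ge>N. 2 * kernel_pairing \<epsilon> \<mu> (?f n) \<nu> (?g n) + ennreal (2 * t) * kernel_potential \<epsilon> \<nu> (?g n) z
    \<le> kernel_pairing \<epsilon> \<mu> f \<mu> f + kernel_pairing \<epsilon> \<nu> g \<nu> g
      + ennreal (2 * t) * kernel_potential \<epsilon> \<mu> f z + ennreal (t\<^sup>2)" by blast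
qed

section \<open>Self potentials\<close>

text \<open>In the reproducing kernel Hilbert space of the Gaussian kernel the self potential
  corresponds to the minimiser \<open>w\<close> of \<open>|w|\<^sup>2/2 - \<integral> ln w \<partial>\<mu>\<close>, a strongly convex problem.
  \<open>G\<close> is this functional at \<open>w = K g\<close>, with \<open>g\<close> bounded and bounded away from 0.\<close>
locale self_transport = prob_space \<mu> for \<mu> :: "'a::{real_inner,polish_space} measure" +
  fixes \<epsilon> :: real
  assumes eps: "\<epsilon> > 0" and sets_\<mu> [measurable_cong]: "sets \<mu> = sets borel"
    and second_moment: "integrable \<mu> (\<lambda>x. (norm x)\<^sup>2)"
begin

abbreviation k :: "'a \<Rightarrow> 'a \<Rightarrow> real" where "k \<equiv> gauss_kernel \<epsilon>"

definition K :: "('a \<Rightarrow> real) \<Rightarrow> 'a \<Rightarrow> real" where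
  "K g x = (\<integral>y. g y * k x y \<partial>\<mu>)"

definition E :: "('a \<Rightarrow> real) \<Rightarrow> ('a \<Rightarrow> real) \<Rightarrow> real" where
  "E g h = (\<integral>x. g x * K h x \<partial>\<mu>)"

definition nb :: "('a \<Rightarrow> real) \<Rightarrow> bool" where
  "nb g \<longleftrightarrow> g \<in> borel_measurable borel \<and> (\<forall>x. 0 \<le> g x) \<and> (\<exists>C. \<forall>x. g x \<le> C)"

text \<open>The positive lower bound keeps \<open>K g\<close> away from 0 at a controlled rate, so
  that \<open>ln (K g x)\<close> is integrable and \<open>G\<close> meaningful.\<close>

definition adm :: "('a \<Rightarrow> real) \<Rightarrow> bool" where
  "adm g \<longleftrightarrow> nb g \<and> (\<exists>c>0. \<forall>x. c \<le> g x)"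

definition G :: "('a \<Rightarrow> real) \<Rightarrow> real" where
  "G g = E g g / 2 - (\<integral>x. ln (K g x) \<partial>\<mu>)"

lemma nbI: "g \<in> borel_measurable borel \<Longrightarrow> (\<And>x. 0 \<le> g x) \<Longrightarrow> (\<And>x. g x \<le> C) \<Longrightarrow> nb g"
  unfolding nb_def by blast

lemma nb_lin:
  assumes "nb g" "nb h" "s \<ge> 0" "t \<ge> 0"
  shows "nb (\<lambda>x. s * g x + t * h x)"
proof -
  obtain C D where "\<And>x. g x \<le> C" "\<And>x. h x \<le> D" using assms(1,2) unfolding nb_def by blast
  with assms show ?thesis
    by (intro nbI[of _ "s * C + t * D"]) (auto simp: nb_def intro!: add_mono mult_left_mono)
qed

lemma adm_lin:
  assumes "adm g" "nb h" "s > 0" "t \<ge> 0"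
  shows "adm (\<lambda>x. s * g x + t * h x)"
proof -
  obtain c where c: "c > 0" "\<And>x. c \<le> g x" using assms(1) unfolding adm_def by blast
  have "s * c \<le> s * g x + t * h x" for x
    using c(2)[of x] assms by (intro add_increasing2 mult_left_mono) (auto simp: nb_def)
  then show ?thesis
    using assms c(1) unfolding adm_def by (auto intro!: nb_lin exI[of _ "s * c"])
qed

lemma
  assumes "nb g"
  shows K_int: "integrable \<mu> (\<lambda>y. g y * k x y)"
    and K_pot: "kernel_potential \<epsilon> \<mu> g x = ennreal (K g x)"
    and K_nonneg: "0 \<le> K g x" and K_meas: "K g \<in> borel_measurable borel"
    and K_bdd: "\<exists>C. \<forall>x. K g x \<le> C"
proof -
  obtain C where g: "g \<in> borel_measurable borel" "\<And>x. 0 \<le> g x" "\<And>x. g x \<le> C"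
    using assms unfolding nb_def by blast
  note * = kernel_potential_bounded[OF eps prob_space_axioms sets_\<mu> g, folded K_def]
  show "integrable \<mu> (\<lambda>y. g y * k x y)" "kernel_potential \<epsilon> \<mu> g x = ennreal (K g x)"
    "0 \<le> K g x" "K g \<in> borel_measurable borel" "\<exists>C. \<forall>x. K g x \<le> C"
    using * by (auto simp: K_def[abs_def])
qed

lemma
  assumes "nb g" "nb h"
  shows E_int: "integrable \<mu> (\<lambda>x. g x * K h x)"
    and E_pair: "kernel_pairing \<epsilon> \<mu> g \<mu> h = ennreal (E g h)"
    and E_nonneg: "0 \<le> E g h" and E_sym: "E g h = E h g"
proof -
  obtain C D where g: "g \<in> borel_measurable borel" "\<And>x. 0 \<le> g x" "\<And>x. g x \<le> C"
    and h: "h \<in> borel_measurable borel" "\<And>x. 0 \<le> h x" "\<And>x. h x \<le> D"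
    using assms unfolding nb_def by blast
  note * = kernel_pairing_bounded[OF eps prob_space_axioms prob_space_axioms sets_\<mu> sets_\<mu>,
      folded K_def, folded E_def]
  show "integrable \<mu> (\<lambda>x. g x * K h x)" "kernel_pairing \<epsilon> \<mu> g \<mu> h = ennreal (E g h)" "0 \<le> E g h"
    using *[OF g(1) h(1) g(2,3) h(2,3)] by auto
  then show "E g h = E h g"
    using *[OF h(1) g(1) h(2,3) g(2,3)]
      kernel_pairing_commute[OF prob_space_axioms prob_space_axioms sets_\<mu> sets_\<mu> g(1) h(1) g(2) h(2), of \<epsilon>]
    by simp
qed

lemma K_lin: "nb g \<Longrightarrow> nb h \<Longrightarrow> K (\<lambda>x. s * g x + t * h x) x = s * K g x + t * K h x"
  unfolding K_def using K_int[of g x] K_int[of h x] by (simp add: algebra_simps)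

lemma E_lin:
  assumes "nb g" "nb h"
  shows "E (\<lambda>x. s * g x + t * h x) (\<lambda>x. s * g x + t * h x)
    = s\<^sup>2 * E g g + 2 * s * t * E g h + t\<^sup>2 * E h h"
proof -
  have "E (\<lambda>x. s * g x + t * h x) (\<lambda>x. s * g x + t * h x) =
    (\<integral>x. s\<^sup>2 * (g x * K g x) + s * t * (g x * K h x) + s * t * (h x * K g x) + t\<^sup>2 * (h x * K h x) \<partial>\<mu>)"
    unfolding E_def K_lin[OF assms]
    by (intro Bochner_Integration.integral_cong) (auto simp: algebra_simps power2_eq_square)
  also have "\<dots> = s\<^sup>2 * E g g + s * t * E g h + s * t * E h g + t\<^sup>2 * E h h"
    unfolding E_def using assms E_int by simp
  also have "\<dots> = s\<^sup>2 * E g g + 2 * s * t * E g h + t\<^sup>2 * E h h"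
    using E_sym[OF assms] by (simp add: algebra_simps)
  finally show ?thesis .
qed

text \<open>With t = 0 it controls \<open>E g h\<close>; with small t > 0 it bounds
  \<open>K h z - K g z\<close> by the energy distance of g and h.\<close>

lemma polarization:
  assumes "nb g" "nb h" "t \<ge> 0"
  shows "2 * E g h + 2 * t * K h z \<le> E g g + E h h + 2 * t * K g z + t\<^sup>2"
proof -
  have "2 * kernel_pairing \<epsilon> \<mu> g \<mu> h + ennreal (2 * t) * kernel_potential \<epsilon> \<mu> h z
    \<le> kernel_pairing \<epsilon> \<mu> g \<mu> g + kernel_pairing \<epsilon> \<mu> h \<mu> h
      + ennreal (2 * t) * kernel_potential \<epsilon> \<mu> g z + ennreal (t\<^sup>2)"
    using assms sets_\<mu> eps prob_space_axioms by (intro kernel_pairing_polarization) (auto simp: nb_def)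
  then have "ennreal (2 * E g h + 2 * t * K h z) \<le> ennreal (E g g + E h h + 2 * t * K g z + t\<^sup>2)"
    using assms E_nonneg K_nonneg by (simp add: E_pair K_pot ennreal_plus ennreal_mult)
  then show ?thesis
    using assms E_nonneg K_nonneg by (subst (asm) ennreal_le_iff) auto
qed

lemma adm_nb: "adm g \<Longrightarrow> nb g"
  by (simp add: adm_def)

lemma adm_pos: "adm g \<Longrightarrow> g x > 0"
  unfolding adm_def by (metis less_le_trans)

text \<open>From |x - y|^2 <= 2 |x|^2 + 2 |y|^2 the kernel is at least e(x) e(y), and the factor
  e(y) integrates to a positive constant.\<close>

lemma K_lower:
  assumes "adm g"
  shows "\<exists>a>0. \<forall>x. a * exp (- 2 * (norm x)\<^sup>2 / \<epsilon>) \<le> K g x"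
proof -
  obtain c where c: "c > 0" "\<And>x. c \<le> g x" using assms unfolding adm_def by blast
  define e where "e x = exp (- 2 * (norm x)\<^sup>2 / \<epsilon>)" for x :: 'a
  have [measurable]: "e \<in> borel_measurable borel" unfolding e_def by measurable
  have int: "integrable \<mu> e"
    by (rule integrable_const_bound[of _ 1]) (auto simp: e_def eps less_imp_le)
  have "0 < expectation e"
    using int by (rule expectation_greater) (simp add: e_def)
  moreover have "c * expectation e * e x \<le> K g x" for x
  proof -
    have pt: "c * (e x * e y) \<le> g y * k x y" for y
    proof (rule mult_mono)
      have "(norm (x - y))\<^sup>2 \<le> 2 * (norm x)\<^sup>2 + 2 * (norm y)\<^sup>2"
        using zero_le_power2[of "norm (x + y)"] unfolding power2_norm_eq_inner
        by (simp add: inner_diff_left inner_diff_right inner_add_left inner_add_right inner_commute)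
      then have "(norm (x - y))\<^sup>2 / \<epsilon> \<le> (2 * (norm x)\<^sup>2 + 2 * (norm y)\<^sup>2) / \<epsilon>"
        using eps by (intro divide_right_mono) auto
      then show "e x * e y \<le> k x y"
        unfolding e_def gauss_kernel_def mult_exp_exp by (simp add: add_divide_distrib)
    qed (use c adm_pos[OF assms] in \<open>auto simp: e_def less_imp_le\<close>)
    have "c * expectation e * e x = (\<integral>y. c * (e x * e y) \<partial>\<mu>)" by simp
    also have "\<dots> \<le> K g x"
      unfolding K_def using K_int[OF adm_nb[OF assms]] int pt by (intro integral_mono) auto
    finally show ?thesis .
  qed
  ultimately show ?thesis
    using c(1) unfolding e_def[symmetric] by (intro exI[of _ "c * expectation e"]) auto
qed

lemma K_pos: "adm g \<Longrightarrow> K g x > 0"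
  using K_lower[of g] by (meson exp_gt_zero less_le_trans mult_pos_pos)

text \<open>Here the second moment enters: \<open>K g\<close> is bounded above and, by
  \<open>K_lower\<close>, its logarithm falls at most quadratically in the norm.\<close>

lemma lnK_int:
  assumes "adm g"
  shows "integrable \<mu> (\<lambda>x. ln (K g x))"
proof -
  obtain a where a: "a > 0" "\<And>x. a * exp (- 2 * (norm x)\<^sup>2 / \<epsilon>) \<le> K g x"
    using K_lower[OF assms] by blast
  obtain C where C: "\<And>x. K g x \<le> C" using K_bdd[OF adm_nb[OF assms]] by blast
  have [measurable]: "K g \<in> borel_measurable borel" using K_meas[OF adm_nb[OF assms]] .
  show ?thesis
  proof (rule Bochner_Integration.integrable_bound)
    show "integrable \<mu> (\<lambda>x. \<bar>ln C\<bar> + \<bar>ln a\<bar> + 2 / \<epsilon> * (norm x)\<^sup>2)"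
      using second_moment by simp
    have "\<bar>ln (K g x)\<bar> \<le> \<bar>ln C\<bar> + \<bar>ln a\<bar> + 2 / \<epsilon> * (norm x)\<^sup>2" for x
    proof -
      have "ln (K g x) \<le> ln C"
        using C[of x] K_pos[OF assms, of x] by (subst ln_le_cancel_iff) auto
      moreover have "ln (a * exp (- 2 * (norm x)\<^sup>2 / \<epsilon>)) \<le> ln (K g x)"
        using a K_pos[OF assms, of x] by (subst ln_le_cancel_iff) auto
      then have "ln a - 2 / \<epsilon> * (norm x)\<^sup>2 \<le> ln (K g x)"
        using a(1) by (simp add: ln_mult)
      moreover have "0 \<le> 2 / \<epsilon> * (norm x)\<^sup>2" using eps by simp
      ultimately show ?thesis by linarith
    qed
    then show "AE x in \<mu>. norm (ln (K g x)) \<le> norm (\<bar>ln C\<bar> + \<bar>ln a\<bar> + 2 / \<epsilon> * (norm x)\<^sup>2)"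
      by (intro AE_I2) (smt (verit) real_norm_def)
  qed measurable
qed

lemma nb_one: "nb (\<lambda>_. 1)" and nb_zero: "nb (\<lambda>_. 0)"
  by (auto simp: nb_def)

section \<open>The variational functional and its minimising sequences\<close>

text \<open>The inequality ln y <= y - 1 replaces the logarithm by the linear term E(1,g) - 1. Then
  2 E(1,g) <= E(1,1) + E(g,g), with E(1,1) <= 1, leaves 1/2.\<close>

lemma G_lower:
  assumes "adm g"
  shows "1 / 2 \<le> G g"
proof -
  note nb = adm_nb[OF assms]
  have "K (\<lambda>_. 1) x \<le> 1" for x
    using kernel_potential_bounded(4)[OF eps prob_space_axioms sets_\<mu>, of "\<lambda>_. 1" 1] by (simp add: K_def)
  then have "E (\<lambda>_. 1) (\<lambda>_. 1) \<le> (\<integral>x. 1 \<partial>\<mu>)"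
    unfolding E_def using E_int[OF nb_one nb_one] by (intro integral_mono) auto
  then have 1: "E (\<lambda>_. 1) (\<lambda>_. 1) \<le> 1" by (simp add: prob_space)
  have "(\<integral>x. ln (K g x) \<partial>\<mu>) \<le> (\<integral>x. 1 * K g x - 1 \<partial>\<mu>)"
    using lnK_int[OF assms] E_int[OF nb_one nb] ln_le_minus_one[OF K_pos[OF assms]]
    by (intro integral_mono) auto
  also have "\<dots> = E (\<lambda>_. 1) g - 1"
    unfolding E_def using E_int[OF nb_one nb] by (simp add: prob_space)
  finally show ?thesis
    using polarization[OF nb_one nb, of 0] 1 by (simp add: G_def)
qed

lemma E_pos:
  assumes "adm g"
  shows "E g g > 0"
  unfolding E_def using E_int[OF adm_nb[OF assms] adm_nb[OF assms]]
  by (rule expectation_greater) (use adm_pos[OF assms] K_pos[OF assms] in auto)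

text \<open>Along the ray of multiples s g the functional is s^2 E(g,g) / 2 - ln s plus a constant,
  which is least at s = 1 / sqrt (E(g,g)).\<close>

lemma normalise:
  assumes "adm g"
  shows "\<exists>h. adm h \<and> E h h = 1 \<and> G h \<le> G g"
proof -
  note nb = adm_nb[OF assms]
  define s where "s = 1 / sqrt (E g g)"
  have s: "s > 0" "s\<^sup>2 = 1 / E g g" "ln s = - ln (E g g) / 2"
    using E_pos[OF assms] by (auto simp: s_def power_divide ln_div ln_sqrt)
  \<comment> \<open>The summand with coefficient 0 brings the multiple into the shape of the lemmas
    on linear combinations.\<close>
  let ?h = "\<lambda>x. s * g x + 0 * g x"
  have adm: "adm ?h" using assms nb s by (intro adm_lin) auto
  have E: "E ?h ?h = 1" using E_pos[OF assms] unfolding E_lin[OF nb nb] by (simp add: s)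
  have "(\<integral>x. ln (K ?h x) \<partial>\<mu>) = (\<integral>x. ln s + ln (K g x) \<partial>\<mu>)"
    unfolding K_lin[OF nb nb] using s(1) K_pos[OF assms]
    by (intro Bochner_Integration.integral_cong) (auto simp: ln_mult_pos)
  also have "\<dots> = ln s + (\<integral>x. ln (K g x) \<partial>\<mu>)"
    using lnK_int[OF assms] by (simp add: prob_space)
  finally have "G ?h \<le> G g"
    using ln_le_minus_one[OF E_pos[OF assms]] unfolding G_def E s(3) by (simp add: field_simps)
  then show ?thesis using adm E by blast
qed

text \<open>For unit energies \<open>1 - E g h\<close> is half the squared energy distance. The
  midpoint has energy (1 + E g h) / 2 and, by concavity of ln, at least the mean logarithmic term,
  so near-minimisers must be close to each other.\<close>

lemma midpoint:
  assumes "adm g" "adm h" "E g g = 1" "E h h = 1" and J: "\<And>f. adm f \<Longrightarrow> J \<le> G f"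
  shows "1 - E g h \<le> 2 * (G g - J) + 2 * (G h - J)"
proof -
  note nb = adm_nb[OF assms(1)] adm_nb[OF assms(2)]
  let ?m = "\<lambda>x. 1 / 2 * g x + 1 / 2 * h x"
  have adm: "adm ?m" using assms(1) nb by (intro adm_lin) auto
  have E: "E ?m ?m = (1 + E g h) / 2"
    unfolding E_lin[OF nb] by (simp add: assms power2_eq_square)
  have "(\<integral>x. 1 / 2 * ln (K g x) + 1 / 2 * ln (K h x) \<partial>\<mu>) \<le> (\<integral>x. ln (K ?m x) \<partial>\<mu>)"
  proof (rule integral_mono)
    show "integrable \<mu> (\<lambda>x. 1 / 2 * ln (K g x) + 1 / 2 * ln (K h x))"
      using lnK_int assms by (intro Bochner_Integration.integrable_add) auto
    show "integrable \<mu> (\<lambda>x. ln (K ?m x))" by (rule lnK_int[OF adm])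
    fix x
    show "1 / 2 * ln (K g x) + 1 / 2 * ln (K h x) \<le> ln (K ?m x)"
      unfolding K_lin[OF nb]
      using concave_onD[OF ln_concave, of "1/2" "K g x" "K h x"] K_pos[OF assms(1), of x] K_pos[OF assms(2), of x]
      by simp
  qed
  also have "(\<integral>x. 1 / 2 * ln (K g x) + 1 / 2 * ln (K h x) \<partial>\<mu>)
      = 1 / 2 * (\<integral>x. ln (K g x) \<partial>\<mu>) + 1 / 2 * (\<integral>x. ln (K h x) \<partial>\<mu>)"
    using lnK_int assms by (subst Bochner_Integration.integral_add) auto
  finally show ?thesis
    using J[OF adm] unfolding G_def E by (simp add: assms field_simps)
qed

text \<open>The value \<open>K g z\<close> is the inner product of two unit vectors, one of them the
  Dirac mass at z.\<close>

lemma K_le_1: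
  assumes "nb g" "E g g = 1"
  shows "K g z \<le> 1"
  using polarization[OF nb_zero assms(1), of 1 z] assms(2)
  by (simp add: E_def[of "\<lambda>_. 0"] K_def[of "\<lambda>_. 0"])

text \<open>Compare g with g + t h, which stays admissible since h >= 0. A defect t^2 in minimality
  costs only t after division by the step t. The bound ln (1 + y) >= y / (1 + y) keeps t in the
  denominator, so the integrand is at most 1 / t and no integrability of K h / K g is
  presupposed.\<close>

lemma first_variation:
  assumes "adm g" "E g g = 1" "nb h" "t > 0" and J: "\<And>f. adm f \<Longrightarrow> J \<le> G f" "G g \<le> J + t\<^sup>2"
  shows "(\<integral>\<^sup>+x. ennreal (K h x / (K g x + t * K h x)) \<partial>\<mu>) \<le> ennreal (E g h + t / 2 * E h h + t)"
proof -
  note nb = adm_nb[OF assms(1)]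
  let ?f = "\<lambda>x. 1 * g x + t * h x"
  have adm: "adm ?f" using assms by (intro adm_lin) auto
  have [measurable]: "K g \<in> borel_measurable borel" "K h \<in> borel_measurable borel"
    using K_meas nb assms by auto
  have pos: "K g x > 0" "K g x + t * K h x > 0" "K h x \<ge> 0" for x
    using K_pos[OF assms(1), of x] K_nonneg[OF assms(3), of x] assms(4)
    by (auto intro: add_pos_nonneg)
  have Ef: "E ?f ?f = 1 + 2 * t * E g h + t\<^sup>2 * E h h"
    unfolding E_lin[OF nb assms(3)] using assms(2) by simp
  let ?q = "\<lambda>x. K h x / (K g x + t * K h x)"
  have q: "t * ?q x \<le> ln (K ?f x) - ln (K g x)" for x
  proof -
    have "ln (K g x / (K g x + t * K h x)) \<le> K g x / (K g x + t * K h x) - 1"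
      using pos by (intro ln_le_minus_one) auto
    also have "\<dots> = - (t * ?q x)" using pos(2)[of x] by (simp add: field_simps)
    finally show ?thesis
      unfolding K_lin[OF nb assms(3)] using pos[of x] by (simp add: ln_div)
  qed
  have qint: "integrable \<mu> ?q"
  proof (rule integrable_const_bound[of _ "1 / t"])
    show "AE x in \<mu>. norm (?q x) \<le> 1 / t"
    proof (rule AE_I2)
      fix x
      have "K h x * t \<le> K g x + t * K h x" using pos[of x] by simp
      then show "norm (?q x) \<le> 1 / t" using pos[of x] assms(4) by (simp add: field_simps)
    qed
  qed measurable
  have "t * (\<integral>x. ?q x \<partial>\<mu>) = (\<integral>x. t * ?q x \<partial>\<mu>)" by (rule integral_mult_right_zero[symmetric])
  also have "\<dots> \<le> (\<integral>x. ln (K ?f x) - ln (K g x) \<partial>\<mu>)"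
    by (rule integral_mono[OF integrable_mult_right[OF qint]
          Bochner_Integration.integrable_diff[OF lnK_int[OF adm] lnK_int[OF assms(1)]] q])
  also have "\<dots> = (\<integral>x. ln (K ?f x) \<partial>\<mu>) - (\<integral>x. ln (K g x) \<partial>\<mu>)"
    using lnK_int[OF adm] lnK_int[OF assms(1)] by (rule Bochner_Integration.integral_diff)
  also have "\<dots> \<le> t * E g h + t\<^sup>2 * E h h / 2 + t\<^sup>2"
    using J(1)[OF adm] J(2) unfolding G_def Ef assms(2) by (simp add: field_simps)
  also have "\<dots> = t * (E g h + t / 2 * E h h + t)" by (simp add: algebra_simps power2_eq_square)
  finally have "(\<integral>x. ?q x \<partial>\<mu>) \<le> E g h + t / 2 * E h h + t" using assms(4) by simp
  moreover have "(\<integral>\<^sup>+x. ennreal (?q x) \<partial>\<mu>) = ennreal (\<integral>x. ?q x \<partial>\<mu>)"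
    using qint pos by (intro nn_integral_eq_integral AE_I2 divide_nonneg_pos) auto
  ultimately show ?thesis by (simp add: ennreal_leI)
qed

text \<open>The tolerance is a square so that \<open>first_variation\<close> can be applied to the
  n-th term with t = 1 / (n + 1), a step tending to 0.\<close>

lemma minimizing_sequence_exists:
  "\<exists>J g. (\<forall>f. adm f \<longrightarrow> J \<le> G f) \<and>
     (\<forall>n::nat. adm (g n) \<and> E (g n) (g n) = 1 \<and> G (g n) \<le> J + (1 / (real n + 1))\<^sup>2)"
proof -
  define J where "J = Inf (G ` Collect adm)"
  have adm1: "adm (\<lambda>_. 1)" by (auto simp: adm_def nb_one intro!: exI[of _ 1])
  have bdd: "bdd_below (G ` Collect adm)" using G_lower by (auto intro!: bdd_belowI[of _ "1/2"])
  have J: "J \<le> G f" if "adm f" for f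
    unfolding J_def using that bdd by (intro cInf_lower) auto
  have "\<exists>g. adm g \<and> E g g = 1 \<and> G g \<le> J + (1 / (real n + 1))\<^sup>2" for n
  proof -
    have "Inf (G ` Collect adm) < J + (1 / (real n + 1))\<^sup>2" unfolding J_def by simp
    then obtain f where "adm f" "G f < J + (1 / (real n + 1))\<^sup>2"
      using adm1 bdd by (subst (asm) cInf_less_iff) auto
    then show ?thesis using normalise[of f] by (metis less_imp_le order_trans)
  qed
  then show ?thesis using J by metis
qed

text \<open>The minimisers converge in energy to \<open>u \<mu>\<close> with \<open>u = 1/w\<close>, where \<open>w\<close> is the uniform limit of
  their potentials: the first variation bounds the energy of \<open>u \<mu>\<close> by 1, and Fatou's lemma
  bounds the pairing of \<open>u \<mu>\<close> with the minimising sequence from below by 1.\<close>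
lemma self_potential_exists:
  "\<exists>u. u \<in> borel_measurable borel \<and> (\<forall>x. u x > 0) \<and> integrable \<mu> (\<lambda>x. ln (u x)) \<and>
     (\<forall>x. kernel_potential \<epsilon> \<mu> u x = ennreal (1 / u x))"
proof -
  obtain J g where J: "\<And>f. adm f \<Longrightarrow> J \<le> G f" and adm: "\<And>n::nat. adm (g n)"
    and E1: "\<And>n. E (g n) (g n) = 1" and Gg: "\<And>n. G (g n) \<le> J + (1 / (real n + 1))\<^sup>2"
    using minimizing_sequence_exists by metis
  define \<delta> where "\<delta> n = 1 / (real n + 1)" for n :: nat
  have \<delta>: "\<delta> n > 0" "\<delta> n \<le> 1" for n by (auto simp: \<delta>_def)
  have \<delta>_lim: "\<delta> \<longlonglongrightarrow> 0" unfolding \<delta>_def using LIMSEQ_inverse_real_of_nat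
    by (simp add: inverse_eq_divide add.commute)
  have \<delta>_mono: "\<delta> m \<le> \<delta> n" if "n \<le> m" for n m using that by (simp add: \<delta>_def frac_le)
  note nb = adm_nb[OF adm]
  have Gd: "G (g n) \<le> J + (\<delta> n)\<^sup>2" for n using Gg by (simp add: \<delta>_def)
  \<comment> \<open>With t = 2 delta, polarisation bounds 2 t times the difference by 2 (1 - E) +
    t^2 <= 8 delta^2 + 4 delta^2. Division by 2 t = 4 delta leaves 3 delta, whatever z is.\<close>
  have diff: "K (g n) z - K (g m) z \<le> 3 * \<delta> N" if "N \<le> n" "N \<le> m" for n m N z
  proof -
    let ?t = "2 * \<delta> N"
    have "(\<delta> n)\<^sup>2 \<le> (\<delta> N)\<^sup>2" "(\<delta> m)\<^sup>2 \<le> (\<delta> N)\<^sup>2"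
      using \<delta>_mono[OF that(1)] \<delta>_mono[OF that(2)] \<delta>(1) by (auto intro!: power_mono simp: less_imp_le)
    moreover have "1 - E (g m) (g n) \<le> 2 * (G (g m) - J) + 2 * (G (g n) - J)"
      using J by (intro midpoint adm E1)
    ultimately have "1 - E (g m) (g n) \<le> 4 * (\<delta> N)\<^sup>2"
      using Gd[of n] Gd[of m] by argo
    moreover have "2 * E (g m) (g n) + 2 * ?t * K (g n) z \<le> 2 + 2 * ?t * K (g m) z + ?t\<^sup>2"
      using polarization[OF nb[of m] nb[of n], of ?t z] E1 \<delta>(1)[of N] by simp
    ultimately have "\<delta> N * (4 * (K (g n) z - K (g m) z)) \<le> \<delta> N * (12 * \<delta> N)"
      by (simp add: algebra_simps power2_eq_square)
    then show ?thesis using \<delta>(1)[of N] by simp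
  qed
  have "Cauchy (\<lambda>n. K (g n) z)" for z
  proof (rule metric_CauchyI)
    fix e :: real assume "0 < e"
    then have "eventually (\<lambda>n. \<delta> n < e / 3) sequentially"
      using \<delta>_lim by (intro order_tendstoD) auto
    then obtain N where N: "\<delta> N < e / 3" by (auto simp: eventually_sequentially)
    show "\<exists>M. \<forall>m\<ge>M. \<forall>n\<ge>M. dist (K (g m) z) (K (g n) z) < e"
    proof (intro exI[of _ N] allI impI)
      fix m n assume "N \<le> m" "N \<le> n"
      then show "dist (K (g m) z) (K (g n) z) < e"
        using diff[of N m n z] diff[of N n m z] N by (simp add: dist_real_def)
    qed
  qed
  then have "convergent (\<lambda>n. K (g n) z)" for z by (rule Cauchy_convergent)
  then obtain w where w_lim: "\<And>z. (\<lambda>n. K (g n) z) \<longlonglongrightarrow> w z"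
    unfolding convergent_def by metis
  have w_nonneg: "0 \<le> w z" for z
    using w_lim by (rule LIMSEQ_le_const) (use K_nonneg[OF nb] in auto)
  have K_le: "K (g n) z \<le> 1" for n z by (rule K_le_1[OF nb E1])
  have [measurable]: "K (g n) \<in> borel_measurable borel" for n by (rule K_meas[OF nb])
  have w_meas [measurable]: "w \<in> borel_measurable borel"
    by (rule borel_measurable_LIMSEQ_real[where u="\<lambda>n. K (g n)"]) (auto intro: w_lim)
  \<comment> \<open>A limit inferior of the logarithms rather than \<open>- ln (w x)\<close>: HOL
    has \<open>ln 0 = 0\<close>, which would hide the zeros of \<open>w\<close>, whereas
    \<open>ell\<close> is infinite there. Nonnegativity for Fatou's lemma comes from
    \<open>K_le\<close>.\<close>
  define ell where "ell x = liminf (\<lambda>n. ennreal (- ln (K (g n) x)))" for x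
  have ell_meas [measurable]: "ell \<in> borel_measurable borel" unfolding ell_def by measurable
  have "(\<integral>\<^sup>+x. ell x \<partial>\<mu>) \<le> liminf (\<lambda>n. \<integral>\<^sup>+x. ennreal (- ln (K (g n) x)) \<partial>\<mu>)"
    unfolding ell_def by (rule nn_integral_liminf) measurable
  also have "\<dots> \<le> liminf (\<lambda>n. ennreal (J + 1))"
  proof (intro Liminf_mono always_eventually allI)
    fix n
    have "(\<integral>\<^sup>+x. ennreal (- ln (K (g n) x)) \<partial>\<mu>) = ennreal (\<integral>x. - ln (K (g n) x) \<partial>\<mu>)"
      using lnK_int[OF adm] K_le K_pos[OF adm] by (intro nn_integral_eq_integral) auto
    also have "(\<integral>x. - ln (K (g n) x) \<partial>\<mu>) = G (g n) - 1 / 2" by (simp add: G_def E1)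
    also have "\<dots> \<le> J + 1"
      using Gd[of n] power_le_one[of "\<delta> n" 2] \<delta>[of n] by (auto simp: less_imp_le)
    finally show "(\<integral>\<^sup>+x. ennreal (- ln (K (g n) x)) \<partial>\<mu>) \<le> ennreal (J + 1)"
      by (simp add: ennreal_leI)
  qed
  also have "\<dots> < \<infinity>" by (simp add: Liminf_const)
  finally have ell_int: "(\<integral>\<^sup>+x. ell x \<partial>\<mu>) < \<infinity>" .
  then have ell_fin: "AE x in \<mu>. ell x \<noteq> \<infinity>" by (intro nn_integral_PInf_AE) auto
  have w0: "ell x = \<infinity>" if "w x = 0" for x
  proof -
    have "filterlim (\<lambda>n. K (g n) x) (at_right 0) sequentially"
      using w_lim[of x] that K_pos[OF adm, of _ x]
      unfolding filterlim_at by (auto simp: less_imp_neq[THEN not_sym] intro!: always_eventually)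
    then have "filterlim (\<lambda>n. - ln (K (g n) x)) at_top sequentially"
      by (intro filterlim_compose[OF filterlim_uminus_at_top_at_bot] filterlim_compose[OF ln_at_0])
    then have "(\<lambda>n. ennreal (- ln (K (g n) x))) \<longlonglongrightarrow> \<infinity>"
      by (simp add: ennreal_tendsto_top_eq_at_top)
    then show ?thesis unfolding ell_def by (intro lim_imp_Liminf) auto
  qed
  have w1: "ell x = ennreal (- ln (w x))" if "w x > 0" for x
    unfolding ell_def using that by (intro lim_imp_Liminf tendsto_intros w_lim) auto
  have w_pos_AE: "AE x in \<mu>. w x > 0"
    using ell_fin by eventually_elim (use w0 w_nonneg in \<open>force simp: less_le\<close>)
  have w_le: "w x \<le> 1" for x
    using w_lim by (rule LIMSEQ_le_const2) (use K_le in auto)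
  \<comment> \<open>Where \<open>w\<close> vanishes this is 0 by convention. So far such points are
    only known to form a null set; \<open>w_pos\<close> excludes them later.\<close>
  define u where "u x = 1 / w x" for x
  have u_meas [measurable]: "u \<in> borel_measurable borel" unfolding u_def by measurable
  have u_nonneg: "u x \<ge> 0" for x using w_nonneg by (simp add: u_def)
  \<comment> \<open>The first variation against h, with t = delta n: Fatou's lemma on the left,
    \<open>E (g n) h\<close> tending to the integral of h w on the right. That integral is at most 1
    because h w <= u w <= 1. Test functions must be bounded, so \<open>u\<close> itself is reached
    by truncation in \<open>uu\<close>.\<close>
  have test: "kernel_pairing \<epsilon> \<mu> u \<mu> h \<le> 1" if h: "nb h" "\<And>x. h x \<le> u x" for h
  proof -
    have [measurable]: "h \<in> borel_measurable borel" "K h \<in> borel_measurable borel"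
      using h(1) K_meas by (auto simp: nb_def)
    let ?q = "\<lambda>n x. ennreal (K h x / (K (g n) x + \<delta> n * K h x))"
    have lim: "(\<lambda>n. ?q n x) \<longlonglongrightarrow> ennreal (u x * K h x)" if "w x > 0" for x
    proof -
      have "(\<lambda>n. K h x / (K (g n) x + \<delta> n * K h x)) \<longlonglongrightarrow> K h x / (w x + 0 * K h x)"
        using that by (intro tendsto_intros w_lim \<delta>_lim) auto
      then show ?thesis by (intro tendsto_ennrealI) (simp add: u_def)
    qed
    have "kernel_pairing \<epsilon> \<mu> u \<mu> h = (\<integral>\<^sup>+x. ennreal (u x * K h x) \<partial>\<mu>)"
      unfolding kernel_pairing_def K_pot[OF h(1)] by (simp add: ennreal_mult' u_nonneg)
    also have "\<dots> = (\<integral>\<^sup>+x. liminf (\<lambda>n. ?q n x) \<partial>\<mu>)"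
      by (intro nn_integral_cong_AE, rule AE_mp[OF w_pos_AE], intro AE_I2 impI lim_imp_Liminf[symmetric] lim) auto
    also have "\<dots> \<le> liminf (\<lambda>n. \<integral>\<^sup>+x. ?q n x \<partial>\<mu>)" by (rule nn_integral_liminf) measurable
    also have "\<dots> \<le> liminf (\<lambda>n. ennreal (E (g n) h + \<delta> n / 2 * E h h + \<delta> n))"
      using first_variation[OF adm E1 h(1) \<delta>(1) J Gd] by (intro Liminf_mono always_eventually allI) auto
    also have "\<dots> = ennreal ((\<integral>x. h x * w x \<partial>\<mu>) + 0 / 2 * E h h + 0)"
    proof (intro lim_imp_Liminf tendsto_ennrealI tendsto_intros \<delta>_lim)
      obtain C where C: "\<And>x. h x \<le> C" "\<And>x. 0 \<le> h x" using h(1) unfolding nb_def by blast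
      have "(\<lambda>n. \<integral>x. h x * K (g n) x \<partial>\<mu>) \<longlonglongrightarrow> (\<integral>x. h x * w x \<partial>\<mu>)"
      proof (rule integral_dominated_convergence[where w="\<lambda>_. C"])
        show "AE x in \<mu>. norm (h x * K (g n) x) \<le> C" for n
        proof (rule AE_I2)
          fix x
          have "h x * K (g n) x \<le> C * 1"
            using C K_le K_nonneg[OF nb] by (intro mult_mono) (auto intro: order_trans)
          then show "norm (h x * K (g n) x) \<le> C" using C K_nonneg[OF nb] by simp
        qed
      qed (auto intro!: tendsto_intros w_lim)
      then show "(\<lambda>n. E (g n) h) \<longlonglongrightarrow> (\<integral>x. h x * w x \<partial>\<mu>)"
        unfolding E_sym[OF nb h(1)] by (simp add: E_def)
    qed auto
    also have "\<dots> \<le> ennreal 1"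
    proof (rule ennreal_leI)
      have hw: "h x * w x \<le> 1" "0 \<le> h x * w x" for x
      proof -
        have "h x * w x \<le> u x * w x" using h(2) w_nonneg by (rule mult_right_mono)
        also have "\<dots> \<le> 1" by (simp add: u_def)
        finally show "h x * w x \<le> 1" .
        show "0 \<le> h x * w x" using h(1) w_nonneg by (simp add: nb_def)
      qed
      have "(\<integral>x. h x * w x \<partial>\<mu>) \<le> (\<integral>x. 1 \<partial>\<mu>)"
        using hw by (intro integral_mono integrable_const_bound[of _ 1]) auto
      then show "(\<integral>x. h x * w x \<partial>\<mu>) + 0 / 2 * E h h + 0 \<le> 1" by (simp add: prob_space)
    qed
    finally show ?thesis by simp
  qed
  have uu: "kernel_pairing \<epsilon> \<mu> u \<mu> u \<le> 1"
  proof (rule LIMSEQ_le_const2)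
    let ?u = "\<lambda>n x. min (u x) (real n)"
    show "(\<lambda>n. kernel_pairing \<epsilon> \<mu> (?u n) \<mu> (?u n)) \<longlonglongrightarrow> kernel_pairing \<epsilon> \<mu> u \<mu> u"
      by (rule kernel_pairing_truncation) (auto simp: prob_space_axioms sets_\<mu> u_nonneg)
    have "kernel_pairing \<epsilon> \<mu> (?u n) \<mu> (?u n) \<le> 1" for n
    proof -
      have "kernel_pairing \<epsilon> \<mu> (?u n) \<mu> (?u n) \<le> kernel_pairing \<epsilon> \<mu> u \<mu> (?u n)"
        using u_nonneg by (intro kernel_pairing_mono) auto
      also have "\<dots> \<le> 1"
        using u_nonneg by (intro test nbI[of _ "real n"]) auto
      finally show ?thesis .
    qed
    then show "\<exists>N. \<forall>n\<ge>N. kernel_pairing \<epsilon> \<mu> (?u n) \<mu> (?u n) \<le> 1" by blast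
  qed
  \<comment> \<open>The energy of \<open>u \<mu> - g n \<mu>\<close> is at most 2 - 2 P n, so a
    lower limit of at least 1 for \<open>P\<close> means convergence in energy.\<close>
  define P where "P n = kernel_pairing \<epsilon> \<mu> u \<mu> (g n)" for n
  have P_eq: "P n = (\<integral>\<^sup>+x. ennreal (u x * K (g n) x) \<partial>\<mu>)" for n
    unfolding P_def kernel_pairing_def K_pot[OF nb] by (simp add: ennreal_mult' u_nonneg)
  have lim1: "(\<lambda>n. ennreal (u x * K (g n) x)) \<longlonglongrightarrow> 1" if "w x > 0" for x
  proof -
    have "(\<lambda>n. u x * K (g n) x) \<longlonglongrightarrow> u x * w x" by (intro tendsto_intros w_lim)
    from tendsto_ennrealI[OF this] show ?thesis using that by (simp add: u_def)
  qed
  have "1 = (\<integral>\<^sup>+x. 1 \<partial>\<mu>)" by (simp add: emeasure_space_1)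
  also have "\<dots> = (\<integral>\<^sup>+x. liminf (\<lambda>n. ennreal (u x * K (g n) x)) \<partial>\<mu>)"
      by (intro nn_integral_cong_AE, rule AE_mp[OF w_pos_AE], intro AE_I2 impI lim_imp_Liminf[symmetric] lim1) auto
  also have "\<dots> \<le> liminf P" unfolding P_eq[abs_def] by (rule nn_integral_liminf) measurable
  finally have P_lim: "1 \<le> liminf P" .
  have P_ev: "eventually (\<lambda>n. ennreal r < P n) sequentially" if "0 \<le> r" "r < 1" for r
    using that by (intro less_LiminfD less_le_trans[OF _ P_lim]) (simp add: ennreal_less_one_iff)
  have g_meas: "g n \<in> borel_measurable borel" "0 \<le> g n x" for n x
    using nb[of n] by (auto simp: nb_def)
  \<comment> \<open>The two orders of the pair bound the potential of \<open>u\<close> at z from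
    above (\<open>pol1\<close>) and from below (\<open>pol2\<close>) by that of
    \<open>g n\<close>.\<close>
  have pol1: "2 * P n + ennreal (2 * t) * kernel_potential \<epsilon> \<mu> u z \<le> ennreal (2 + 2 * t * K (g n) z + t\<^sup>2)"
    if "t \<ge> 0" for t n z
  proof -
    have "2 * kernel_pairing \<epsilon> \<mu> (g n) \<mu> u + ennreal (2 * t) * kernel_potential \<epsilon> \<mu> u z
      \<le> kernel_pairing \<epsilon> \<mu> (g n) \<mu> (g n) + kernel_pairing \<epsilon> \<mu> u \<mu> u
        + ennreal (2 * t) * kernel_potential \<epsilon> \<mu> (g n) z + ennreal (t\<^sup>2)"
      using that eps prob_space_axioms sets_\<mu> g_meas u_nonneg by (intro kernel_pairing_polarization) auto
    also have "kernel_pairing \<epsilon> \<mu> (g n) \<mu> u = P n" unfolding P_def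
      using prob_space_axioms sets_\<mu> g_meas u_nonneg by (intro kernel_pairing_commute) auto
    also have "kernel_pairing \<epsilon> \<mu> (g n) \<mu> (g n) + kernel_pairing \<epsilon> \<mu> u \<mu> u
        + ennreal (2 * t) * kernel_potential \<epsilon> \<mu> (g n) z + ennreal (t\<^sup>2)
      \<le> ennreal 1 + ennreal 1 + ennreal (2 * t) * ennreal (K (g n) z) + ennreal (t\<^sup>2)"
      using uu unfolding E_pair[OF nb nb] E1 K_pot[OF nb] by (intro add_mono) auto
    also have "\<dots> = ennreal (2 + 2 * t * K (g n) z + t\<^sup>2)"
      using that K_nonneg[OF nb] by (simp add: ennreal_plus ennreal_mult)
    finally show ?thesis .
  qed
  have pol2: "2 * P n + ennreal (2 * t * K (g n) z) \<le> 2 + ennreal (2 * t) * kernel_potential \<epsilon> \<mu> u z + ennreal (t\<^sup>2)"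
    if "t \<ge> 0" for t n z
  proof -
    have "2 * P n + ennreal (2 * t) * kernel_potential \<epsilon> \<mu> (g n) z
      \<le> kernel_pairing \<epsilon> \<mu> u \<mu> u + kernel_pairing \<epsilon> \<mu> (g n) \<mu> (g n)
        + ennreal (2 * t) * kernel_potential \<epsilon> \<mu> u z + ennreal (t\<^sup>2)"
      unfolding P_def
      using that eps prob_space_axioms sets_\<mu> g_meas u_nonneg by (intro kernel_pairing_polarization) auto
    also have "\<dots> \<le> 1 + 1 + ennreal (2 * t) * kernel_potential \<epsilon> \<mu> u z + ennreal (t\<^sup>2)"
      using uu unfolding E_pair[OF nb nb] E1 by (intro add_mono) auto
    finally show ?thesis
      using that K_nonneg[OF nb] by (simp add: K_pot[OF nb] ennreal_mult)
  qed
  have pot: "kernel_potential \<epsilon> \<mu> u z = ennreal (w z)" for z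
  proof -
    have "ennreal (2 * 1) * kernel_potential \<epsilon> \<mu> u z \<le> ennreal (2 + 2 * 1 * K (g 0) z + 1\<^sup>2)"
      by (rule order_trans[OF _ pol1]) auto
    then have "kernel_potential \<epsilon> \<mu> u z \<noteq> \<infinity>" by (auto simp: ennreal_mult_top top_unique)
    then obtain q where q: "kernel_potential \<epsilon> \<mu> u z = ennreal q" "q \<ge> 0"
      by (cases "kernel_potential \<epsilon> \<mu> u z") auto
    have both: "q \<le> w z + t \<and> w z \<le> q + t" if "t > 0" "t < 1" for t
    proof -
      \<comment> \<open>Chosen so that the slack 2 - 2 r equals the energy t^2 of the Dirac term;
        the total 2 t^2 divided by 2 t leaves the error t.\<close>
      define r where "r = 1 - t\<^sup>2 / 2"
      have "t\<^sup>2 < 1" using that by (simp add: power_less_one_iff)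
      then have r: "0 \<le> r" "r < 1" using that by (auto simp: r_def)
      have "eventually (\<lambda>n. 2 * r + 2 * t * q \<le> 2 + 2 * t * K (g n) z + t\<^sup>2 \<and>
          2 * r + 2 * t * K (g n) z \<le> 2 + 2 * t * q + t\<^sup>2) sequentially"
        using P_ev[OF r]
      proof eventually_elim
        fix n assume n: "ennreal r < P n"
        have *: "ennreal (2 * r) \<le> 2 * P n"
          using n r by (simp add: ennreal_mult less_imp_le mult_left_mono)
        have "ennreal (2 * r + 2 * t * q) \<le> 2 * P n + ennreal (2 * t) * ennreal q"
          using * r q(2) that by (simp add: ennreal_plus ennreal_mult[symmetric] add_right_mono mult.assoc)
        also have "\<dots> \<le> ennreal (2 + 2 * t * K (g n) z + t\<^sup>2)"
          using pol1[of t n z] that q by simp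
        finally have 1: "2 * r + 2 * t * q \<le> 2 + 2 * t * K (g n) z + t\<^sup>2"
          using that K_nonneg[OF nb, of n z] by (subst (asm) ennreal_le_iff) auto
        have "ennreal (2 * r + 2 * t * K (g n) z) \<le> 2 * P n + ennreal (2 * t * K (g n) z)"
          using * r that K_nonneg[OF nb, of n z] by (simp add: ennreal_plus add_right_mono)
        also have "\<dots> \<le> 2 + ennreal (2 * t) * ennreal q + ennreal (t\<^sup>2)"
          using pol2[of t n z] that q by simp
        also have "\<dots> = ennreal (2 + 2 * t * q + t\<^sup>2)"
          using that q by (simp add: ennreal_plus ennreal_mult)
        finally have "2 * r + 2 * t * K (g n) z \<le> 2 + 2 * t * q + t\<^sup>2"
          using that q by (subst (asm) ennreal_le_iff) auto
        with 1 show "2 * r + 2 * t * q \<le> 2 + 2 * t * K (g n) z + t\<^sup>2 \<and>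
          2 * r + 2 * t * K (g n) z \<le> 2 + 2 * t * q + t\<^sup>2" ..
      qed
      then have ev: "eventually (\<lambda>n. 2 * r + 2 * t * q \<le> 2 + 2 * t * K (g n) z + t\<^sup>2) sequentially"
        "eventually (\<lambda>n. 2 * r + 2 * t * K (g n) z \<le> 2 + 2 * t * q + t\<^sup>2) sequentially"
        by (simp_all add: eventually_conj_iff)
      have "2 * r + 2 * t * q \<le> 2 + 2 * t * w z + t\<^sup>2"
        by (rule tendsto_lowerbound[OF _ ev(1)]) (auto intro!: tendsto_intros w_lim)
      moreover have "2 * r + 2 * t * w z \<le> 2 + 2 * t * q + t\<^sup>2"
        by (rule tendsto_upperbound[OF _ ev(2)]) (auto intro!: tendsto_intros w_lim)
      ultimately have "t * q \<le> t * (w z + t)" "t * w z \<le> t * (q + t)"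
        by (simp_all add: r_def algebra_simps power2_eq_square)
      then show ?thesis using that by simp
    qed
    have "q \<le> w z"
    proof (rule dense_ge_bounded[of "w z" "w z + 1"])
      show "q \<le> v" if "w z < v" "v < w z + 1" for v using both[of "v - w z"] that by simp
    qed simp
    moreover have "w z \<le> q"
    proof (rule dense_ge_bounded[of q "q + 1"])
      show "w z \<le> v" if "q < v" "v < q + 1" for v using both[of "v - q"] that by simp
    qed simp
    ultimately show ?thesis using q by simp
  qed
  \<comment> \<open>Now \<open>w\<close> is the potential of \<open>u\<close>. As the kernel is
    strictly positive, a zero at a single point would force u = 0 almost everywhere.\<close>
  have w_pos: "w z > 0" for z
  proof -
    have "w z \<noteq> 0"
    proof
      assume "w z = 0"
      then have "(\<integral>\<^sup>+y. ennreal (u y * k z y) \<partial>\<mu>) = 0"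
        using pot[of z] by (simp add: kernel_potential_def)
      then have "AE y in \<mu>. u y * k z y \<le> 0"
        by (subst (asm) nn_integral_0_iff_AE) (auto simp: ennreal_eq_0_iff)
      with w_pos_AE have "AE y in \<mu>. False"
        by eventually_elim (auto simp: u_def divide_le_0_iff not_le[THEN iffD2, OF gauss_kernel_pos])
      then show False by simp
    qed
    then show ?thesis using w_nonneg[of z] by simp
  qed
  have "(\<integral>\<^sup>+x. ennreal (- ln (w x)) \<partial>\<mu>) < \<infinity>"
    using ell_int w1[OF w_pos] by simp
  then have "integrable \<mu> (\<lambda>x. - ln (w x))"
    using w_le w_pos by (intro integrableI_nonneg) auto
  then have "integrable \<mu> (\<lambda>x. ln (u x))"
    using w_pos by (simp add: u_def ln_inverse inverse_eq_divide[symmetric])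
  then show ?thesis
    using u_meas pot w_pos by (intro exI[of _ u]) (simp add: u_def)
qed

end

section \<open>Laplace transforms determine measures\<close>

text \<open>The value at 0 is \<open>c 0\<close>, and differentiation shifts the coefficients up to
  nonzero factors; hence the induction over arbitrary \<open>c\<close>.\<close>

lemma real_power_series_zero:
  fixes c :: "nat \<Rightarrow> real"
  assumes "\<And>t. (\<lambda>n. c n * t ^ n) sums 0"
  shows "c n = 0"
  using assms
proof (induction n arbitrary: c)
  case 0
  from 0[of 0] show ?case using powser_sums_zero_iff[of c 0] by simp
next
  case (Suc n)
  have sm: "summable (\<lambda>n. c n * t ^ n)" for t using Suc.prems sums_summable by blast
  have "(\<lambda>n. diffs c n * t ^ n) sums 0" for t
  proof -
    have "((\<lambda>x. \<Sum>n. c n * x ^ n) has_field_derivative (\<Sum>n. diffs c n * t ^ n)) (at t)"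
      by (rule termdiffs_strong_converges_everywhere) (rule sm)
    moreover have "(\<lambda>x. \<Sum>n. c n * x ^ n) = (\<lambda>x. 0)"
      using Suc.prems by (auto simp: sums_iff)
    ultimately have "(\<Sum>n. diffs c n * t ^ n) = 0" using DERIV_unique[OF _ DERIV_const] by fastforce
    moreover have "summable (\<lambda>n. diffs c n * t ^ n)"
      by (rule termdiff_converges_all) (rule sm)
    ultimately show ?thesis by (simp add: sums_iff)
  qed
  then have "diffs c n = 0" by (rule Suc.IH)
  then show ?case by (simp add: diffs_def)
qed

text \<open>For complex z, so that one series serves both the moment generating function (real z)
  and the characteristic function (imaginary z).\<close>

lemma (in real_distribution) exponential_moment_series:
  assumes int: "\<And>t::real. integrable M (\<lambda>x. exp (t * x))"
  shows "(\<lambda>n. complex_of_real (expectation (\<lambda>x. x ^ n)) * z ^ n / fact n)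
      sums (\<integral>x. exp (z * complex_of_real x) \<partial>M)"
proof -
  \<comment> \<open>At least |z|, to dominate the series, and at least 1, so that |x|^n <= (r |x|)^n
    also yields the moments.\<close>
  let ?r = "norm z + 1"
  define b where "b x = exp (?r * x) + exp (- (?r * x))" for x
  have b_int: "integrable M b"
    unfolding b_def using int[of ?r] int[of "- ?r"] 
    by (intro Bochner_Integration.integrable_add) (simp_all only: mult_minus_left)
  have b_ge: "exp (?r * \<bar>x\<bar>) \<le> b x" for x by (cases "x \<ge> 0") (auto simp: b_def)
  have term_le: "(?r * \<bar>x\<bar>) ^ n / fact n \<le> b x" for x n
  proof -
    have "(?r * \<bar>x\<bar>) ^ n / fact n \<le> exp (?r * \<bar>x\<bar>)"
      using sum_le_suminf[OF summable_exp_generic[of "?r * \<bar>x\<bar>"], of "{n}"]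
      by (simp add: exp_def divide_inverse_commute scaleR_conv_of_real)
    then show ?thesis using b_ge[of x] by linarith
  qed
  have mom_int: "integrable M (\<lambda>x. x ^ n)" for n
  proof (rule Bochner_Integration.integrable_bound)
    show "integrable M (\<lambda>x. fact n * b x)" using b_int by simp
    have "\<bar>x\<bar> ^ n \<le> fact n * b x" for x
    proof -
      have "\<bar>x\<bar> ^ n \<le> (?r * \<bar>x\<bar>) ^ n" by (intro power_mono) (auto simp: mult_le_cancel_right1)
      also have "\<dots> \<le> fact n * b x" using term_le[of x n] by (simp add: field_simps)
      finally show ?thesis .
    qed
    moreover have "b x \<ge> 0" for x by (simp add: b_def add_nonneg_nonneg)
    ultimately show "AE x in M. norm (x ^ n) \<le> norm (fact n * b x)"
      by (auto simp: power_abs abs_mult)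
  qed measurable
  let ?f = "\<lambda>n x. (z * complex_of_real x) ^ n / fact n"
  have f_eq: "?f n = (\<lambda>x. z ^ n / fact n * complex_of_real (x ^ n))" for n
    by (auto simp: power_mult_distrib)
  have f_int: "integrable M (?f n)" for n
    unfolding f_eq using mom_int by (intro integrable_mult_right integrable_of_real)
  have nrm: "norm (?f n x) = (norm z * \<bar>x\<bar>) ^ n / fact n" for n x
    by (simp add: norm_divide norm_power norm_mult)
  have exp_sums: "(\<lambda>n. a ^ n / fact n) sums exp a" for a :: complex
    using exp_converges[of a] by (simp add: scaleR_conv_of_real divide_inverse_commute)
  have exp_sums': "(\<lambda>n. a ^ n / fact n) sums exp a" for a :: real
    using exp_converges[of a] by (simp add: divide_inverse_commute)
  have "(\<lambda>n. \<integral>x. ?f n x \<partial>M) sums (\<integral>x. (\<Sum>n. ?f n x) \<partial>M)"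
  proof (rule sums_integral)
    show "AE x in M. summable (\<lambda>n. norm (?f n x))"
      unfolding nrm using exp_sums' sums_summable by blast
    have ni: "integrable M (\<lambda>x. norm (?f n x))" for n using f_int by (rule integrable_norm)
    show "summable (\<lambda>n. \<integral>x. norm (?f n x) \<partial>M)"
    proof (rule bounded_imp_summable)
      show "(\<Sum>i\<le>n. \<integral>x. norm (?f i x) \<partial>M) \<le> (\<integral>x. b x \<partial>M)" for n
      proof -
        have "(\<Sum>i\<le>n. norm (?f i x)) \<le> b x" for x
        proof -
          have "(\<Sum>i\<le>n. norm (?f i x)) \<le> exp (norm z * \<bar>x\<bar>)"
            unfolding nrm using sums_unique[OF exp_sums'[of "norm z * \<bar>x\<bar>"]]
              sum_le_suminf[OF sums_summable[OF exp_sums'[of "norm z * \<bar>x\<bar>"]], of "{..n}"] by simp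
          also have "\<dots> \<le> exp (?r * \<bar>x\<bar>)" by (simp add: mult_right_mono)
          finally show ?thesis using b_ge[of x] by linarith
        qed
        then have "(\<integral>x. (\<Sum>i\<le>n. norm (?f i x)) \<partial>M) \<le> (\<integral>x. b x \<partial>M)"
          using ni b_int by (intro integral_mono Bochner_Integration.integrable_sum) auto
        then show ?thesis using ni by (subst (asm) Bochner_Integration.integral_sum) auto
      qed
    qed simp
  qed (rule f_int)
  moreover have "(\<Sum>n. ?f n x) = exp (z * complex_of_real x)" for x
    using exp_sums[of "z * complex_of_real x"] by (simp add: sums_iff)
  moreover have "(\<integral>x. ?f n x \<partial>M) = complex_of_real (expectation (\<lambda>x. x ^ n)) * z ^ n / fact n" for n
    unfolding f_eq by (subst integral_mult_right_zero) (simp add: integral_complex_of_real del: of_real_power)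
  ultimately show ?thesis by simp
qed

text \<open>On the real line the series identifies all moments; on the imaginary axis the same
  moments determine the characteristic function.\<close>

lemma real_distribution_eq_if_mgf_eq:
  assumes M: "real_distribution M" and N: "real_distribution N"
    and int: "\<And>t::real. integrable M (\<lambda>x. exp (t * x))" "\<And>t::real. integrable N (\<lambda>x. exp (t * x))"
    and eq: "\<And>t::real. (\<integral>x. exp (t * x) \<partial>M) = (\<integral>x. exp (t * x) \<partial>N)"
  shows "M = N"
proof (rule Levy_uniqueness[OF M N])
  interpret M: real_distribution M by fact
  interpret N: real_distribution N by fact
  let ?m = "\<lambda>n. M.expectation (\<lambda>x. x ^ n)" and ?n = "\<lambda>n. N.expectation (\<lambda>x. x ^ n)"
  note sM = M.exponential_moment_series[OF int(1)] and sN = N.exponential_moment_series[OF int(2)]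
  have "(\<lambda>n. (?m n - ?n n) / fact n * t ^ n) sums 0" for t :: real
  proof -
    have e: "(\<integral>x. exp (complex_of_real t * complex_of_real x) \<partial>L) = complex_of_real (\<integral>x. exp (t * x) \<partial>L)" for L
      by (simp only: of_real_mult[symmetric] exp_of_real integral_complex_of_real)
    have "(\<lambda>n. complex_of_real ((?m n - ?n n) / fact n * t ^ n)) sums complex_of_real 0"
      using sums_diff[OF sM[of "of_real t"] sN[of "of_real t"]] unfolding e eq
      by (simp add: diff_divide_distrib left_diff_distrib)
    then show ?thesis by (simp only: sums_of_real_iff)
  qed
  then have "(?m n - ?n n) / fact n = 0" for n by (rule real_power_series_zero)
  then have mom: "?m n = ?n n" for n by simp
  show "char M = char N"
  proof
    fix t
    have c: "char L t = (\<integral>x. exp (\<i> * complex_of_real t * complex_of_real x) \<partial>L)" for L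
      by (simp add: char_def mult.assoc)
    show "char M t = char N t"
      unfolding c using sM[of "\<i> * of_real t"] sN[of "\<i> * of_real t"] unfolding mom by (rule sums_unique2)
  qed
qed

section \<open>Cylinder sets and exponential tilting\<close>

text \<open>Finite intersections of half-spaces, built one at a time so that induction meets exactly
  the step proved in \<open>laplace_transform_halfspace\<close>.\<close>

inductive_set cylinder :: "'a::real_inner set set" where
  cylinder_UNIV: "UNIV \<in> cylinder"
| cylinder_Int: "A \<in> cylinder \<Longrightarrow> A \<inter> {y. h \<bullet> y \<le> a} \<in> cylinder"

lemma cylinder_Int_stable: "Int_stable cylinder"
proof (rule Int_stableI)
  fix A B :: "'a set" assume A: "A \<in> cylinder" and B: "B \<in> cylinder"
  from B show "A \<inter> B \<in> cylinder"
    by (induction rule: cylinder.induct) (use A in \<open>auto simp: Int_assoc[symmetric] intro: cylinder.intros\<close>)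
qed

text \<open>A Parseval sequence makes the squared norm a pointwise limit of polynomials in countably
  many linear functionals, so balls are generated by half-spaces. By separability every open set is
  a countable union of balls.\<close>

lemma borel_eq_sigma_cylinder:
  "sets (borel :: 'a::{real_inner,second_countable_topology} measure) = sigma_sets UNIV cylinder"
proof
  have "A \<in> sets borel" if "A \<in> cylinder" for A :: "'a set"
    using that by (induction rule: cylinder.induct) auto
  then show "sigma_sets UNIV cylinder \<subseteq> sets (borel :: 'a measure)"
    using sets.sigma_sets_subset[of cylinder "borel :: 'a measure"] by auto
next
  let ?S = "sigma (UNIV :: 'a set) cylinder"
  have sS: "sets ?S = sigma_sets UNIV cylinder" and spS: "space ?S = UNIV" by auto
  have h [measurable]: "(\<lambda>y. h \<bullet> y) \<in> borel_measurable ?S" for h :: 'a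
  proof (rule borel_measurableI_le)
    show "{x \<in> space ?S. h \<bullet> x \<le> a} \<in> sets ?S" for a
      using cylinder_Int[OF cylinder_UNIV, of h a] by (auto simp: spS intro: sigma_sets.Basic)
  qed
  obtain e :: "nat \<Rightarrow> 'a" where e: "\<And>x. (\<lambda>n. \<Sum>i<n. (e i \<bullet> x)\<^sup>2) \<longlonglongrightarrow> (norm x)\<^sup>2"
    using parseval_sequence_exists by blast
  have [measurable]: "(\<lambda>y. (norm (y - c))\<^sup>2) \<in> borel_measurable ?S" for c
  proof (rule borel_measurable_LIMSEQ_real)
    show "(\<lambda>n. \<Sum>i<n. (e i \<bullet> (y - c))\<^sup>2) \<longlonglongrightarrow> (norm (y - c))\<^sup>2" for y by (rule e)
    show "(\<lambda>y. \<Sum>i<n. (e i \<bullet> (y - c))\<^sup>2) \<in> borel_measurable ?S" for n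
      unfolding inner_diff_right by measurable
  qed
  have ball: "ball c r \<in> sets ?S" for c r
  proof (cases "r > 0")
    case True
    have "{y \<in> space ?S. (norm (y - c))\<^sup>2 < r\<^sup>2} \<in> sets ?S" by measurable
    also have "{y \<in> space ?S. (norm (y - c))\<^sup>2 < r\<^sup>2} = ball c r"
      using True by (auto simp: dist_norm norm_minus_commute power_strict_mono dest: power_less_imp_less_base)
    finally show ?thesis .
  qed (simp add: ball_empty sigma_sets.Empty)
  obtain d :: "nat \<Rightarrow> 'a" where d: "\<And>x r. r > 0 \<Longrightarrow> \<exists>n. dist (d n) x < r"
    using dense_sequence_exists by blast
  have "S \<in> sets ?S" if "open S" for S
  proof -
    have "S = (\<Union>n. \<Union>q\<in>{q::rat. ball (d n) (of_rat q) \<subseteq> S}. ball (d n) (of_rat q))"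
    proof
      show "S \<subseteq> (\<Union>n. \<Union>q\<in>{q::rat. ball (d n) (of_rat q) \<subseteq> S}. ball (d n) (of_rat q))"
      proof
        fix x assume "x \<in> S"
        then obtain r where r: "r > 0" "ball x r \<subseteq> S" using \<open>open S\<close> open_contains_ball by blast
        \<comment> \<open>A centre closer than r / 4 to x puts x inside radius q > r / 4, and q < r
          / 2 keeps the ball within distance 3 r / 4 of x.\<close>
        obtain q :: rat where q: "r / 4 < of_rat q" "of_rat q < r / 2" using of_rat_dense[of "r/4" "r/2"] r by auto
        obtain n where n: "dist (d n) x < r / 4" using d[of "r/4" x] r by auto
        have "ball (d n) (of_rat q) \<subseteq> ball x r"
        proof
          fix y assume "y \<in> ball (d n) (of_rat q)"
          then show "y \<in> ball x r" using n q r dist_triangle[of x y "d n"] by (simp add: dist_commute)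
        qed
        then show "x \<in> (\<Union>n. \<Union>q\<in>{q::rat. ball (d n) (of_rat q) \<subseteq> S}. ball (d n) (of_rat q))"
          using r(2) n q by (auto intro!: exI[of _ n] exI[of _ q])
      qed
    qed auto
    also have "\<dots> \<in> sets ?S"
      by (intro sets.countable_UN'' countableI_type ball)
    finally show ?thesis .
  qed
  then show "sets (borel :: 'a measure) \<subseteq> sigma_sets UNIV cylinder"
    unfolding borel_def sS[symmetric]
    using sets.sigma_sets_subset[of "{S::'a set. open S}" ?S] by (auto simp: spS)
qed

text \<open>After restriction to A, tilting by exp (x . y) and division by m, the law of h . y has
  at t the moment generating function given by the transform at x + t h. Equality is therefore
  assumed at all points, and it is inherited at all points.\<close>

lemma laplace_transform_halfspace:
  fixes M N :: "'a::{real_inner,polish_space} measure"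
  assumes sets [measurable_cong]: "sets M = sets borel" "sets N = sets borel"
    and A [measurable]: "A \<in> sets borel"
    and eq: "\<And>x. (\<integral>\<^sup>+y. ennreal (exp (x \<bullet> y)) * indicator A y \<partial>M) = (\<integral>\<^sup>+y. ennreal (exp (x \<bullet> y)) * indicator A y \<partial>N)"
    and fin: "\<And>x. (\<integral>\<^sup>+y. ennreal (exp (x \<bullet> y)) * indicator A y \<partial>M) < \<infinity>"
  shows "(\<integral>\<^sup>+y. ennreal (exp (x \<bullet> y)) * indicator (A \<inter> {y. h \<bullet> y \<le> a}) y \<partial>M)
       = (\<integral>\<^sup>+y. ennreal (exp (x \<bullet> y)) * indicator (A \<inter> {y. h \<bullet> y \<le> a}) y \<partial>N)"
proof -
  define m where "m = (\<integral>\<^sup>+y. ennreal (exp (x \<bullet> y)) * indicator A y \<partial>M)"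
  have m_N: "m = (\<integral>\<^sup>+y. ennreal (exp (x \<bullet> y)) * indicator A y \<partial>N)" using eq by (simp add: m_def)
  have m_fin: "m < \<infinity>" using fin by (simp add: m_def)
  show ?thesis
  \<comment> \<open>With m = 0 nothing can be normalised, but the integrals over the smaller set
    vanish too.\<close>
  proof (cases "m = 0")
    case True
    have le: "(\<integral>\<^sup>+y. ennreal (exp (x \<bullet> y)) * indicator (A \<inter> {y. h \<bullet> y \<le> a}) y \<partial>L)
       \<le> (\<integral>\<^sup>+y. ennreal (exp (x \<bullet> y)) * indicator A y \<partial>L)" for L
      by (intro nn_integral_mono mult_left_mono) (auto simp: indicator_def)
    show ?thesis using le[of M] le[of N] True m_N unfolding m_def by simp
  next
    case False
    define D where "D L = density L (\<lambda>y. ennreal (exp (x \<bullet> y)) * indicator A y / m)" for L :: "'a measure"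
    define P where "P L = distr (D L) borel (\<lambda>y. h \<bullet> y)" for L :: "'a measure"
    have main: "real_distribution (P L) \<and>
        (\<forall>t::real. (\<integral>\<^sup>+s. ennreal (exp (t * s)) \<partial>P L) =
            (\<integral>\<^sup>+y. ennreal (exp ((x + t *\<^sub>R h) \<bullet> y)) * indicator A y \<partial>L) / m) \<and>
        emeasure (P L) {..a} = (\<integral>\<^sup>+y. ennreal (exp (x \<bullet> y)) * indicator (A \<inter> {y. h \<bullet> y \<le> a}) y \<partial>L) / m"
      if sL [measurable_cong]: "sets L = sets borel"
        and mL: "m = (\<integral>\<^sup>+y. ennreal (exp (x \<bullet> y)) * indicator A y \<partial>L)" for L
    proof (intro conjI allI)
      have spL: "space L = UNIV" using sets_eq_imp_space_eq[OF sL] by simp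
      have [measurable]: "(\<lambda>y. h \<bullet> y) \<in> D L \<rightarrow>\<^sub>M borel" unfolding D_def by measurable
      have "emeasure (D L) (space (D L)) = (\<integral>\<^sup>+y. ennreal (exp (x \<bullet> y)) * indicator A y / m \<partial>L)"
        unfolding D_def by (subst emeasure_density) (auto simp: spL)
      also have "\<dots> = 1"
        using False m_fin mL by (subst nn_integral_divide) (auto simp: ennreal_divide_self less_top)
      finally have "prob_space (D L)" by (rule prob_spaceI)
      then show "real_distribution (P L)" unfolding P_def
        by (simp add: real_distribution_def real_distribution_axioms_def prob_space.prob_space_distr)
      show "(\<integral>\<^sup>+s. ennreal (exp (t * s)) \<partial>P L) =
            (\<integral>\<^sup>+y. ennreal (exp ((x + t *\<^sub>R h) \<bullet> y)) * indicator A y \<partial>L) / m" for t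
      proof -
        have "(\<integral>\<^sup>+s. ennreal (exp (t * s)) \<partial>P L) = (\<integral>\<^sup>+y. ennreal (exp (t * (h \<bullet> y))) \<partial>D L)"
          unfolding P_def by (subst nn_integral_distr) auto
        also have "\<dots> = (\<integral>\<^sup>+y. ennreal (exp (x \<bullet> y)) * indicator A y / m * ennreal (exp (t * (h \<bullet> y))) \<partial>L)"
          unfolding D_def by (subst nn_integral_density) auto
        also have "\<dots> = (\<integral>\<^sup>+y. ennreal (exp ((x + t *\<^sub>R h) \<bullet> y)) * indicator A y / m \<partial>L)"
        proof (rule nn_integral_cong)
          fix y
          have "exp ((x + t *\<^sub>R h) \<bullet> y) = exp (t * (h \<bullet> y)) * exp (x \<bullet> y)"
            by (simp add: inner_add_left exp_add)
          then show "ennreal (exp (x \<bullet> y)) * indicator A y / m * ennreal (exp (t * (h \<bullet> y)))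
              = ennreal (exp ((x + t *\<^sub>R h) \<bullet> y)) * indicator A y / m"
            by (cases "y \<in> A") (simp_all add: ennreal_mult ennreal_times_divide mult.commute)
        qed
        also have "\<dots> = (\<integral>\<^sup>+y. ennreal (exp ((x + t *\<^sub>R h) \<bullet> y)) * indicator A y \<partial>L) / m"
          by (rule nn_integral_divide) measurable
        finally show ?thesis .
      qed
      have "emeasure (P L) {..a} = emeasure (D L) {y. h \<bullet> y \<le> a}"
        unfolding P_def by (subst emeasure_distr) (auto simp: D_def spL intro!: arg_cong2[where f=emeasure])
      also have "\<dots> = (\<integral>\<^sup>+y. ennreal (exp (x \<bullet> y)) * indicator A y / m * indicator {y. h \<bullet> y \<le> a} y \<partial>L)"
        unfolding D_def by (subst emeasure_density) auto
      also have "\<dots> = (\<integral>\<^sup>+y. ennreal (exp (x \<bullet> y)) * indicator (A \<inter> {y. h \<bullet> y \<le> a}) y / m \<partial>L)"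
        by (intro nn_integral_cong) (auto split: split_indicator)
      also have "\<dots> = (\<integral>\<^sup>+y. ennreal (exp (x \<bullet> y)) * indicator (A \<inter> {y. h \<bullet> y \<le> a}) y \<partial>L) / m"
        by (rule nn_integral_divide) measurable
      finally show "emeasure (P L) {..a} = (\<integral>\<^sup>+y. ennreal (exp (x \<bullet> y)) * indicator (A \<inter> {y. h \<bullet> y \<le> a}) y \<partial>L) / m" .
    qed
    note mM = main[OF sets(1) m_def] and mN = main[OF sets(2) m_N]
    have int: "integrable Q (\<lambda>s. exp (t * s))" if "Q = P M \<or> Q = P N" for Q and t :: real
    proof (rule integrableI_nonneg)
      have "sets Q = sets borel" using that by (auto simp: P_def)
      then show "(\<lambda>s. exp (t * s)) \<in> borel_measurable Q" by (simp cong: measurable_cong_sets)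
      show "(\<integral>\<^sup>+s. ennreal (exp (t * s)) \<partial>Q) < \<infinity>"
        using that mM mN fin[of "x + t *\<^sub>R h"] eq[of "x + t *\<^sub>R h"] False
        by (auto simp: ennreal_divide_eq_top_iff less_top[symmetric] top_unique)
    qed simp
    have "P M = P N"
    proof (rule real_distribution_eq_if_mgf_eq)
      show "(\<integral>s. exp (t * s) \<partial>P M) = (\<integral>s. exp (t * s) \<partial>P N)" for t
        using mM mN eq[of "x + t *\<^sub>R h"]
        by (subst (1 2) integral_eq_nn_integral) (auto simp: P_def)
    qed (use mM mN int in auto)
    then have "emeasure (P M) {..a} = emeasure (P N) {..a}" by simp
    then have "m * ((\<integral>\<^sup>+y. ennreal (exp (x \<bullet> y)) * indicator (A \<inter> {y. h \<bullet> y \<le> a}) y \<partial>M) / m) =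
        m * ((\<integral>\<^sup>+y. ennreal (exp (x \<bullet> y)) * indicator (A \<inter> {y. h \<bullet> y \<le> a}) y \<partial>N) / m)"
      unfolding mM[THEN conjunct2, THEN conjunct2] mN[THEN conjunct2, THEN conjunct2] by simp
    moreover have "m * (b / m) = b" for b :: ennreal
    proof -
      have "m * (b / m) = (b * m) / m" by (simp only: ennreal_times_divide mult.commute)
      also have "\<dots> = b" using False m_fin by (intro mult_divide_eq_ennreal) auto
      finally show ?thesis .
    qed
    ultimately show ?thesis by simp
  qed
qed

text \<open>A half-space can be added to a cylinder set because exponential tilting makes every
  one-dimensional marginal determined by its moment generating function.\<close>
lemma measure_eq_if_laplace_transform_eq:
  fixes M N :: "'a::{real_inner,polish_space} measure"
  assumes sets: "sets M = sets borel" "sets N = sets borel"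
    and eq: "\<And>x. (\<integral>\<^sup>+y. ennreal (exp (x \<bullet> y)) \<partial>M) = (\<integral>\<^sup>+y. ennreal (exp (x \<bullet> y)) \<partial>N)"
    and fin: "\<And>x. (\<integral>\<^sup>+y. ennreal (exp (x \<bullet> y)) \<partial>M) < \<infinity>"
  shows "M = N"
proof -
  have cyl: "A \<in> sets borel \<and> (\<forall>x. (\<integral>\<^sup>+y. ennreal (exp (x \<bullet> y)) * indicator A y \<partial>M)
      = (\<integral>\<^sup>+y. ennreal (exp (x \<bullet> y)) * indicator A y \<partial>N))" if "A \<in> cylinder" for A
    using that
  proof (induction rule: cylinder.induct)
    case (cylinder_Int A h a)
    have "(\<integral>\<^sup>+y. ennreal (exp (x \<bullet> y)) * indicator A y \<partial>M) < \<infinity>" for x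
      by (rule le_less_trans[OF nn_integral_mono fin[of x]]) (auto simp: indicator_def)
    then show ?case
      using cylinder_Int laplace_transform_halfspace[OF sets, of A] by auto
  qed (simp add: eq)
  show ?thesis
  proof (rule measure_eqI_generator_eq[OF cylinder_Int_stable, where \<Omega>=UNIV and A="\<lambda>_. UNIV"])
    show "emeasure M X = emeasure N X" if "X \<in> cylinder" for X
    proof -
      \<comment> \<open>At x = 0 the exponential is 1 and the transform is the measure of the
        set.\<close>
      have "(\<integral>\<^sup>+y. indicator X y \<partial>M) = (\<integral>\<^sup>+y. indicator X y \<partial>N)" and "X \<in> sets borel"
        using cyl[OF that] by (auto dest!: spec[of _ 0])
      then show ?thesis using sets by simp
    qed
    have "emeasure M UNIV = (\<integral>\<^sup>+y. ennreal (exp (0 \<bullet> y)) \<partial>M)"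
      using sets_eq_imp_space_eq[OF sets(1)] by simp
    then show "emeasure M UNIV \<noteq> \<infinity>" using fin[of 0] by simp
  qed (auto simp: sets borel_eq_sigma_cylinder intro: cylinder.intros)
qed

section \<open>Entropic duality\<close>

text \<open>The negative part of p ln p is at most 1, hence integrable against a probability
  measure. The difference in \<open>KL\<close> is thus never infinity minus infinity, and
  non-integrability can only mean the value infinity.\<close>

lemma KL_density:
  assumes "prob_space P" and [measurable]: "p \<in> borel_measurable P" and p: "\<And>z. p z \<ge> 0"
  shows "KL (density P (\<lambda>z. ennreal (p z))) P =
    (if integrable P (\<lambda>z. p z * ln (p z)) then ereal (\<integral>z. p z * ln (p z) \<partial>P) else \<infinity>)"
proof -
  interpret prob_space P by fact
  let ?D = "density P (\<lambda>z. ennreal (p z))"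
  let ?g = "\<lambda>z. p z * ln (p z)"
  have ac: "absolutely_continuous P ?D" by (rule absolutely_continuousI_density) measurable
  have "AE z in P. ennreal (p z) = RN_deriv P ?D z" by (rule RN_deriv_unique) auto
  then have RN: "AE z in P. enn2real (RN_deriv P ?D z) = p z"
    by eventually_elim (metis enn2real_ennreal p)
  define A where "A = (\<integral>\<^sup>+z. ennreal (?g z) \<partial>P)"
  define B where "B = (\<integral>\<^sup>+z. ennreal (- ?g z) \<partial>P)"
  have max0: "ennreal (max 0 x) = ennreal x" for x by (cases "x \<ge> 0") (auto simp: ennreal_neg max_def)
  have KL: "KL ?D P = enn2ereal A - enn2ereal B"
  proof -
    have "(\<integral>\<^sup>+ x. ennreal (max 0 (enn2real (RN_deriv P ?D x) * ln (enn2real (RN_deriv P ?D x)))) \<partial>P) = A"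
      unfolding A_def max0 using RN by (intro nn_integral_cong_AE) (auto elim!: eventually_mono)
    moreover have "(\<integral>\<^sup>+ x. ennreal (max 0 (- (enn2real (RN_deriv P ?D x) * ln (enn2real (RN_deriv P ?D x))))) \<partial>P) = B"
      unfolding B_def max0 using RN by (intro nn_integral_cong_AE) (auto elim!: eventually_mono)
    ultimately show ?thesis using ac by (simp add: KL_def Let_def)
  qed
  have neg: "- ?g z \<le> 1" for z
  proof (cases "p z = 0")
    case False
    with p[of z] have pos: "p z > 0" by simp
    have "ln (1 / p z) \<le> 1 / p z - 1" using pos by (intro ln_le_minus_one) simp
    then have "p z * (- ln (p z)) \<le> p z * (1 / p z - 1)"
      using pos by (intro mult_left_mono) (auto simp: ln_div)
    also have "\<dots> \<le> 1" using pos by (simp add: field_simps)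
    finally show ?thesis by simp
  qed simp
  have "B \<le> (\<integral>\<^sup>+z. ennreal 1 \<partial>P)"
    unfolding B_def using neg by (intro nn_integral_mono ennreal_leI)
  then have "B \<le> 1" by (simp add: emeasure_space_1)
  then obtain b where b: "B = ennreal b" "b \<ge> 0" by (cases B) (auto simp: top_unique)
  show ?thesis
  proof (cases "integrable P ?g")
    case True
    then have "A \<noteq> \<infinity>" unfolding A_def by (simp add: real_integrable_def)
    then obtain a where a: "A = ennreal a" "a \<ge> 0" by (cases A) auto
    have "(\<integral>z. ?g z \<partial>P) = a - b"
      using real_lebesgue_integral_def[OF True] a b unfolding A_def B_def by simp
    then show ?thesis using True a b unfolding KL by simp
  next
    case False
    then have "A = \<infinity>" unfolding A_def using b unfolding B_def by (auto simp: real_integrable_def)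
    then show ?thesis using False b unfolding KL by simp
  qed
qed

lemma
  assumes \<gamma>: "\<gamma> \<in> Joint \<mu> \<nu>"
  shows Joint_integrable_fst: "integrable \<mu> h \<Longrightarrow> integrable \<gamma> (\<lambda>z. h (fst z) :: real)"
    and Joint_integral_fst: "integrable \<mu> h \<Longrightarrow> (\<integral>z. h (fst z) \<partial>\<gamma>) = (\<integral>x. h x \<partial>\<mu>)"
    and Joint_integrable_snd: "integrable \<nu> k \<Longrightarrow> integrable \<gamma> (\<lambda>z. k (snd z) :: real)"
    and Joint_integral_snd: "integrable \<nu> k \<Longrightarrow> (\<integral>z. k (snd z) \<partial>\<gamma>) = (\<integral>x. k x \<partial>\<nu>)"
proof -
  have [measurable_cong]: "sets \<gamma> = sets (\<mu> \<Otimes>\<^sub>M \<nu>)"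
    and d: "distr \<gamma> \<mu> fst = \<mu>" "distr \<gamma> \<nu> snd = \<nu>"
    using \<gamma> by (auto simp: Joint_def)
  have [measurable]: "fst \<in> \<gamma> \<rightarrow>\<^sub>M \<mu>" "snd \<in> \<gamma> \<rightarrow>\<^sub>M \<nu>" by measurable
  show "integrable \<gamma> (\<lambda>z. h (fst z))" if "integrable \<mu> h"
    using that integrable_distr[of fst \<gamma> \<mu> h] by (simp add: d)
  show "integrable \<gamma> (\<lambda>z. k (snd z))" if "integrable \<nu> k"
    using that integrable_distr[of snd \<gamma> \<nu> k] by (simp add: d)
  show "(\<integral>z. h (fst z) \<partial>\<gamma>) = (\<integral>x. h x \<partial>\<mu>)" if "integrable \<mu> h"
    using that integral_distr[of fst \<gamma> \<mu> h] by (simp add: d)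
  show "(\<integral>z. k (snd z) \<partial>\<gamma>) = (\<integral>x. k x \<partial>\<nu>)" if "integrable \<nu> k"
    using that integral_distr[of snd \<gamma> \<nu> k] by (simp add: d)
qed

text \<open>Reads the pairing as the total mass of the unnormalised coupling density, the number Z
  of the dual bound.\<close>

lemma kernel_pairing_eq_pair_integral:
  fixes \<mu> \<nu> :: "'a::{real_inner,polish_space} measure"
  assumes "prob_space \<nu>" and [measurable_cong]: "sets \<mu> = sets borel" "sets \<nu> = sets borel"
    and [measurable]: "u \<in> borel_measurable borel" "v \<in> borel_measurable borel"
    and nn: "\<And>x. u x \<ge> 0" "\<And>x. v x \<ge> 0"
  shows "(\<integral>\<^sup>+z. ennreal (u (fst z) * v (snd z) * gauss_kernel \<epsilon> (fst z) (snd z)) \<partial>(\<mu> \<Otimes>\<^sub>M \<nu>))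
    = kernel_pairing \<epsilon> \<mu> u \<nu> v"
proof -
  interpret prob_space \<nu> by fact
  show ?thesis
    unfolding kernel_pairing_def kernel_potential_def
    by (subst nn_integral_fst[symmetric], measurable, subst nn_integral_cmult[symmetric])
       (auto simp: ennreal_mult'[symmetric] nn mult.assoc)
qed

text \<open>For densities f of a coupling and q = u v k the pointwise inequality f ln f - f ln q >=
  f - q integrates to a right side of 1 - Z. On the left ln q splits into ln u, ln v and - cost /
  epsilon, and the marginals of the coupling evaluate the first two.\<close>

lemma OT_eps_weak_duality:
  fixes \<mu> \<nu> :: "'a::{real_inner,polish_space} measure"
  assumes \<epsilon>: "\<epsilon> > 0" and prob: "prob_space \<mu>" "prob_space \<nu>"
    and sets [measurable_cong]: "sets \<mu> = sets borel" "sets \<nu> = sets borel"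
    and uv [measurable]: "u \<in> borel_measurable borel" "v \<in> borel_measurable borel"
    and pos: "\<And>x. u x > 0" "\<And>x. v x > 0"
    and int: "integrable \<mu> (\<lambda>x. ln (u x))" "integrable \<nu> (\<lambda>x. ln (v x))"
    and Z: "kernel_pairing \<epsilon> \<mu> u \<nu> v = ennreal Z" "Z \<ge> 0"
  shows "ereal (\<epsilon> * ((\<integral>x. ln (u x) \<partial>\<mu>) + (\<integral>x. ln (v x) \<partial>\<nu>) + 1 - Z)) \<le> OT_eps \<epsilon> \<mu> \<nu>"
  unfolding OT_eps_def
proof (rule INF_greatest)
  fix \<gamma> assume \<gamma>: "\<gamma> \<in> Joint \<mu> \<nu>"
  interpret \<mu>: prob_space \<mu> by fact
  interpret \<nu>: prob_space \<nu> by fact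
  interpret P: pair_prob_space \<mu> \<nu> ..
  let ?P = "\<mu> \<Otimes>\<^sub>M \<nu>"
  let ?c = "\<lambda>z::'a \<times> 'a. (norm (fst z - snd z))\<^sup>2"
  let ?C = "\<integral>\<^sup>+z. ennreal (?c z) \<partial>\<gamma>"
  have sets_\<gamma> [measurable_cong]: "sets \<gamma> = sets ?P" and "prob_space \<gamma>" using \<gamma> by (auto simp: Joint_def)
  interpret G: prob_space \<gamma> by fact
  let ?goal = "ereal (\<epsilon> * ((\<integral>x. ln (u x) \<partial>\<mu>) + (\<integral>x. ln (v x) \<partial>\<nu>) + 1 - Z)) \<le> enn2ereal ?C + ereal \<epsilon> * KL \<gamma> ?P"
  have inf: ?goal if "KL \<gamma> ?P = \<infinity>"
    unfolding that using \<epsilon> by (cases ?C) auto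
  show ?goal
  proof (cases "absolutely_continuous ?P \<gamma>")
    case False
    then show ?thesis by (intro inf) (simp add: KL_def)
  next
    case ac: True
    define f where "f z = enn2real (RN_deriv ?P \<gamma> z)" for z
    have f_meas [measurable]: "f \<in> borel_measurable ?P" unfolding f_def by measurable
    have f0: "f z \<ge> 0" for z by (simp add: f_def)
    have "AE z in ?P. RN_deriv ?P \<gamma> z \<noteq> \<infinity>"
      by (rule P.RN_deriv_finite[OF _ ac sets_\<gamma>]) (rule G.sigma_finite_measure_axioms)
    then have "AE z in ?P. RN_deriv ?P \<gamma> z = ennreal (f z)"
      by eventually_elim (auto simp: f_def less_top)
    then have "density ?P (RN_deriv ?P \<gamma>) = density ?P (\<lambda>z. ennreal (f z))"
      by (intro density_cong) auto
    then have \<gamma>_eq: "\<gamma> = density ?P (\<lambda>z. ennreal (f z))"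
      using P.density_RN_deriv[OF ac sets_\<gamma>] by simp
    let ?g = "\<lambda>z. f z * ln (f z)"
    have KL: "KL \<gamma> ?P = (if integrable ?P ?g then ereal (\<integral>z. ?g z \<partial>?P) else \<infinity>)"
      using KL_density[OF P.prob_space_axioms f_meas f0] by (simp add: \<gamma>_eq[symmetric])
    have trans: "integrable \<gamma> h \<longleftrightarrow> integrable ?P (\<lambda>z. f z * h z)" "(\<integral>z. h z \<partial>\<gamma>) = (\<integral>z. f z * h z \<partial>?P)"
      if [measurable]: "h \<in> borel_measurable ?P" for h :: "_ \<Rightarrow> real"
      unfolding \<gamma>_eq using f0 by (simp_all add: integrable_density integral_density)
    show ?thesis
    proof (cases "integrable ?P ?g \<and> ?C \<noteq> \<infinity>")
      case False
      then show ?thesis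
      proof (cases "integrable ?P ?g")
        case True
        with False have "?C = \<infinity>" by simp
        then show ?thesis using True by (simp add: KL)
      qed (use inf KL in simp)
    next
      case True
      have c_int: "integrable \<gamma> ?c" using True by (intro integrableI_nonneg) (auto simp: less_top)
      have C: "?C = ennreal (\<integral>z. ?c z \<partial>\<gamma>)" using c_int by (intro nn_integral_eq_integral) auto
      let ?q = "\<lambda>z. u (fst z) * v (snd z) * gauss_kernel \<epsilon> (fst z) (snd z)"
      have q_pos: "?q z > 0" for z by (intro mult_pos_pos pos gauss_kernel_pos)
      have q: "integrable ?P ?q" "(\<integral>z. ?q z \<partial>?P) = Z"
      proof -
        have "(\<integral>\<^sup>+z. ennreal (?q z) \<partial>?P) = ennreal Z"
          using kernel_pairing_eq_pair_integral[OF prob(2) sets uv] pos Z by (simp add: less_imp_le)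
        then have "integrable ?P ?q \<and> (\<integral>z. ?q z \<partial>?P) = Z"
          using q_pos Z(2) by (subst (asm) nn_integral_eq_integrable) (auto simp: less_imp_le)
        then show "integrable ?P ?q" "(\<integral>z. ?q z \<partial>?P) = Z" by auto
      qed
      have one: "integrable ?P f" "(\<integral>z. f z \<partial>?P) = 1"
        using trans[of "\<lambda>_. 1"] G.prob_space by auto
      have lu: "integrable ?P (\<lambda>z. f z * ln (u (fst z)))" "(\<integral>z. f z * ln (u (fst z)) \<partial>?P) = (\<integral>x. ln (u x) \<partial>\<mu>)"
        using trans[of "\<lambda>z. ln (u (fst z))"] Joint_integrable_fst[OF \<gamma> int(1)] Joint_integral_fst[OF \<gamma> int(1)] by auto
      have lv: "integrable ?P (\<lambda>z. f z * ln (v (snd z)))" "(\<integral>z. f z * ln (v (snd z)) \<partial>?P) = (\<integral>x. ln (v x) \<partial>\<nu>)"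
        using trans[of "\<lambda>z. ln (v (snd z))"] Joint_integrable_snd[OF \<gamma> int(2)] Joint_integral_snd[OF \<gamma> int(2)] by auto
      have c: "integrable ?P (\<lambda>z. f z * ?c z)" "(\<integral>z. f z * ?c z \<partial>?P) = (\<integral>z. ?c z \<partial>\<gamma>)"
        using trans[of ?c] c_int by auto
      have pt: "f z - ?q z \<le> ?g z + (1 / \<epsilon>) * (f z * ?c z) - f z * ln (u (fst z)) - f z * ln (v (snd z))" for z
      proof (cases "f z = 0")
        case True
        then show ?thesis using q_pos[of z] by simp
      next
        case False
        with f0[of z] have fp: "f z > 0" by simp
        have lnq: "ln (?q z) = ln (u (fst z)) + ln (v (snd z)) - ?c z / \<epsilon>"
          using pos gauss_kernel_pos[of \<epsilon> "fst z" "snd z"]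
          by (simp add: ln_mult_pos mult_pos_pos) (simp add: gauss_kernel_def)
        have "ln (?q z / f z) \<le> ?q z / f z - 1" using fp q_pos[of z] by (intro ln_le_minus_one) simp
        then have "f z * ln (?q z / f z) \<le> f z * (?q z / f z - 1)" using fp by (intro mult_left_mono) auto
        also have "\<dots> = ?q z - f z" using fp by (simp add: field_simps)
        also have "ln (?q z / f z) = ln (?q z) - ln (f z)" using fp q_pos[of z] by (intro ln_divide_pos)
        finally show ?thesis unfolding lnq by (simp add: algebra_simps)
      qed
      have "1 - Z = (\<integral>z. f z - ?q z \<partial>?P)" using one q by simp
      also have "\<dots> \<le> (\<integral>z. ?g z + (1 / \<epsilon>) * (f z * ?c z) - f z * ln (u (fst z)) - f z * ln (v (snd z)) \<partial>?P)"
        using one q True c lu lv pt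
        by (intro integral_mono Bochner_Integration.integrable_diff Bochner_Integration.integrable_add
            integrable_mult_right) auto
      also have "\<dots> = (\<integral>z. ?g z \<partial>?P) + (1 / \<epsilon>) * (\<integral>z. ?c z \<partial>\<gamma>) - (\<integral>x. ln (u x) \<partial>\<mu>) - (\<integral>x. ln (v x) \<partial>\<nu>)"
        unfolding c(2)[symmetric] lu(2)[symmetric] lv(2)[symmetric] using True c(1) lu(1) lv(1)
        by (intro has_bochner_integral_integral_eq has_bochner_integral_diff has_bochner_integral_add
            has_bochner_integral_mult_right has_bochner_integral_integrable) auto
      finally have "\<epsilon> * ((\<integral>x. ln (u x) \<partial>\<mu>) + (\<integral>x. ln (v x) \<partial>\<nu>) + 1 - Z) \<le> \<epsilon> * ((\<integral>z. ?g z \<partial>?P) + (1 / \<epsilon>) * (\<integral>z. ?c z \<partial>\<gamma>))"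
        using \<epsilon> by (intro mult_left_mono) auto
      also have "\<dots> = (\<integral>z. ?c z \<partial>\<gamma>) + \<epsilon> * (\<integral>z. ?g z \<partial>?P)" using \<epsilon> by (simp add: field_simps)
      finally have "ereal (\<epsilon> * ((\<integral>x. ln (u x) \<partial>\<mu>) + (\<integral>x. ln (v x) \<partial>\<nu>) + 1 - Z))
          \<le> ereal ((\<integral>z. ?c z \<partial>\<gamma>) + \<epsilon> * (\<integral>z. ?g z \<partial>?P))" by simp
      then show ?thesis using True by (simp add: KL C)
    qed
  qed
qed

text \<open>The coupling has density u(x) u(y) k(x,y); the potential equation says that both
  marginals are right. In its entropy the cost appears with factor - 1 / epsilon and cancels the
  transport cost, which second moments make finite.\<close>

lemma OT_eps_self_upper:
  fixes \<mu> :: "'a::{real_inner,polish_space} measure"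
  assumes \<epsilon>: "\<epsilon> > 0" and prob: "prob_space \<mu>"
    and sets [measurable_cong]: "sets \<mu> = sets borel"
    and m2: "integrable \<mu> (\<lambda>x. (norm x)\<^sup>2)"
    and u [measurable]: "u \<in> borel_measurable borel" and pos: "\<And>x. u x > 0"
    and int: "integrable \<mu> (\<lambda>x. ln (u x))"
    and pot: "\<And>x. kernel_potential \<epsilon> \<mu> u x = ennreal (1 / u x)"
  shows "OT_eps \<epsilon> \<mu> \<mu> \<le> ereal (\<epsilon> * (2 * (\<integral>x. ln (u x) \<partial>\<mu>)))"
proof -
  interpret \<mu>: prob_space \<mu> by fact
  interpret P: pair_prob_space \<mu> \<mu> ..
  let ?P = "\<mu> \<Otimes>\<^sub>M \<mu>"
  let ?c = "\<lambda>z::'a \<times> 'a. (norm (fst z - snd z))\<^sup>2"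
  have space: "space \<mu> = UNIV" using sets_eq_imp_space_eq[OF sets] by simp
  define p where "p z = u (fst z) * u (snd z) * gauss_kernel \<epsilon> (fst z) (snd z)" for z
  have p_meas [measurable]: "p \<in> borel_measurable ?P" unfolding p_def by measurable
  have p_pos: "p z > 0" for z unfolding p_def by (intro mult_pos_pos pos gauss_kernel_pos)
  then have p0: "p z \<ge> 0" for z by (simp add: less_imp_le)
  define \<gamma> where "\<gamma> = density ?P (\<lambda>z. ennreal (p z))"
  have marg: "(\<integral>\<^sup>+y. ennreal (p (x, y)) \<partial>\<mu>) = 1" "(\<integral>\<^sup>+y. ennreal (p (y, x)) \<partial>\<mu>) = 1" for x
  proof -
    have "(\<integral>\<^sup>+y. ennreal (p (x, y)) \<partial>\<mu>) = ennreal (u x) * kernel_potential \<epsilon> \<mu> u x"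
      unfolding kernel_potential_def p_def
      by (subst nn_integral_cmult[symmetric]) (auto simp: ennreal_mult'[symmetric] less_imp_le[OF pos] mult.assoc)
    also have "\<dots> = 1" using pos[of x] by (simp add: pot ennreal_mult'[symmetric] less_imp_le)
    finally show "(\<integral>\<^sup>+y. ennreal (p (x, y)) \<partial>\<mu>) = 1" .
    moreover have "p (y, x) = p (x, y)" for y
      by (simp add: p_def gauss_kernel_commute[of _ y x] mult.commute)
    ultimately show "(\<integral>\<^sup>+y. ennreal (p (y, x)) \<partial>\<mu>) = 1" by simp
  qed
  have d1: "distr \<gamma> \<mu> fst = \<mu>"
  proof (rule measure_eqI)
    fix A assume "A \<in> sets (distr \<gamma> \<mu> fst)"
    then have [measurable]: "A \<in> sets \<mu>" by simp
    have "emeasure (distr \<gamma> \<mu> fst) A = (\<integral>\<^sup>+x. indicator A x \<partial>distr \<gamma> \<mu> fst)" by simp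
    also have "\<dots> = (\<integral>\<^sup>+z. indicator A (fst z) \<partial>\<gamma>)"
      unfolding \<gamma>_def by (rule nn_integral_distr) measurable
    also have "\<dots> = (\<integral>\<^sup>+z. ennreal (p z) * indicator A (fst z) \<partial>?P)"
      unfolding \<gamma>_def by (rule nn_integral_density) measurable
    also have "\<dots> = (\<integral>\<^sup>+x. \<integral>\<^sup>+y. ennreal (p (x, y)) * indicator A x \<partial>\<mu> \<partial>\<mu>)"
      by (subst \<mu>.nn_integral_fst[symmetric]) auto
    also have "\<dots> = (\<integral>\<^sup>+x. indicator A x \<partial>\<mu>)"
      by (intro nn_integral_cong) (subst nn_integral_multc, auto simp: marg)
    finally show "emeasure (distr \<gamma> \<mu> fst) A = emeasure \<mu> A" by simp
  qed simp
  have d2: "distr \<gamma> \<mu> snd = \<mu>"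
  proof (rule measure_eqI)
    fix A assume "A \<in> sets (distr \<gamma> \<mu> snd)"
    then have [measurable]: "A \<in> sets \<mu>" by simp
    have "emeasure (distr \<gamma> \<mu> snd) A = (\<integral>\<^sup>+x. indicator A x \<partial>distr \<gamma> \<mu> snd)" by simp
    also have "\<dots> = (\<integral>\<^sup>+z. indicator A (snd z) \<partial>\<gamma>)"
      unfolding \<gamma>_def by (rule nn_integral_distr) measurable
    also have "\<dots> = (\<integral>\<^sup>+z. ennreal (p z) * indicator A (snd z) \<partial>?P)"
      unfolding \<gamma>_def by (rule nn_integral_density) measurable
    also have "\<dots> = (\<integral>\<^sup>+y. \<integral>\<^sup>+x. ennreal (p (x, y)) * indicator A y \<partial>\<mu> \<partial>\<mu>)"
      by (subst P.nn_integral_snd[symmetric]) auto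
    also have "\<dots> = (\<integral>\<^sup>+x. indicator A x \<partial>\<mu>)"
      by (intro nn_integral_cong) (subst nn_integral_multc, auto simp: marg)
    finally show "emeasure (distr \<gamma> \<mu> snd) A = emeasure \<mu> A" by simp
  qed simp
  have "prob_space \<gamma>"
  proof (rule prob_spaceI)
    have "emeasure \<gamma> (space \<gamma>) = emeasure (distr \<gamma> \<mu> fst) (space \<mu>)"
      unfolding \<gamma>_def by (subst emeasure_distr) (auto simp: space space_pair_measure)
    then show "emeasure \<gamma> (space \<gamma>) = 1" unfolding d1 by (simp add: \<mu>.emeasure_space_1)
  qed
  then have \<gamma>: "\<gamma> \<in> Joint \<mu> \<mu>" using d1 d2 by (simp add: Joint_def \<gamma>_def)
  have trans: "integrable \<gamma> h \<longleftrightarrow> integrable ?P (\<lambda>z. p z * h z)" "(\<integral>z. h z \<partial>\<gamma>) = (\<integral>z. p z * h z \<partial>?P)"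
    if [measurable]: "h \<in> borel_measurable ?P" for h :: "_ \<Rightarrow> real"
    unfolding \<gamma>_def using p0 by (simp_all add: integrable_density integral_density)
  have c_int: "integrable \<gamma> ?c"
  proof (rule Bochner_Integration.integrable_bound)
    show "integrable \<gamma> (\<lambda>z. 2 * (norm (fst z))\<^sup>2 + 2 * (norm (snd z))\<^sup>2)"
      using Joint_integrable_fst[OF \<gamma> m2] Joint_integrable_snd[OF \<gamma> m2]
      by (intro Bochner_Integration.integrable_add integrable_mult_right) auto
    have "?c z \<le> 2 * (norm (fst z))\<^sup>2 + 2 * (norm (snd z))\<^sup>2" for z
      using zero_le_power2[of "norm (fst z + snd z)"] unfolding power2_norm_eq_inner
      by (simp add: inner_diff_left inner_diff_right inner_add_left inner_add_right inner_commute)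
    then show "AE z in \<gamma>. norm (?c z) \<le> norm (2 * (norm (fst z))\<^sup>2 + 2 * (norm (snd z))\<^sup>2)"
      by (intro AE_I2) (simp add: abs_of_nonneg)
    show "?c \<in> borel_measurable \<gamma>" unfolding \<gamma>_def by measurable
  qed
  let ?l = "\<lambda>z. ln (u (fst z)) + ln (u (snd z)) - ?c z / \<epsilon>"
  have lnp: "ln (p z) = ?l z" for z
    unfolding p_def using pos gauss_kernel_pos[of \<epsilon> "fst z" "snd z"]
    by (simp add: ln_mult_pos mult_pos_pos) (simp add: gauss_kernel_def)
  note lu = Joint_integrable_fst[OF \<gamma> int] Joint_integrable_snd[OF \<gamma> int]
    Joint_integral_fst[OF \<gamma> int] Joint_integral_snd[OF \<gamma> int]
  have l_int: "integrable \<gamma> ?l"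
    using lu c_int by (intro Bochner_Integration.integrable_diff Bochner_Integration.integrable_add) auto
  have l_val: "(\<integral>z. ?l z \<partial>\<gamma>) = 2 * (\<integral>x. ln (u x) \<partial>\<mu>) - (\<integral>z. ?c z \<partial>\<gamma>) / \<epsilon>"
    using lu c_int by (subst Bochner_Integration.integral_diff) auto
  have "integrable ?P (\<lambda>z. p z * ln (p z))" "(\<integral>z. p z * ln (p z) \<partial>?P) = (\<integral>z. ?l z \<partial>\<gamma>)"
    unfolding lnp using trans[of ?l] l_int by auto
  then have KL: "KL \<gamma> ?P = ereal (2 * (\<integral>x. ln (u x) \<partial>\<mu>) - (\<integral>z. ?c z \<partial>\<gamma>) / \<epsilon>)"
    using KL_density[OF P.prob_space_axioms p_meas p0] unfolding \<gamma>_def[symmetric] l_val by simp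
  have C: "(\<integral>\<^sup>+z. ennreal (?c z) \<partial>\<gamma>) = ennreal (\<integral>z. ?c z \<partial>\<gamma>)"
    using c_int by (intro nn_integral_eq_integral) auto
  have "OT_eps \<epsilon> \<mu> \<mu> \<le> enn2ereal (\<integral>\<^sup>+z. ennreal (?c z) \<partial>\<gamma>) + ereal \<epsilon> * KL \<gamma> ?P"
    unfolding OT_eps_def by (rule INF_lower) (rule \<gamma>)
  also have "\<dots> = ereal (\<epsilon> * (2 * (\<integral>x. ln (u x) \<partial>\<mu>)))"
    unfolding KL C using \<epsilon> by (simp add: field_simps)
  finally show ?thesis .
qed

lemma density_reciprocal:
  assumes [measurable]: "w \<in> borel_measurable \<mu>" and pos: "\<And>x. w x > (0::real)"
  shows "density (density \<mu> (\<lambda>x. ennreal (w x))) (\<lambda>x. ennreal (1 / w x)) = \<mu>"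
proof -
  have "ennreal (w x) * ennreal (1 / w x) = 1" for x
    using pos[of x] by (simp add: ennreal_mult'[symmetric] less_imp_le)
  then show ?thesis by (subst density_density_eq) (auto simp: density_1)
qed

text \<open>The potentials of the Gaussian kernel are, up to a factor, Laplace transforms.\<close>
lemma measure_eq_if_kernel_potential_eq:
  fixes \<mu> \<nu> :: "'a::{real_inner,polish_space} measure"
  assumes \<epsilon>: "\<epsilon> > 0"
    and sets [measurable_cong]: "sets \<mu> = sets borel" "sets \<nu> = sets borel"
    and u [measurable]: "u \<in> borel_measurable borel" and pos: "\<And>x. u x > 0"
    and eq: "\<And>x. kernel_potential \<epsilon> \<mu> u x = kernel_potential \<epsilon> \<nu> u x"
    and fin: "\<And>x. kernel_potential \<epsilon> \<mu> u x < \<infinity>"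
  shows "\<mu> = \<nu>"
proof -
  define w where "w y = u y * exp (- (norm y)\<^sup>2 / \<epsilon>)" for y
  have [measurable]: "w \<in> borel_measurable borel" unfolding w_def by measurable
  have w_pos: "w y > 0" for y using pos by (simp add: w_def)
  let ?D = "\<lambda>L. density L (\<lambda>y. ennreal (w y))"
  \<comment> \<open>Evaluation at (epsilon / 2) x cancels the 2 / epsilon in the exponent of
    \<open>gauss_kernel_factor\<close>.\<close>
  have lap: "(\<integral>\<^sup>+y. ennreal (exp (x \<bullet> y)) \<partial>?D L)
      = ennreal (exp ((norm ((\<epsilon> / 2) *\<^sub>R x))\<^sup>2 / \<epsilon>)) * kernel_potential \<epsilon> L u ((\<epsilon> / 2) *\<^sub>R x)"
    if [measurable_cong]: "sets L = sets borel" for L x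
  proof -
    have k: "w y * exp (x \<bullet> y) = exp ((norm ((\<epsilon> / 2) *\<^sub>R x))\<^sup>2 / \<epsilon>) * (u y * gauss_kernel \<epsilon> ((\<epsilon> / 2) *\<^sub>R x) y)" for y
    proof -
      have "exp ((norm ((\<epsilon> / 2) *\<^sub>R x))\<^sup>2 / \<epsilon>) * exp (- (norm ((\<epsilon> / 2) *\<^sub>R x))\<^sup>2 / \<epsilon>) = 1"
        by (simp add: mult_exp_exp)
      then show ?thesis
        unfolding w_def gauss_kernel_factor using \<epsilon>
        by (simp add: mult_ac)
    qed
    have "(\<integral>\<^sup>+y. ennreal (exp (x \<bullet> y)) \<partial>?D L) = (\<integral>\<^sup>+y. ennreal (w y * exp (x \<bullet> y)) \<partial>L)"
      by (subst nn_integral_density) (auto simp: ennreal_mult' less_imp_le[OF w_pos])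
    also have "\<dots> = ennreal (exp ((norm ((\<epsilon> / 2) *\<^sub>R x))\<^sup>2 / \<epsilon>)) * kernel_potential \<epsilon> L u ((\<epsilon> / 2) *\<^sub>R x)"
      unfolding k kernel_potential_def
      by (subst nn_integral_cmult[symmetric]) (auto simp: ennreal_mult')
    finally show ?thesis .
  qed
  have "?D \<mu> = ?D \<nu>"
    by (rule measure_eq_if_laplace_transform_eq)
       (use eq fin in \<open>auto simp: sets lap ennreal_mult_less_top\<close>)
  then have "density (?D \<mu>) (\<lambda>y. ennreal (1 / w y)) = density (?D \<nu>) (\<lambda>y. ennreal (1 / w y))" by simp
  then show ?thesis using w_pos by (simp add: density_reciprocal)
qed

text \<open>The potential equation gives energy 1, as u * (1 / u) = 1. The defect 1 - Z of weak
  duality then vanishes and the two bounds on the cost coincide.\<close>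

lemma self_schroedinger_potential:
  fixes \<mu> :: "'a::{real_inner,polish_space} measure"
  assumes \<epsilon>: "\<epsilon> > 0" and prob: "prob_space \<mu>" and sets: "sets \<mu> = sets borel"
    and m2: "integrable \<mu> (\<lambda>x. (norm x)\<^sup>2)"
  obtains u where "u \<in> borel_measurable borel" "\<And>x. u x > 0" "integrable \<mu> (\<lambda>x. ln (u x))"
    "\<And>x. kernel_potential \<epsilon> \<mu> u x = ennreal (1 / u x)" "kernel_pairing \<epsilon> \<mu> u \<mu> u = 1"
    "OT_eps \<epsilon> \<mu> \<mu> = ereal (\<epsilon> * (2 * (\<integral>x. ln (u x) \<partial>\<mu>)))"
proof -
  interpret prob_space \<mu> by fact
  interpret self_transport \<mu> \<epsilon>
    using assms by (auto simp: self_transport_def self_transport_axioms_def)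
  obtain u where u: "u \<in> borel_measurable borel" "\<And>x. u x > 0" "integrable \<mu> (\<lambda>x. ln (u x))"
    "\<And>x. kernel_potential \<epsilon> \<mu> u x = ennreal (1 / u x)"
    using self_potential_exists by blast
  have "ennreal (u x) * ennreal (1 / u x) = 1" for x
    using u(2)[of x] by (simp add: ennreal_mult'[symmetric] less_imp_le)
  then have pair: "kernel_pairing \<epsilon> \<mu> u \<mu> u = 1"
    by (simp add: kernel_pairing_def u(4) emeasure_space_1)
  have "ereal (\<epsilon> * ((\<integral>x. ln (u x) \<partial>\<mu>) + (\<integral>x. ln (u x) \<partial>\<mu>) + 1 - 1)) \<le> OT_eps \<epsilon> \<mu> \<mu>"
    using pair by (intro OT_eps_weak_duality[OF \<epsilon> prob prob sets sets u(1) u(1) u(2) u(2) u(3) u(3)]) auto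
  then have "OT_eps \<epsilon> \<mu> \<mu> = ereal (\<epsilon> * (2 * (\<integral>x. ln (u x) \<partial>\<mu>)))"
    using OT_eps_self_upper[OF \<epsilon> prob sets m2 u] by (intro antisym) (simp_all add: algebra_simps)
  then show thesis using that u pair by blast
qed

text \<open>Here \<open>u \<mu> - v \<nu>\<close> has energy 0; perturbing it by a small multiple of \<open>\<delta>\<^sub>z\<close> shows that its
  potential at \<open>z\<close> has a sign.\<close>
lemma kernel_potential_le_if_pairing_one:
  fixes \<mu> \<nu> :: "'a::{real_inner,polish_space} measure"
  assumes \<epsilon>: "\<epsilon> > 0" and prob: "prob_space \<mu>" "prob_space \<nu>"
    and sets: "sets \<mu> = sets borel" "sets \<nu> = sets borel"
    and meas: "u \<in> borel_measurable borel" "v \<in> borel_measurable borel"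
    and pos: "\<And>x. u x > 0" "\<And>x. v x > 0"
    and pot: "\<And>x. kernel_potential \<epsilon> \<mu> u x = ennreal (1 / u x)" "\<And>x. kernel_potential \<epsilon> \<nu> v x = ennreal (1 / v x)"
    and one: "kernel_pairing \<epsilon> \<mu> u \<mu> u = 1" "kernel_pairing \<epsilon> \<nu> v \<nu> v = 1" "kernel_pairing \<epsilon> \<mu> u \<nu> v = 1"
  shows "1 / v z \<le> 1 / u z"
proof (rule field_le_epsilon)
  fix e :: real assume "e > 0"
  \<comment> \<open>With t = e the Dirac energy e^2 costs only e / 2 after division by 2 e.\<close>
  have *: "2 * kernel_pairing \<epsilon> \<mu> u \<nu> v + ennreal (2 * e) * kernel_potential \<epsilon> \<nu> v z
    \<le> kernel_pairing \<epsilon> \<mu> u \<mu> u + kernel_pairing \<epsilon> \<nu> v \<nu> v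
      + ennreal (2 * e) * kernel_potential \<epsilon> \<mu> u z + ennreal (e\<^sup>2)"
    using assms \<open>e > 0\<close> by (intro kernel_pairing_polarization) (auto simp: less_imp_le)
  have "ennreal (2 + 2 * e * (1 / v z)) \<le> ennreal (2 + 2 * e * (1 / u z) + e\<^sup>2)"
  proof -
    have "ennreal (2 + 2 * e * (1 / v z)) = 2 * 1 + ennreal (2 * e) * ennreal (1 / v z)"
      "ennreal (2 + 2 * e * (1 / u z) + e\<^sup>2) = 1 + 1 + ennreal (2 * e) * ennreal (1 / u z) + ennreal (e\<^sup>2)"
      using \<open>e > 0\<close> pos[of z]
      by (simp_all add: ennreal_plus ennreal_mult[symmetric] less_imp_le del: times_divide_eq_right)
    then show ?thesis using * unfolding one pot by simp
  qed
  then have "2 + 2 * e * (1 / v z) \<le> 2 + 2 * e * (1 / u z) + e\<^sup>2"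
    using \<open>e > 0\<close> pos[of z] by (subst (asm) ennreal_le_iff) (auto simp: less_imp_le)
  then have "(2 * e) * (1 / v z) \<le> (2 * e) * (1 / u z + e / 2)"
    by (simp add: algebra_simps power2_eq_square)
  then have "1 / v z \<le> 1 / u z + e / 2" using \<open>e > 0\<close> by (subst (asm) mult_le_cancel_left_pos) auto
  then show "1 / v z \<le> 1 / u z + e" using \<open>e > 0\<close> by simp
qed

theorem mainTheorem9:
  fixes \<mu>0 \<mu>1 :: "('a::{real_inner,polish_space}) measure" and \<epsilon> :: real
  assumes "\<epsilon> > 0" and "gaussian_measure \<mu>0" and "gaussian_measure \<mu>1"
  shows "sinkhorn \<epsilon> \<mu>0 \<mu>1 \<ge> 0 \<and> (sinkhorn \<epsilon> \<mu>0 \<mu>1 = 0 \<longleftrightarrow> \<mu>0 = \<mu>1)"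
proof -
  have prob: "prob_space \<mu>0" "prob_space \<mu>1" and sets: "sets \<mu>0 = sets borel" "sets \<mu>1 = sets borel"
    using assms by (auto simp: gaussian_measure_def)
  obtain u where u: "u \<in> borel_measurable borel" "\<And>x. u x > 0" "integrable \<mu>0 (\<lambda>x. ln (u x))"
    "\<And>x. kernel_potential \<epsilon> \<mu>0 u x = ennreal (1 / u x)" "kernel_pairing \<epsilon> \<mu>0 u \<mu>0 u = 1"
    "OT_eps \<epsilon> \<mu>0 \<mu>0 = ereal (\<epsilon> * (2 * (\<integral>x. ln (u x) \<partial>\<mu>0)))"
    using self_schroedinger_potential[OF assms(1) prob(1) sets(1) gaussian_measure_second_moment[OF assms(2)]] by blast
  obtain v where v: "v \<in> borel_measurable borel" "\<And>x. v x > 0" "integrable \<mu>1 (\<lambda>x. ln (v x))"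
    "\<And>x. kernel_potential \<epsilon> \<mu>1 v x = ennreal (1 / v x)" "kernel_pairing \<epsilon> \<mu>1 v \<mu>1 v = 1"
    "OT_eps \<epsilon> \<mu>1 \<mu>1 = ereal (\<epsilon> * (2 * (\<integral>x. ln (v x) \<partial>\<mu>1)))"
    using self_schroedinger_potential[OF assms(1) prob(2) sets(2) gaussian_measure_second_moment[OF assms(3)]] by blast
  let ?U = "\<integral>x. ln (u x) \<partial>\<mu>0" and ?V = "\<integral>x. ln (v x) \<partial>\<mu>1"
  \<comment> \<open>At t = 0 polarisation is Cauchy-Schwarz for two unit vectors; the base point 0
    is arbitrary.\<close>
  have "2 * kernel_pairing \<epsilon> \<mu>0 u \<mu>1 v + ennreal (2 * 0) * kernel_potential \<epsilon> \<mu>1 v 0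
    \<le> kernel_pairing \<epsilon> \<mu>0 u \<mu>0 u + kernel_pairing \<epsilon> \<mu>1 v \<mu>1 v
      + ennreal (2 * 0) * kernel_potential \<epsilon> \<mu>0 u 0 + ennreal (0\<^sup>2)"
    using assms(1) prob sets u v by (intro kernel_pairing_polarization) (auto simp: less_imp_le)
  then have le: "2 * kernel_pairing \<epsilon> \<mu>0 u \<mu>1 v \<le> 2" using u(5) v(5) by simp
  then have "kernel_pairing \<epsilon> \<mu>0 u \<mu>1 v \<noteq> \<infinity>" by (auto simp: ennreal_mult_top top_unique)
  then obtain Z where Z: "kernel_pairing \<epsilon> \<mu>0 u \<mu>1 v = ennreal Z" "Z \<ge> 0"
    by (cases "kernel_pairing \<epsilon> \<mu>0 u \<mu>1 v") auto
  have "ennreal (2 * Z) \<le> ennreal 2" using le Z by (simp add: ennreal_mult)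
  then have Z1: "Z \<le> 1" by (subst (asm) ennreal_le_iff) auto
  have dual: "ereal (\<epsilon> * (?U + ?V + 1 - Z)) \<le> OT_eps \<epsilon> \<mu>0 \<mu>1"
    by (rule OT_eps_weak_duality[OF assms(1) prob sets u(1) v(1) u(2) v(2) u(3) v(3) Z])
  have S: "sinkhorn \<epsilon> \<mu>0 \<mu>1 = OT_eps \<epsilon> \<mu>0 \<mu>1 - ereal (\<epsilon> * (?U + ?V))"
  proof -
    have "(ereal (\<epsilon> * (2 * ?U)) + ereal (\<epsilon> * (2 * ?V))) / 2 = ereal (\<epsilon> * (?U + ?V))"
      by (simp add: field_simps)
    then show ?thesis unfolding sinkhorn_def u(6) v(6) by simp
  qed
  \<comment> \<open>The mixed cost is known only from below here, so the value infinity is a case of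
    its own.\<close>
  have lower: "ereal (\<epsilon> * (1 - Z)) \<le> sinkhorn \<epsilon> \<mu>0 \<mu>1"
    unfolding S using dual by (cases "OT_eps \<epsilon> \<mu>0 \<mu>1") (auto simp: algebra_simps)
  have "0 \<le> \<epsilon> * (1 - Z)" using assms(1) Z1 by simp
  then have nonneg: "0 \<le> sinkhorn \<epsilon> \<mu>0 \<mu>1" using lower by (metis ereal_less_eq(5) order_trans)
  have "\<mu>0 = \<mu>1" if "sinkhorn \<epsilon> \<mu>0 \<mu>1 = 0"
  proof -
    have "\<epsilon> * (1 - Z) \<le> 0" using lower that by simp
    then have "Z = 1" using assms(1) Z1 by (simp add: mult_le_0_iff)
    then have one: "kernel_pairing \<epsilon> \<mu>0 u \<mu>1 v = 1" using Z by simp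
    moreover have "kernel_pairing \<epsilon> \<mu>1 v \<mu>0 u = 1"
      using kernel_pairing_commute[OF prob sets u(1) v(1), of \<epsilon>] u(2) v(2) one by (simp add: less_imp_le)
    ultimately have "1 / v z = 1 / u z" for z
      using kernel_potential_le_if_pairing_one[OF assms(1) prob sets u(1) v(1) u(2) v(2) u(4) v(4) u(5) v(5)]
        kernel_potential_le_if_pairing_one[OF assms(1) prob(2) prob(1) sets(2) sets(1) v(1) u(1) v(2) u(2) v(4) u(4) v(5) u(5)]
      by (intro antisym)
    \<comment> \<open>Equality as functions on the whole space: one and the same density then has
      equal potentials against both measures.\<close>
    then have "u = v" by (auto simp: fun_eq_iff)
    then show ?thesis
      using measure_eq_if_kernel_potential_eq[OF assms(1) sets u(1,2)] u(4) v(4) by simp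
  qed
  \<comment> \<open>The difference of equal costs is 0 in \<open>ereal\<close> because
    \<open>u(6)\<close> shows the cost to be finite.\<close>
  moreover have "sinkhorn \<epsilon> \<mu>0 \<mu>1 = 0" if "\<mu>0 = \<mu>1"
    using u(6) unfolding sinkhorn_def that[symmetric] by simp
  ultimately show ?thesis using nonneg by blast
qed

end
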